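(* For any $\epsilon>0$ and any positive integer $k$, there exist $\delta=\delta(\epsilon,k)>0$ and $N=N(\epsilon,k)$ such that the following holds. Suppose $n>N$ is odd and $H$ is an orientation with $n$ vertices, $\Delta(H)\le k$ and $c(H)+(3-\epsilon)f(H)-i(H)-g(H)\ge\epsilon n$. Then $R(H)\ge(1+\delta)\,n!/2^{e(H)}$.
   Context: An orientation is a digraph obtained by orienting each edge of a finite simple undirected graph $\hat H$; $\Delta(H)$ is the maximum degree of $\hat H$ and $e(H)$ the number of edges. Two edges sharing a common vertex form a consistent pair if that vertex is the tail of one and the head of the other, and an inconsistent pair if it is the tail of both or the head of both. A pair of edges with a common endpoint is induced if its two non-common endpoints are not adjacent. $c(H)$ is the number of induced consistent pairs of edges of $H$, $i(H)$ the number of induced inconsistent pairs, $f(H)$ the number of directed triangles ($C_3$) in $H$, and $g(H)$ the number of transitive triangles ($T_3$) in $H$. A tournament on an odd number $n$ of vertices is regular if all in- and out-degrees equal $(n-1)/2$. For a tournament $G$ on $n$ vertices, $G(H)$ is the number of bijections $\phi:V(H)\to V(G)$ with $(\phi(u),\phi(v))\in E(G)$ for every edge $(u,v)$ of $H$; $R(H)$ is the maximum of $G(H)$ over all regular tournaments $G$ on $n$ vertices. *)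

theory Defs
  imports Complex_Main "HOL-Library.FuncSet" "Graph_Theory.Graph_Theory"
begin

section \<open>Orientations of finite simple graphs\<close>

text \<open>Undirected simple graphs are the symmetric digraphs of Graph_Theory (\<^locale>\<open>pair_graph\<close>):
  an edge is represented by its two opposite arcs. Orienting it means keeping exactly one of them.\<close>

definition orientation_of :: "'a pair_pre_digraph \<Rightarrow> 'a pair_pre_digraph \<Rightarrow> bool" where
  "orientation_of H U \<longleftrightarrow> pverts H = pverts U \<and> parcs H \<subseteq> parcs U \<and>
     (\<forall>u v. (u, v) \<in> parcs U \<longrightarrow> ((u, v) \<in> parcs H \<longleftrightarrow> (v, u) \<notin> parcs H))"

definition orientation :: "'a pair_pre_digraph \<Rightarrow> bool" where
  "orientation H \<longleftrightarrow> (\<exists>U. pair_graph U \<and> orientation_of H U)"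

definition underlying :: "'a pair_pre_digraph \<Rightarrow> 'a pair_pre_digraph" where
  "underlying H = mk_symmetric (with_proj H)"

lemma parcs_underlying: "(u, v) \<in> parcs (underlying H) \<longleftrightarrow> (u, v) \<in> parcs H \<or> (v, u) \<in> parcs H"
  by (auto simp: underlying_def mk_symmetric_def intro: bexI[of _ "(v, u)"])

lemma underlying_eq:
  assumes "pair_graph U" "orientation_of H U"
  shows "underlying H = U"
proof -
  interpret pair_graph U by fact
  have "sym (parcs U)"
    using pair_sym_arcs by (simp add: symmetric_def)
  then have "parcs (underlying H) = parcs U"
    using assms(2) unfolding orientation_of_def
    by (simp add: set_eq_iff parcs_underlying subset_eq split_paired_all) (meson symD)
  moreover have "pverts (underlying H) = pverts U"
    using assms(2) by (simp add: orientation_of_def underlying_def mk_symmetric_def)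
  ultimately show ?thesis by simp
qed

lemma orientation_iff:
  "orientation H \<longleftrightarrow> pair_digraph H \<and> (\<forall>u v. (u, v) \<in> parcs H \<longrightarrow> (v, u) \<notin> parcs H)"
proof
  assume "orientation H"
  then obtain U where U: "pair_graph U" "orientation_of H U" by (auto simp: orientation_def)
  interpret U: pair_graph U by (rule U)
  have sub: "parcs H \<subseteq> parcs U" "pverts H = pverts U"
    using U(2) by (auto simp: orientation_of_def)
  have fin: "finite (parcs H)" "finite (pverts H)"
    using finite_subset[OF sub(1) U.pair_finite_arcs] sub(2) U.pair_finite_verts by simp_all
  have arc: "fst e \<in> pverts H" "snd e \<in> pverts H" "fst e \<noteq> snd e" if "e \<in> parcs H" for e
    using that sub U.arc_fst_in_verts[of e] U.arc_snd_in_verts[of e] U.pair_no_loops[of e] by blast+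
  have "pair_digraph H"
    by unfold_locales (fact fin arc)+
  then show "pair_digraph H \<and> (\<forall>u v. (u, v) \<in> parcs H \<longrightarrow> (v, u) \<notin> parcs H)"
    using U(2) by (auto simp: orientation_of_def)
next
  assume H: "pair_digraph H \<and> (\<forall>u v. (u, v) \<in> parcs H \<longrightarrow> (v, u) \<notin> parcs H)"
  then interpret H: pair_digraph H by simp
  have arcs: "parcs (underlying H) = parcs H \<union> (parcs H)\<inverse>"
    by (auto simp: parcs_underlying)
  have verts: "pverts (underlying H) = pverts H"
    by (simp add: underlying_def mk_symmetric_def)
  have irrefl: "(u, u) \<notin> parcs H" for u
    using H.pair_no_loops[of "(u, u)"] by auto
  have "pair_graph (underlying H)"
    using H.in_arcsD1 H.in_arcsD2 H.pair_finite_verts H.pair_finite_arcs irrefl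
    by unfold_locales (auto simp: arcs verts symmetric_def sym_def)
  moreover have "orientation_of H (underlying H)"
    using H by (auto simp: orientation_of_def arcs verts)
  ultimately show "orientation H" by (auto simp: orientation_def)
qed

abbreviation adjacent :: "'a pair_pre_digraph \<Rightarrow> 'a \<Rightarrow> 'a \<Rightarrow> bool" where
  "adjacent H u v \<equiv> (u, v) \<in> parcs (underlying H)"

text \<open>In the symmetric digraph \<^term>\<open>underlying H\<close>, the out-degree of a vertex is the number of
  edges of the undirected graph at that vertex.\<close>

definition max_degree :: "'a pair_pre_digraph \<Rightarrow> nat" where
  "max_degree H = Max ((\<lambda>v. out_degree (with_proj (underlying H)) v) ` pverts H)"

definition num_edges :: "'a pair_pre_digraph \<Rightarrow> nat" where
  "num_edges H = card (parcs H)"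

section \<open>Pairs of edges and triangles\<close>

text \<open>Pairs of edges are unordered, and triangles are counted as subgraphs; both are represented by
  their sets of arcs. In an orientation the vertices \<^term>\<open>u\<close>, \<^term>\<open>v\<close>, \<^term>\<open>w\<close> in
  the definitions of \<open>induced_consistent_pairs\<close>, \<open>directed_triangles\<close> and
  \<open>transitive_triangles\<close> are automatically distinct.\<close>

definition induced_consistent_pairs :: "'a pair_pre_digraph \<Rightarrow> ('a \<times> 'a) set set" where
  "induced_consistent_pairs H =
     {{(u, v), (v, w)} | u v w. (u, v) \<in> parcs H \<and> (v, w) \<in> parcs H \<and> \<not> adjacent H u w}"

definition induced_inconsistent_pairs :: "'a pair_pre_digraph \<Rightarrow> ('a \<times> 'a) set set" where
  "induced_inconsistent_pairs H =
     {{(v, u), (v, w)} | u v w. u \<noteq> w \<and> (v, u) \<in> parcs H \<and> (v, w) \<in> parcs H \<and> \<not> adjacent H u w} \<union>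
     {{(u, v), (w, v)} | u v w. u \<noteq> w \<and> (u, v) \<in> parcs H \<and> (w, v) \<in> parcs H \<and> \<not> adjacent H u w}"

definition directed_triangles :: "'a pair_pre_digraph \<Rightarrow> ('a \<times> 'a) set set" where
  "directed_triangles H =
     {{(u, v), (v, w), (w, u)} | u v w. (u, v) \<in> parcs H \<and> (v, w) \<in> parcs H \<and> (w, u) \<in> parcs H}"

definition transitive_triangles :: "'a pair_pre_digraph \<Rightarrow> ('a \<times> 'a) set set" where
  "transitive_triangles H =
     {{(u, v), (v, w), (u, w)} | u v w. (u, v) \<in> parcs H \<and> (v, w) \<in> parcs H \<and> (u, w) \<in> parcs H}"

definition num_c :: "'a pair_pre_digraph \<Rightarrow> nat" where
  "num_c H = card (induced_consistent_pairs H)"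

definition num_i :: "'a pair_pre_digraph \<Rightarrow> nat" where
  "num_i H = card (induced_inconsistent_pairs H)"

definition num_f :: "'a pair_pre_digraph \<Rightarrow> nat" where
  "num_f H = card (directed_triangles H)"

definition num_g :: "'a pair_pre_digraph \<Rightarrow> nat" where
  "num_g H = card (transitive_triangles H)"

section \<open>Copies in regular tournaments\<close>

definition tournament :: "'a pair_pre_digraph \<Rightarrow> bool" where
  "tournament G \<longleftrightarrow> orientation G \<and>
     (\<forall>u\<in>pverts G. \<forall>v\<in>pverts G. u \<noteq> v \<longrightarrow> adjacent G u v)"

definition regular_tournament :: "'a pair_pre_digraph \<Rightarrow> bool" where
  "regular_tournament G \<longleftrightarrow> tournament G \<and> odd (card (pverts G)) \<and>
     (\<forall>v\<in>pverts G. in_degree (with_proj G) v = (card (pverts G) - 1) div 2 \<and>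
                    out_degree (with_proj G) v = (card (pverts G) - 1) div 2)"

text \<open>Bijections are taken extensional (\<^const>\<open>PiE\<close>), so that each one is counted once.\<close>

definition arc_preserving_bijections ::
  "'a pair_pre_digraph \<Rightarrow> 'b pair_pre_digraph \<Rightarrow> ('a \<Rightarrow> 'b) set" where
  "arc_preserving_bijections H G =
     {\<phi> \<in> PiE (pverts H) (\<lambda>_. pverts G). bij_betw \<phi> (pverts H) (pverts G) \<and>
        (\<forall>u v. (u, v) \<in> parcs H \<longrightarrow> (\<phi> u, \<phi> v) \<in> parcs G)}"

definition num_copies :: "'b pair_pre_digraph \<Rightarrow> 'a pair_pre_digraph \<Rightarrow> nat" where
  "num_copies G H = card (arc_preserving_bijections H G)"

text \<open>Up to isomorphism, every tournament has natural numbers as vertices. The set of values is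
  finite (each is at most \<open>n!\<close>), and it is nonempty for odd \<open>n\<close> (rotational tournaments).\<close>

definition max_copies :: "'a pair_pre_digraph \<Rightarrow> nat" where
  "max_copies H = Max {num_copies G H | G :: nat pair_pre_digraph.
     regular_tournament G \<and> card (pverts G) = card (pverts H)}"

end

theory Submission
  imports Defs "HOL-Combinatorics.Transposition"
begin

text \<open>Every pair of adjacent arcs of \<open>H\<close> that is not induced lies in exactly one triangle, and so
  \<open>c + 3f - i - g\<close> is the number of all consistent adjacent pairs minus the number of all inconsistent
  ones. In a random regular tournament a consistent pair is slightly more likely, and an inconsistent
  pair slightly less likely, than for independent arcs, by a relative amount of about \<open>1/n\<close>.

  The random tournament is chosen so that its arcs are independent up to local corrections: all
  vertices except one vertex \<open>p\<close> are split into blocks of bounded even size, and each bipartite graph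
  between two blocks and each clique formed by a block and \<open>p\<close> receives, independently, a uniformly
  random balanced orientation. By symmetry, two adjacent arcs in a bipartite part of side length \<open>a\<close>
  have correlation \<open>1/(a - 1)\<close> up to sign. For a random placement of \<open>H\<close>, the normalised
  probability of containment is a product over the parts; it is bounded below by one plus the sum of
  the logarithms of its factors, so that only first moments over the placement are needed. Parts with
  two arcs contribute the correlations, which add up to at least \<open>\<epsilon>/2\<close>. Parts with more arcs are
  rare, and each of them costs only a constant, because any orientation of bounded degree extends to
  a balanced orientation of a large bipartite part or clique.\<close>

section \<open>Balanced orientations\<close>

text \<open>The gain and the errors scale differently in the block size, which fixes the order of
  the constants. A consistent pair contributes its correlation, about \<open>1/a\<close>, only when
  its outer ends fall into one block of size \<open>a\<close> and its middle vertex into another;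
  this has probability about \<open>a/n\<close>. The product is of order \<open>1/n\<close> whatever
  \<open>a\<close> is, so \<open>\<epsilon> n\<close> net pairs give a gain independent of
  \<open>m\<close>. The quadratic error of the logarithm carries one more factor \<open>1/a\<close>,
  and a large \<open>m\<close>, depending on \<open>\<epsilon>\<close> and \<open>k\<close> only,
  makes it small. Overfull parts cost a power of \<open>m\<close> divided by \<open>n\<close>; they
  are dealt with last, by taking \<open>n\<close> large.

  Disjoint arcs in one part are correlated too, and there may be of order \<open>n^2\<close> pairs
  of disjoint arcs. Their signed correlations cancel on average, so that only their squares remain.

  The vertex \<open>p\<close> exists for parity. Balance requires even degrees: bipartite parts need
  even sides, cliques need an odd number of vertices, and \<open>n\<close> itself is odd.\<close>

definition arc_sign :: "('v \<times> 'v) set \<Rightarrow> 'v \<times> 'v \<Rightarrow> int" where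
  "arc_sign A e = of_bool (e \<in> A) - of_bool (prod.swap e \<in> A)"

definition orients :: "('v \<times> 'v) set \<Rightarrow> ('v \<times> 'v) set \<Rightarrow> bool" where
  "orients A D \<longleftrightarrow> A \<subseteq> D \<and> (\<forall>x y. (x, y) \<in> D \<longrightarrow> ((x, y) \<in> A \<longleftrightarrow> (y, x) \<notin> A))"

definition balanced :: "'v set \<Rightarrow> ('v \<times> 'v) set \<Rightarrow> ('v \<times> 'v) set set" where
  "balanced V D = {A. orients A D \<and> (\<forall>x\<in>V. (\<Sum>y\<in>V. arc_sign A (x, y)) = 0)}"

text \<open>By skew-symmetry. It makes the total excess of a vertex set depend on its boundary arcs
  only.\<close>

lemma sum_arc_sign_square:
  assumes "finite S"
  shows "(\<Sum>x\<in>S. \<Sum>y\<in>S. arc_sign A (x, y)) = 0"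
proof -
  have "(\<Sum>x\<in>S. \<Sum>y\<in>S. arc_sign A (x, y)) = (\<Sum>y\<in>S. \<Sum>x\<in>S. arc_sign A (x, y))"
    by (rule sum.swap)
  also have "\<dots> = (\<Sum>y\<in>S. \<Sum>x\<in>S. - arc_sign A (y, x))"
    by (intro sum.cong refl) (simp add: arc_sign_def)
  finally show ?thesis by (simp add: sum_negf)
qed

lemma sum_of_bool_pair:
  assumes "finite S" "finite T"
  shows "(\<Sum>x\<in>S. \<Sum>y\<in>T. of_bool ((x, y) \<in> A)) = int (card (A \<inter> S \<times> T))"
proof -
  have "(\<Sum>x\<in>S. \<Sum>y\<in>T. of_bool ((x, y) \<in> A)) = (\<Sum>e\<in>S \<times> T. of_bool (e \<in> A))"
    by (simp add: sum.cartesian_product case_prod_unfold)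
  also have "\<dots> = int (card (A \<inter> S \<times> T))"
    using assms by (simp add: Int_commute)
  finally show ?thesis .
qed

lemma sum_of_bool_pair':
  assumes "finite S" "finite T"
  shows "(\<Sum>x\<in>S. \<Sum>y\<in>T. of_bool ((y, x) \<in> A)) = int (card (A \<inter> T \<times> S))"
  using sum_of_bool_pair[OF assms(2,1), of A] by (subst sum.swap) simp

lemma card_orients_cut:
  assumes "orients A D" "\<And>x y. (x, y) \<in> D \<Longrightarrow> (y, x) \<in> D" "finite S" "finite T"
  shows "card (D \<inter> S \<times> T) = card (A \<inter> S \<times> T) + card (A \<inter> T \<times> S)"
proof -
  have eq: "D \<inter> S \<times> T = (A \<inter> S \<times> T) \<union> prod.swap ` (A \<inter> T \<times> S)"
  proof (intro set_eqI iffI)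
    fix e assume e: "e \<in> D \<inter> S \<times> T"
    obtain x y where [simp]: "e = (x, y)" by (cases e)
    show "e \<in> (A \<inter> S \<times> T) \<union> prod.swap ` (A \<inter> T \<times> S)"
    proof (cases "e \<in> A")
      case False
      then have "(y, x) \<in> A" using assms(1) e by (auto simp: orients_def)
      then have "(y, x) \<in> A \<inter> T \<times> S" using e by auto
      then show ?thesis by force
    qed (use e in auto)
  next
    fix e assume "e \<in> (A \<inter> S \<times> T) \<union> prod.swap ` (A \<inter> T \<times> S)"
    then obtain x y where e: "e = (x, y)" "x \<in> S" "y \<in> T" "(x, y) \<in> A \<or> (y, x) \<in> A" by auto
    then show "e \<in> D \<inter> S \<times> T" using assms(1) assms(2)[of y x] by (auto simp: orients_def)
  qed
  have disj: "(A \<inter> S \<times> T) \<inter> prod.swap ` (A \<inter> T \<times> S) = {}"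
    using assms(1) by (auto simp: orients_def)
  have "card (prod.swap ` (A \<inter> T \<times> S)) = card (A \<inter> T \<times> S)"
    by (intro card_image) (auto intro: inj_onI)
  then show ?thesis
    unfolding eq using disj assms(3,4) by (subst card_Un_disjoint) auto
qed

section \<open>Moving imbalance along a path\<close>

lemma reverse_arc:
  assumes "finite V" "orients A D" "(a, b) \<in> A" "a \<in> V" "b \<in> V" "(b, a) \<in> D" "a \<noteq> b"
  defines "A' \<equiv> insert (b, a) (A - {(a, b)})"
  shows "orients A' D"
    and "\<And>x. x \<in> V \<Longrightarrow> (\<Sum>y\<in>V. arc_sign A' (x, y)) =
      (\<Sum>y\<in>V. arc_sign A (x, y)) - 2 * of_bool (x = a) + 2 * of_bool (x = b)"
proof -
  have ba: "(b, a) \<notin> A" using assms by (auto simp: orients_def)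
  show "orients A' D" using assms by (auto simp: orients_def)
  fix x assume x: "x \<in> V"
  have *: "arc_sign A' (x, y) = arc_sign A (x, y) - 2 * of_bool (x = a) * of_bool (y = b)
      + 2 * of_bool (x = b) * of_bool (y = a)" for y
    using ba assms(3,7)
    by (cases "x = a"; cases "x = b"; cases "y = a"; cases "y = b") (simp_all add: arc_sign_def A'_def)
  have "(\<Sum>y\<in>V. 2 * of_bool (x = a) * of_bool (y = b) :: int) = 2 * of_bool (x = a)"
    using assms by (simp add: sum_distrib_left[symmetric] Int_insert_right)
  moreover have "(\<Sum>y\<in>V. 2 * of_bool (x = b) * of_bool (y = a) :: int) = 2 * of_bool (x = b)"
    using assms by (simp add: sum_distrib_left[symmetric] Int_insert_right)
  ultimately show "(\<Sum>y\<in>V. arc_sign A' (x, y)) =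
      (\<Sum>y\<in>V. arc_sign A (x, y)) - 2 * of_bool (x = a) + 2 * of_bool (x = b)"
    unfolding * by (simp add: sum.distrib sum_subtractf)
qed

text \<open>At an inner vertex one incoming and one outgoing arc exchange their roles, so only the
  two ends of the path notice the reversal. The path avoids \<open>F\<close>, hence the prescribed
  arcs survive.\<close>

lemma reverse_path:
  assumes "finite V" "\<And>x y. (x, y) \<in> D \<Longrightarrow> (y, x) \<in> D" "\<And>x y. (x, y) \<in> F \<Longrightarrow> (y, x) \<notin> F"
    and "p \<noteq> []" "distinct p" "set p \<subseteq> V" "successively (\<lambda>a b. (a, b) \<in> A - F) p"
    and "orients A D" "F \<subseteq> A"
  shows "\<exists>A'. orients A' D \<and> F \<subseteq> A' \<and> (\<forall>x\<in>V. (\<Sum>y\<in>V. arc_sign A' (x, y)) =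
      (\<Sum>y\<in>V. arc_sign A (x, y)) - 2 * of_bool (x = hd p) + 2 * of_bool (x = last p))"
  using assms(4-)
proof (induction p arbitrary: A rule: induct_list012)
  case (3 a b p)
  note pr = "3.prems"
  define A' where "A' = insert (b, a) (A - {(a, b)})"
  have ab: "(a, b) \<in> A" "(a, b) \<notin> F" "a \<in> V" "b \<in> V" "a \<noteq> b" using pr(2-4) by auto
  have "(a, b) \<in> D" using pr(5) ab(1) by (auto simp: orients_def)
  then have D: "(b, a) \<in> D" by (rule assms(2))
  have rev: "orients A' D" "\<And>x. x \<in> V \<Longrightarrow> (\<Sum>y\<in>V. arc_sign A' (x, y)) =
      (\<Sum>y\<in>V. arc_sign A (x, y)) - 2 * of_bool (x = a) + 2 * of_bool (x = b)"
    using reverse_arc[OF assms(1) pr(5) ab(1,3,4) D ab(5)] unfolding A'_def by blast+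
  \<comment> \<open>The path is distinct, so its later arcs do not involve \<open>a\<close> and are
    still present after \<open>(a, b)\<close> has been reversed.\<close>
  have suc: "successively (\<lambda>a b. (a, b) \<in> A' - F) (b # p)"
  proof -
    have "successively (\<lambda>a b. (a, b) \<in> A - F) (b # p)" using pr(4) by simp
    then show ?thesis
      by (rule successively_mono) (use pr(2) in \<open>auto simp: A'_def\<close>)
  qed
  have FA': "F \<subseteq> A'" using pr(6) ab(2) by (auto simp: A'_def)
  from "3.IH"(2)[OF _ _ _ suc rev(1) FA'] pr(2,3)
  obtain A'' where A'': "orients A'' D" "F \<subseteq> A''" "\<And>x. x \<in> V \<Longrightarrow>
      (\<Sum>y\<in>V. arc_sign A'' (x, y)) =
      (\<Sum>y\<in>V. arc_sign A' (x, y)) - 2 * of_bool (x = b) + 2 * of_bool (x = last (b # p))"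
    by auto
  have "\<forall>x\<in>V. (\<Sum>y\<in>V. arc_sign A'' (x, y)) =
      (\<Sum>y\<in>V. arc_sign A (x, y)) - 2 * of_bool (x = hd (a # b # p)) + 2 * of_bool (x = last (a # b # p))"
    using A''(3) rev(2) by simp
  with A''(1,2) show ?case by blast
qed auto

text \<open>Among the orientations extending \<open>F\<close>, one minimising the total imbalance is balanced:
  otherwise the set reachable from the vertices of positive excess along arcs outside \<open>F\<close> contains
  no vertex of negative excess, and its boundary violates the cut condition.\<close>

lemma balanced_extension:
  fixes V :: "'v :: linorder set"
  assumes fin: "finite V" and DV: "D \<subseteq> V \<times> V" and sym: "\<And>x y. (x, y) \<in> D \<Longrightarrow> (y, x) \<in> D"
    and irr: "\<And>x. (x, x) \<notin> D" and even_deg: "\<And>x. x \<in> V \<Longrightarrow> even (card (D \<inter> {x} \<times> V))"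
    and FD: "F \<subseteq> D" and anti: "\<And>x y. (x, y) \<in> F \<Longrightarrow> (y, x) \<notin> F"
    and cut: "\<And>S. S \<subseteq> V \<Longrightarrow> S \<noteq> {} \<Longrightarrow> S \<noteq> V \<Longrightarrow>
      2 * card (F \<inter> (V - S) \<times> S) < card (D \<inter> S \<times> (V - S))"
  shows "\<exists>A\<in>balanced V D. F \<subseteq> A"
proof -
  define exc where "exc A x = (\<Sum>y\<in>V. arc_sign A (x, y))" for A x
  define imb where "imb A = (\<Sum>x\<in>V. nat \<bar>exc A x\<bar>)" for A
  define P where "P A \<longleftrightarrow> orients A D \<and> F \<subseteq> A" for A
  \<comment> \<open>A starting orientation extending \<open>F\<close>: the free edges point upwards
    in the linear order, which is what the class \<open>linorder\<close> provides.\<close>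
  have "orients (F \<union> {(x, y) \<in> D. (y, x) \<notin> F \<and> x < y}) D"
    unfolding orients_def
  proof (intro conjI allI impI)
    fix x y assume xy: "(x, y) \<in> D"
    then have "x \<noteq> y" "(y, x) \<in> D" using irr sym[of x y] by auto
    then consider "x < y" | "y < x" by (meson linorder_neqE)
    then show "((x, y) \<in> F \<union> {(x, y) \<in> D. (y, x) \<notin> F \<and> x < y}) \<longleftrightarrow>
        ((y, x) \<notin> F \<union> {(x, y) \<in> D. (y, x) \<notin> F \<and> x < y})"
      using xy \<open>(y, x) \<in> D\<close> anti[of x y] anti[of y x] by cases auto
  qed (use FD in auto)
  then have "P (F \<union> {(x, y) \<in> D. (y, x) \<notin> F \<and> x < y})" by (simp add: P_def)
  from ex_has_least_nat[of P, OF this, of imb]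
  obtain A where A: "P A" and min: "\<And>A'. P A' \<Longrightarrow> imb A \<le> imb A'" by blast
  have orA: "orients A D" and FA: "F \<subseteq> A" using A unfolding P_def by blast+
  have exc_eq: "exc A x = int (card (A \<inter> {x} \<times> V)) - int (card (A \<inter> V \<times> {x}))" if "x \<in> V" for x
    using sum_of_bool_pair[of "{x}" V A] sum_of_bool_pair'[of "{x}" V A] fin
    by (simp add: exc_def arc_sign_def sum_subtractf)
  \<comment> \<open>Excess and degree have the same parity. A nonzero excess is therefore at least 2
    in absolute value, and a path reversal, which shifts by 2, cannot overshoot zero.\<close>
  have even_exc: "even (exc A x)" if "x \<in> V" for x
  proof -
    have "card (D \<inter> {x} \<times> V) = card (A \<inter> {x} \<times> V) + card (A \<inter> V \<times> {x})"
      using card_orients_cut[OF orA sym, of "{x}" V] fin by simp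
    then show ?thesis using even_deg[OF that] exc_eq[OF that] by auto
  qed
  have sum0: "(\<Sum>x\<in>V. exc A x) = 0"
    unfolding exc_def using sum_arc_sign_square[OF fin] .
  have "exc A x = 0" if "x \<in> V" for x
  proof (rule ccontr)
    assume "exc A x \<noteq> 0"
    have ex_pos: "\<exists>x\<in>V. exc A x > 0"
    proof (rule ccontr)
      assume "\<not> ?thesis"
      then have "\<forall>x\<in>V. 0 \<le> - exc A x" by auto
      moreover have "(\<Sum>x\<in>V. - exc A x) = 0" using sum0 by (simp add: sum_negf)
      ultimately have "\<forall>x\<in>V. - exc A x = 0" using sum_nonneg_eq_0_iff[OF fin, of "\<lambda>x. - exc A x"] by auto
      then show False using that \<open>exc A x \<noteq> 0\<close> by auto
    qed
    \<comment> \<open>Reachability is witnessed by simple paths because the witnessing path itself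
      gets reversed.\<close>
    define pth where "pth p \<longleftrightarrow> p \<noteq> [] \<and> distinct p \<and> set p \<subseteq> V \<and>
        successively (\<lambda>a b. (a, b) \<in> A - F) p \<and> exc A (hd p) > 0" for p
    define R where "R = last ` {p. pth p}"
    have RV: "R \<subseteq> V" by (auto simp: R_def pth_def)
    have pthR: "set p \<subseteq> R" if p: "pth p" for p
    proof
      fix z assume "z \<in> set p"
      then obtain q r where q: "p = q @ z # r" by (meson split_list)
      have "pth (q @ [z])"
        using p unfolding pth_def q
        by (cases q) (auto simp: successively_append_iff successively_Cons hd_append split: if_splits)
      then show "z \<in> R" unfolding R_def by force
    qed
    have posR: "x \<in> R" if "x \<in> V" "exc A x > 0" for x
      using that pthR[of "[x]"] by (auto simp: pth_def)
    have closed: "z \<in> R" if "y \<in> R" "(y, z) \<in> A - F" for y z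
    proof (rule ccontr)
      assume z: "z \<notin> R"
      obtain p where p: "pth p" "y = last p" using \<open>y \<in> R\<close> by (auto simp: R_def)
      have "z \<in> V" using that orA DV by (auto simp: orients_def)
      moreover have "z \<notin> set p" using pthR[OF p(1)] z by auto
      ultimately have "pth (p @ [z])"
        using p that by (auto simp: pth_def successively_append_iff)
      then show False using z unfolding R_def by force
    qed
    have noneg: "exc A y \<ge> 0" if yR: "y \<in> R" for y
    proof (rule ccontr)
      assume neg: "\<not> exc A y \<ge> 0"
      obtain p where p: "pth p" "y = last p" using yR by (auto simp: R_def)
      then obtain A' where A': "orients A' D" "F \<subseteq> A'" and
        exc': "\<And>x. x \<in> V \<Longrightarrow> exc A' x = exc A x - 2 * of_bool (x = hd p) + 2 * of_bool (x = y)"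
        using reverse_path[OF fin sym anti, of p A] orA FA unfolding pth_def exc_def by blast
      have h: "hd p \<in> V" "y \<in> V" "exc A (hd p) > 0" using p by (auto simp: pth_def)
      have "even (exc A (hd p))" "even (exc A y)" using even_exc h by auto
      then have h2: "exc A (hd p) \<ge> 2" "exc A y \<le> -2" using h neg by presburger+
      have "imb A' < imb A" unfolding imb_def
      proof (rule sum_strict_mono_ex1[OF fin])
        show "\<forall>x\<in>V. nat \<bar>exc A' x\<bar> \<le> nat \<bar>exc A x\<bar>"
          using exc' h2 by auto
        have "hd p \<noteq> y" using h2 by auto
        then have "nat \<bar>exc A' y\<bar> < nat \<bar>exc A y\<bar>"
          using exc'[OF h(2)] h2 by auto
        then show "\<exists>a\<in>V. nat \<bar>exc A' a\<bar> < nat \<bar>exc A a\<bar>" using h by auto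
      qed
      moreover have "imb A \<le> imb A'" using min A' by (auto simp: P_def)
      ultimately show False by simp
    qed
    define S where "S = V - R"
    have VS: "V - S = R" using RV by (auto simp: S_def)
    have fS: "finite S" "finite R" using fin RV by (auto simp: S_def finite_subset)
    have Sne: "S \<noteq> {}"
    proof
      assume "S = {}"
      then have "\<forall>x\<in>V. exc A x \<ge> 0" using noneg by (auto simp: S_def)
      then have "\<forall>x\<in>V. exc A x = 0" using sum_nonneg_eq_0_iff[OF fin, of "exc A"] sum0 by auto
      then show False using \<open>exc A x \<noteq> 0\<close> that by auto
    qed
    moreover have "S \<noteq> V" using ex_pos posR by (auto simp: S_def)
    \<comment> \<open>Only arcs of \<open>F\<close> lead from \<open>R\<close> to \<open>S\<close>,
      so by the cut condition more than half of the edges between them point out of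
      \<open>S\<close>. This makes the total excess of \<open>S\<close> positive, although no single
      vertex of \<open>S\<close> has positive excess.\<close>
    ultimately have c: "2 * card (F \<inter> R \<times> S) < card (D \<inter> S \<times> R)"
      using cut[of S] VS by (auto simp: S_def)
    have AF: "A \<inter> R \<times> S = F \<inter> R \<times> S"
      using FA closed by (auto simp: S_def)
    have "(\<Sum>x\<in>S. exc A x) \<le> 0"
      by (intro sum_nonpos) (use posR in \<open>force simp: S_def\<close>)
    moreover have "(\<Sum>x\<in>S. exc A x) = int (card (A \<inter> S \<times> R)) - int (card (A \<inter> R \<times> S))"
    proof -
      have "(\<Sum>x\<in>S. exc A x) = (\<Sum>x\<in>S. \<Sum>y\<in>S. arc_sign A (x, y)) + (\<Sum>x\<in>S. \<Sum>y\<in>R. arc_sign A (x, y))"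
        unfolding exc_def sum.distrib[symmetric]
        by (intro sum.cong refl, subst sum.union_disjoint[symmetric])
          (use fS RV in \<open>auto simp: S_def intro!: sum.cong\<close>)
      then show ?thesis
        using sum_of_bool_pair[OF fS, of A] sum_of_bool_pair'[OF fS, of A] sum_arc_sign_square[OF fS(1), of A]
        by (simp add: arc_sign_def sum_subtractf)
    qed
    moreover have "card (D \<inter> S \<times> R) = card (A \<inter> S \<times> R) + card (A \<inter> R \<times> S)"
      by (rule card_orients_cut[OF orA sym]) (use fS in auto)
    ultimately show False using c AF by simp
  qed
  then show ?thesis using orA FA unfolding balanced_def exc_def by blast
qed

section \<open>Bounded prescriptions extend in cliques and in bipartite graphs\<close>

definition clique :: "'v set \<Rightarrow> ('v \<times> 'v) set" where
  "clique W = {(x, y). x \<in> W \<and> y \<in> W \<and> x \<noteq> y}"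

definition biclique :: "'v set \<Rightarrow> 'v set \<Rightarrow> ('v \<times> 'v) set" where
  "biclique P Q = P \<times> Q \<union> Q \<times> P"

text \<open>In- and out-degrees are bounded separately because the arcs of one direction across a
  cut are counted once from their tails and once from their heads.\<close>

definition bounded_orientation :: "nat \<Rightarrow> ('v \<times> 'v) set \<Rightarrow> bool" where
  "bounded_orientation k F \<longleftrightarrow> finite F \<and> (\<forall>x y. (x, y) \<in> F \<longrightarrow> (y, x) \<notin> F) \<and>
     (\<forall>x. card (F `` {x}) \<le> k \<and> card (F\<inverse> `` {x}) \<le> k)"

lemma card_arcs_between_le:
  assumes "bounded_orientation k F" "finite R" "finite S"
  shows "card (F \<inter> R \<times> S) \<le> k * min (card R) (card S)"
proof -
  have fin: "finite (F `` {x})" "finite (F\<inverse> `` {x})" for x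
    using assms(1) by (auto simp: bounded_orientation_def intro: finite_Image)
  have "card (F \<inter> R \<times> S) \<le> card (SIGMA x:R. F `` {x})"
    by (intro card_mono) (use fin assms in auto)
  also have "\<dots> = (\<Sum>x\<in>R. card (F `` {x}))"
    using fin assms by (simp add: card_SigmaI)
  also have "\<dots> \<le> (\<Sum>x\<in>R. k)"
    by (intro sum_mono) (use assms in \<open>auto simp: bounded_orientation_def\<close>)
  finally have 1: "card (F \<inter> R \<times> S) \<le> k * card R" by (simp add: mult.commute)
  have "card (F \<inter> R \<times> S) = card (prod.swap ` (F \<inter> R \<times> S))"
    by (rule card_image[symmetric]) (auto intro: inj_onI)
  also have "\<dots> \<le> card (SIGMA x:S. F\<inverse> `` {x})"
    by (intro card_mono) (use fin assms in auto)
  also have "\<dots> = (\<Sum>x\<in>S. card (F\<inverse> `` {x}))"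
    using fin assms by (simp add: card_SigmaI)
  also have "\<dots> \<le> (\<Sum>x\<in>S. k)"
    by (intro sum_mono) (use assms in \<open>auto simp: bounded_orientation_def\<close>)
  finally have 2: "card (F \<inter> R \<times> S) \<le> k * card S" by (simp add: mult.commute)
  show ?thesis using 1 2 by (simp add: min_def)
qed

lemma clique_balanced_extension:
  fixes W :: "'v :: linorder set"
  assumes "finite W" "odd (card W)" "card W > 4 * k" "F \<subseteq> clique W" "bounded_orientation k F"
  shows "\<exists>A\<in>balanced W (clique W). F \<subseteq> A"
proof (rule balanced_extension[OF assms(1)])
  show "even (card (clique W \<inter> {x} \<times> W))" if "x \<in> W" for x
  proof -
    have "clique W \<inter> {x} \<times> W = {x} \<times> (W - {x})" using that by (auto simp: clique_def)
    then show ?thesis using assms that by (simp add: card_cartesian_product card_Diff_singleton)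
  qed
next
  fix S assume S: "S \<subseteq> W" "S \<noteq> {}" "S \<noteq> W"
  define R where "R = W - S"
  have fin: "finite S" "finite R" using assms S by (auto simp: R_def finite_subset)
  have "card S + card R = card W"
    using S assms(1) fin by (simp add: R_def card_Diff_subset card_mono)
  moreover have pos: "card S > 0" "card R > 0" using S fin by (auto simp: card_gt_0_iff R_def)
  \<comment> \<open>The longer side exceeds \<open>2 * k\<close>, so the cut, which is longer side
    times shorter side, beats \<open>2 * k\<close> times the shorter side.\<close>
  ultimately have "2 * k < max (card S) (card R)" using assms(3) by linarith
  then have "2 * k * min (card R) (card S) < max (card S) (card R) * min (card R) (card S)"
    using pos by simp
  also have "\<dots> = card S * card R" by (simp add: max_def min_def)
  also have "\<dots> = card (S \<times> R)" using fin by (simp add: card_cartesian_product)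
  also have "S \<times> R = clique W \<inter> S \<times> R" using S by (auto simp: clique_def R_def)
  finally show "2 * card (F \<inter> (W - S) \<times> S) < card (clique W \<inter> S \<times> (W - S))"
    using card_arcs_between_le[OF assms(5) fin(2,1)] unfolding R_def by linarith
qed (use assms in \<open>auto simp: clique_def bounded_orientation_def\<close>)

text \<open>If both rectangles have a side longer than \<open>2 * k\<close>, each term is dominated
  by its own rectangle, and one of them strictly. Otherwise one rectangle fits into a square of side
  \<open>2 * k\<close>; then both sides of the other exceed \<open>6 * k\<close>, and its surplus
  absorbs the deficit of the small one.\<close>

lemma cut_arithmetic:
  fixes a b a' b' k :: nat
  assumes "a + a' > 8 * k" "b + b' > 8 * k" "a + b' > 0" "a' + b > 0"
  shows "2 * k * min a b + 2 * k * min a' b' < a * b + a' * b'"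
proof -
  have prod: "x * y = max x y * min x y" for x y :: nat by (simp add: max_def min_def)
  have le: "2 * k * min x y \<le> x * y" if "max x y > 2 * k" for x y
    unfolding prod[of x y] using that by (intro mult_right_mono) auto
  have less: "2 * k * min x y < x * y" if "max x y > 2 * k" "min x y > 0" for x y
    unfolding prod[of x y] using that by (intro mult_strict_right_mono) auto
  have aux: "2 * k * min x y + 2 * k * min x' y' < x * y + x' * y'"
    if "max x y \<le> 2 * k" "x' > 6 * k" "y' > 6 * k" for x y x' y'
  proof -
    have "(6 * k + 1) * min x' y' \<le> max x' y' * min x' y'" using that by (intro mult_right_mono) auto
    then have 1: "6 * k * min x' y' + min x' y' \<le> x' * y'" by (simp add: prod[of x' y'] algebra_simps)
    have "2 * k * min x y \<le> 2 * k * min x' y'" using that by (intro mult_left_mono) auto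
    then have "2 * k * min x y + 2 * k * min x' y' \<le> 2 * k * min x' y' + 2 * k * min x' y'" by simp
    also have "\<dots> < 6 * k * min x' y' + min x' y'" using that by (simp add: min_def)
    also have "\<dots> \<le> x * y + x' * y'" using 1 by simp
    finally show ?thesis .
  qed
  consider "max a b \<le> 2 * k" | "max a' b' \<le> 2 * k" | "max a b > 2 * k" "max a' b' > 2 * k" by linarith
  then show ?thesis
  proof cases
    case 1 then show ?thesis using assms by (intro aux) auto
  next
    case 2
    then have "2 * k * min a' b' + 2 * k * min a b < a' * b' + a * b"
      using assms by (intro aux) auto
    then show ?thesis by simp
  next
    case 3
    have "min a b > 0 \<or> min a' b' > 0" using assms by auto
    then show ?thesis using le[OF 3(1)] le[OF 3(2)] less[OF 3(1)] less[OF 3(2)] by linarith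
  qed
qed

text \<open>A set \<open>S\<close> cuts the bipartite graph in two rectangles,
  \<open>S \<inter> P\<close> against \<open>Q - S\<close> and \<open>P - S\<close> against
  \<open>S \<inter> Q\<close>. One of them may be tiny or empty, so the cut condition has to be
  checked for both together.\<close>

lemma biclique_balanced_extension:
  fixes P Q :: "'v :: linorder set"
  assumes fin: "finite P" "finite Q" and "P \<inter> Q = {}" and ev: "even (card P)" "even (card Q)"
    and "card P > 8 * k" "card Q > 8 * k" and F: "F \<subseteq> biclique P Q" "bounded_orientation k F"
  shows "\<exists>A\<in>balanced (P \<union> Q) (biclique P Q). F \<subseteq> A"
proof (rule balanced_extension)
  show "even (card (biclique P Q \<inter> {x} \<times> (P \<union> Q)))" if "x \<in> P \<union> Q" for x
  proof (cases "x \<in> P")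
    case True
    then have "biclique P Q \<inter> {x} \<times> (P \<union> Q) = {x} \<times> Q"
      using assms(3) by (auto simp: biclique_def)
    then show ?thesis using ev by (simp add: card_cartesian_product)
  next
    case False
    then have "biclique P Q \<inter> {x} \<times> (P \<union> Q) = {x} \<times> P"
      using assms(3) that by (auto simp: biclique_def)
    then show ?thesis using ev by (simp add: card_cartesian_product)
  qed
next
  fix S assume S: "S \<subseteq> P \<union> Q" "S \<noteq> {}" "S \<noteq> P \<union> Q"
  have f: "finite (S \<inter> P)" "finite (Q - S)" "finite (S \<inter> Q)" "finite (P - S)" using fin by auto
  have "card (S \<inter> P) + card (P - S) = card P" "card (S \<inter> Q) + card (Q - S) = card Q"
    using card_Int_Diff[of P S] card_Int_Diff[of Q S] fin by (simp_all add: Int_commute)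
  moreover have "card (S \<inter> P) + card (S \<inter> Q) > 0" "card (P - S) + card (Q - S) > 0"
    using S fin by (auto simp: card_gt_0_iff)
  ultimately have "2 * k * min (card (S \<inter> P)) (card (Q - S)) + 2 * k * min (card (P - S)) (card (S \<inter> Q))
      < card (S \<inter> P) * card (Q - S) + card (P - S) * card (S \<inter> Q)"
    using assms(6,7) by (intro cut_arithmetic) auto
  moreover have "card (F \<inter> (P \<union> Q - S) \<times> S) \<le>
      card (F \<inter> (Q - S) \<times> (S \<inter> P)) + card (F \<inter> (P - S) \<times> (S \<inter> Q))"
  proof -
    have "F \<inter> (P \<union> Q - S) \<times> S \<subseteq> (F \<inter> (Q - S) \<times> (S \<inter> P)) \<union> (F \<inter> (P - S) \<times> (S \<inter> Q))"
      using F(1) assms(3) by (auto simp: biclique_def)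
    then have "card (F \<inter> (P \<union> Q - S) \<times> S) \<le>
        card ((F \<inter> (Q - S) \<times> (S \<inter> P)) \<union> (F \<inter> (P - S) \<times> (S \<inter> Q)))"
      using f by (intro card_mono) auto
    then show ?thesis using card_Un_le le_trans by blast
  qed
  moreover have "card (F \<inter> (Q - S) \<times> (S \<inter> P)) \<le> k * min (card (S \<inter> P)) (card (Q - S))"
    using card_arcs_between_le[OF F(2) f(2,1)] by (simp add: min.commute)
  moreover have "card (F \<inter> (P - S) \<times> (S \<inter> Q)) \<le> k * min (card (P - S)) (card (S \<inter> Q))"
    using card_arcs_between_le[OF F(2) f(4,3)] by simp
  moreover have "card (biclique P Q \<inter> S \<times> (P \<union> Q - S)) =
      card (S \<inter> P) * card (Q - S) + card (P - S) * card (S \<inter> Q)"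
  proof -
    have "biclique P Q \<inter> S \<times> (P \<union> Q - S) = (S \<inter> P) \<times> (Q - S) \<union> (S \<inter> Q) \<times> (P - S)"
      using assms(3) by (auto simp: biclique_def)
    moreover have "(S \<inter> P) \<times> (Q - S) \<inter> (S \<inter> Q) \<times> (P - S) = {}" using assms(3) by auto
    ultimately show ?thesis
      using f by (simp add: card_Un_disjoint card_cartesian_product)
  qed
  ultimately show "2 * card (F \<inter> (P \<union> Q - S) \<times> S) < card (biclique P Q \<inter> S \<times> (P \<union> Q - S))"
    by linarith
qed (use assms in \<open>auto simp: biclique_def bounded_orientation_def\<close>)

section \<open>Pair correlations in a random balanced orientation\<close>

definition arc_corr :: "'v set \<Rightarrow> ('v \<times> 'v) set \<Rightarrow> 'v \<times> 'v \<Rightarrow> 'v \<times> 'v \<Rightarrow> real" where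
  "arc_corr V D e e' =
     (\<Sum>A\<in>balanced V D. of_int (arc_sign A e * arc_sign A e')) / card (balanced V D)"

text \<open>Normalised by \<open>2 ^ card F\<close>, so that independent unbiased arcs would give the value 1.\<close>

definition containment :: "'v set \<Rightarrow> ('v \<times> 'v) set \<Rightarrow> ('v \<times> 'v) set \<Rightarrow> real" where
  "containment V D F = 2 ^ card F * card {A \<in> balanced V D. F \<subseteq> A} / card (balanced V D)"

lemma finite_balanced: "finite D \<Longrightarrow> finite (balanced V D)"
  by (rule finite_subset[of _ "Pow D"]) (auto simp: balanced_def orients_def)

lemma arc_corr_commute: "arc_corr V D e e' = arc_corr V D e' e"
  by (simp add: arc_corr_def mult.commute)

lemma arc_corr_swap: "arc_corr V D (prod.swap e) e' = - arc_corr V D e e'"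
proof -
  have "arc_sign A (prod.swap e) = - arc_sign A e" for A by (simp add: arc_sign_def)
  then show ?thesis by (simp add: arc_corr_def sum_negf)
qed

text \<open>The symmetries in use are transpositions. As \<open>\<pi>\<close> is an involution,
  taking preimages under it is its own inverse on \<open>balanced V D\<close>.\<close>

lemma balanced_invariant:
  assumes "finite V" "\<And>x. \<pi> (\<pi> x) = x" "\<pi> ` V \<subseteq> V" "\<And>x y. (x, y) \<in> D \<Longrightarrow> (\<pi> x, \<pi> y) \<in> D"
    and "A \<in> balanced V D"
  shows "map_prod \<pi> \<pi> -` A \<in> balanced V D"
proof -
  have D: "(\<pi> x, \<pi> y) \<in> D \<longleftrightarrow> (x, y) \<in> D" for x y
    using assms(4)[of x y] assms(4)[of "\<pi> x" "\<pi> y"] assms(2) by auto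
  have "(\<Sum>y\<in>V. arc_sign (map_prod \<pi> \<pi> -` A) (x, y)) = 0" if "x \<in> V" for x
  proof -
    have "(\<Sum>y\<in>V. arc_sign (map_prod \<pi> \<pi> -` A) (x, y)) = (\<Sum>y\<in>V. arc_sign A (\<pi> x, \<pi> y))"
      by (simp add: arc_sign_def)
    also have "\<dots> = (\<Sum>y\<in>V. arc_sign A (\<pi> x, y))"
      by (rule sum.reindex_bij_witness[of _ \<pi> \<pi>]) (use assms(2,3) in auto)
    also have "\<dots> = 0" using assms(3,5) that by (auto simp: balanced_def)
    finally show ?thesis .
  qed
  moreover have "orients (map_prod \<pi> \<pi> -` A) D"
    using assms(5) D unfolding balanced_def orients_def by fastforce
  ultimately show ?thesis by (simp add: balanced_def)
qed

lemma arc_corr_invariant: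
  assumes "finite V" "\<And>x. \<pi> (\<pi> x) = x" "\<pi> ` V \<subseteq> V" "\<And>x y. (x, y) \<in> D \<Longrightarrow> (\<pi> x, \<pi> y) \<in> D"
  shows "arc_corr V D (\<pi> x, \<pi> y) (\<pi> z, \<pi> w) = arc_corr V D (x, y) (z, w)"
proof -
  have *: "map_prod \<pi> \<pi> -` (map_prod \<pi> \<pi> -` A) = A" for A
    using assms(2) by (auto simp: map_prod_def)
  have "(\<Sum>A\<in>balanced V D. of_int (arc_sign A (\<pi> x, \<pi> y) * arc_sign A (\<pi> z, \<pi> w)))
      = (\<Sum>A\<in>balanced V D. of_int (arc_sign A (x, y) * arc_sign A (z, w)) :: real)"
    by (rule sum.reindex_bij_witness[of _ "\<lambda>A. map_prod \<pi> \<pi> -` A" "\<lambda>A. map_prod \<pi> \<pi> -` A"])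
      (use balanced_invariant[OF assms] * assms(2) in \<open>auto simp: arc_sign_def\<close>)
  then show ?thesis by (simp add: arc_corr_def)
qed

lemma arc_corr_self:
  assumes "e \<in> D" "balanced V D \<noteq> {}" "finite D"
  shows "arc_corr V D e e = 1"
proof -
  have "arc_sign A e * arc_sign A e = 1" if "A \<in> balanced V D" for A
    using that assms(1) by (cases e) (auto simp: balanced_def orients_def arc_sign_def)
  moreover have "card (balanced V D) > 0" using assms finite_balanced by (auto simp: card_gt_0_iff)
  ultimately show ?thesis by (simp add: arc_corr_def)
qed

text \<open>The balance condition at \<open>x\<close>, multiplied by the sign of a fixed arc and
  averaged. Together with symmetry, this linear relation determines all correlations in a bipartite
  part.\<close>

lemma arc_corr_sum_zero:
  assumes "x \<in> V"
  shows "(\<Sum>y\<in>V. arc_corr V D (x, y) e) = 0"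
proof -
  have "(\<Sum>y\<in>V. \<Sum>A\<in>balanced V D. of_int (arc_sign A (x, y) * arc_sign A e) :: real)
      = (\<Sum>A\<in>balanced V D. of_int ((\<Sum>y\<in>V. arc_sign A (x, y)) * arc_sign A e))"
    by (subst sum.swap) (simp add: sum_distrib_right)
  also have "\<dots> = 0" using assms by (intro sum.neutral) (auto simp: balanced_def)
  finally show ?thesis by (simp add: arc_corr_def sum_divide_distrib[symmetric])
qed

lemma arc_corr_outside:
  assumes "e \<notin> D" "prod.swap e \<notin> D"
  shows "arc_corr V D e e' = 0"
  using assms unfolding arc_corr_def
  by (auto simp: arc_sign_def balanced_def orients_def intro!: sum.neutral)

lemma biclique_commute: "biclique P Q = biclique Q P"
  by (auto simp: biclique_def)

lemma biclique_transpose: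
  assumes "u \<in> Q" "w \<in> Q" "P \<inter> Q = {}" "(x, y) \<in> biclique P Q"
  shows "(transpose u w x, transpose u w y) \<in> biclique P Q"
  using assms by (auto simp: biclique_def transpose_def)

lemma biclique_corr_transpose:
  assumes "finite P" "finite Q" "P \<inter> Q = {}" "u \<in> Q" "w \<in> Q"
  shows "arc_corr (P \<union> Q) (biclique P Q) (transpose u w x, transpose u w y) (transpose u w x', transpose u w y')
    = arc_corr (P \<union> Q) (biclique P Q) (x, y) (x', y')"
proof (rule arc_corr_invariant)
  show "transpose u w ` (P \<union> Q) \<subseteq> P \<union> Q" using assms(4,5) by (auto simp: transpose_def)
qed (use assms biclique_transpose[OF assms(4,5,3)] in auto)

lemma biclique_sum_zero:
  assumes "finite P" "finite Q" "P \<inter> Q = {}" "x \<in> P"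
  shows "(\<Sum>y\<in>Q. arc_corr (P \<union> Q) (biclique P Q) (x, y) e) = 0"
proof -
  have "(\<Sum>y\<in>Q. arc_corr (P \<union> Q) (biclique P Q) (x, y) e)
      = (\<Sum>y\<in>P \<union> Q. arc_corr (P \<union> Q) (biclique P Q) (x, y) e)"
    using assms by (intro sum.mono_neutral_left) (auto simp: biclique_def intro!: arc_corr_outside)
  then show ?thesis using arc_corr_sum_zero[of x "P \<union> Q"] assms by simp
qed

text \<open>Transpositions inside \<open>Q\<close> give all arcs \<open>(x, w)\<close> with
  \<open>w \<noteq> y\<close> the same correlation with \<open>(x, y)\<close>. These
  \<open>card Q - 1\<close> equal values and the value 1 of \<open>(x, y)\<close> with itself sum to
  zero.\<close>

lemma biclique_corr_adjacent:
  assumes "finite P" "finite Q" "P \<inter> Q = {}" "balanced (P \<union> Q) (biclique P Q) \<noteq> {}"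
    and "x \<in> P" "y \<in> Q" "z \<in> Q" "y \<noteq> z"
  shows "arc_corr (P \<union> Q) (biclique P Q) (x, y) (x, z) = - 1 / (real (card Q) - 1)"
proof -
  let ?c = "arc_corr (P \<union> Q) (biclique P Q)"
  have eq: "?c (x, w) (x, y) = ?c (x, z) (x, y)" if "w \<in> Q - {y}" for w
  proof -
    have "x \<noteq> w" "x \<noteq> z" using assms that by auto
    then show ?thesis using biclique_corr_transpose[OF assms(1-3), of w z x z x y] assms that by auto
  qed
  have "(\<Sum>w\<in>Q. ?c (x, w) (x, y)) = ?c (x, y) (x, y) + (\<Sum>w\<in>Q - {y}. ?c (x, w) (x, y))"
    by (rule sum.remove) (use assms in auto)
  also have "?c (x, y) (x, y) = 1"
    using assms by (intro arc_corr_self) (auto simp: biclique_def)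
  also have "(\<Sum>w\<in>Q - {y}. ?c (x, w) (x, y)) = (\<Sum>w\<in>Q - {y}. ?c (x, z) (x, y))"
    by (intro sum.cong refl eq)
  also have "\<dots> = (real (card Q) - 1) * ?c (x, z) (x, y)"
  proof -
    have "card Q > 0" using assms by (auto simp: card_gt_0_iff)
    then show ?thesis using assms by (simp add: card_Diff_singleton of_nat_diff)
  qed
  finally have "1 + (real (card Q) - 1) * ?c (x, z) (x, y) = 0"
    using biclique_sum_zero[OF assms(1-3,5)] by simp
  moreover have "card {y, z} \<le> card Q" using assms by (intro card_mono) auto
  then have "card Q \<ge> 2" using assms by simp
  ultimately show ?thesis by (simp add: arc_corr_commute[of _ _ "(x, y)"] field_simps)
qed

text \<open>In the zero sum over the arcs \<open>(x, v)\<close>, the term \<open>v = w\<close> is an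
  adjacent pair meeting in \<open>w\<close>, and the remaining terms are equal by symmetry.\<close>

lemma biclique_corr_disjoint:
  assumes "finite P" "finite Q" "P \<inter> Q = {}" "balanced (P \<union> Q) (biclique P Q) \<noteq> {}"
    and "x \<in> P" "y \<in> Q" "z \<in> P" "w \<in> Q" "x \<noteq> z" "y \<noteq> w"
  shows "arc_corr (P \<union> Q) (biclique P Q) (x, y) (z, w) = 1 / ((real (card P) - 1) * (real (card Q) - 1))"
proof -
  let ?c = "arc_corr (P \<union> Q) (biclique P Q)"
  have cP: "card P \<ge> 2" using card_mono[of P "{x, z}"] assms by simp
  have cQ: "card Q \<ge> 2" using card_mono[of Q "{y, w}"] assms by simp
  have eq: "?c (x, v) (z, w) = ?c (x, y) (z, w)" if "v \<in> Q - {w}" for v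
  proof -
    have "x \<noteq> v" "x \<noteq> y" "z \<noteq> v" "z \<noteq> y" using assms that by auto
    then show ?thesis using biclique_corr_transpose[OF assms(1-3), of v y x y z w] assms that by auto
  qed
  have "(\<Sum>v\<in>Q. ?c (x, v) (z, w)) = ?c (x, w) (z, w) + (\<Sum>v\<in>Q - {w}. ?c (x, v) (z, w))"
    by (rule sum.remove) (use assms in auto)
  also have "(\<Sum>v\<in>Q - {w}. ?c (x, v) (z, w)) = (\<Sum>v\<in>Q - {w}. ?c (x, y) (z, w))"
    by (intro sum.cong refl eq)
  also have "\<dots> = (real (card Q) - 1) * ?c (x, y) (z, w)"
    using assms cQ by (simp add: card_Diff_singleton of_nat_diff)
  \<comment> \<open>Reversing both arcs keeps the correlation and gives two arcs leaving
    \<open>w\<close>, so the adjacent case applies with \<open>P\<close> and \<open>Q\<close>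
    exchanged.\<close>
  also have "?c (x, w) (z, w) = ?c (w, x) (w, z)"
    using arc_corr_swap[of "P \<union> Q" "biclique P Q" "(x, w)" "(w, z)"]
      arc_corr_swap[of "P \<union> Q" "biclique P Q" "(z, w)" "(x, w)"]
    by (simp add: arc_corr_commute)
  also have "\<dots> = - 1 / (real (card P) - 1)"
    using biclique_corr_adjacent[of Q P w x z] assms
    by (simp add: Un_commute Int_commute biclique_commute[of Q P])
  finally have "- 1 / (real (card P) - 1) + (real (card Q) - 1) * ?c (x, y) (z, w) = 0"
    using biclique_sum_zero[OF assms(1-3,5)] by simp
  moreover have "p \<noteq> 0 \<Longrightarrow> q \<noteq> 0 \<Longrightarrow> - 1 / p + q * r = 0 \<Longrightarrow> r = 1 / (p * q)" for p q r :: real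
    by (simp add: field_simps)
  ultimately show ?thesis using cP cQ by simp
qed

text \<open>Reversing all arcs is an involution of the balanced orientations. Signs on
  \<open>D\<close> thus have mean 0, and their square is 1, so \<open>arc_corr\<close> is a genuine
  correlation coefficient.\<close>

lemma sum_arc_sign_balanced:
  assumes "\<And>x y. (x, y) \<in> D \<Longrightarrow> (y, x) \<in> D"
  shows "(\<Sum>A\<in>balanced V D. arc_sign A e) = 0"
proof -
  have conv: "A\<inverse> \<in> balanced V D" if "A \<in> balanced V D" for A
  proof -
    have "arc_sign (A\<inverse>) (x, y) = - arc_sign A (x, y)" for x y by (simp add: arc_sign_def)
    moreover have "orients (A\<inverse>) D"
      using that assms unfolding balanced_def orients_def by blast
    ultimately show ?thesis using that by (simp add: balanced_def sum_negf)
  qed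
  have "arc_sign (A\<inverse>) e = - arc_sign A e" for A by (cases e) (simp add: arc_sign_def)
  then have "(\<Sum>A\<in>balanced V D. arc_sign A e) = (\<Sum>A\<in>balanced V D. - arc_sign A e)"
    by (intro sum.reindex_bij_witness[of _ converse converse]) (use conv in auto)
  then show ?thesis by (simp add: sum_negf)
qed

lemma of_bool_arc_sign:
  assumes "A \<in> balanced V D" "e \<in> D"
  shows "of_bool (e \<in> A) = (1 + real_of_int (arc_sign A e)) / 2"
  using assms by (cases e) (auto simp: balanced_def orients_def arc_sign_def)

section \<open>Containment of few arcs, and a crude bound for many\<close>

lemma containment_empty:
  assumes "finite D" "balanced V D \<noteq> {}"
  shows "containment V D {} = 1"
  using assms finite_balanced[OF assms(1)] by (simp add: containment_def)

lemma card_filter_sum: "finite S \<Longrightarrow> real (card {A \<in> S. P A}) = (\<Sum>A\<in>S. of_bool (P A))"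
  by (simp add: Int_def)

lemma containment_singleton:
  assumes "finite D" "balanced V D \<noteq> {}" "\<And>x y. (x, y) \<in> D \<Longrightarrow> (y, x) \<in> D" "e \<in> D"
  shows "containment V D {e} = 1"
proof -
  have "real (card {A \<in> balanced V D. {e} \<subseteq> A}) = (\<Sum>A\<in>balanced V D. (1 + real_of_int (arc_sign A e)) / 2)"
    unfolding card_filter_sum[OF finite_balanced[OF assms(1)]]
    by (intro sum.cong refl) (use of_bool_arc_sign assms(4) in fastforce)
  also have "\<dots> = (card (balanced V D) + of_int (\<Sum>A\<in>balanced V D. arc_sign A e)) / 2"
    by (simp add: sum_divide_distrib[symmetric] sum.distrib)
  also have "\<dots> = card (balanced V D) / 2" using sum_arc_sign_balanced[OF assms(3)] by simp
  finally show ?thesis using assms finite_balanced[OF assms(1)] by (simp add: containment_def)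
qed

text \<open>In the product of the two factors \<open>(1 + sign) / 2\<close> the linear terms average
  to zero, and the mixed term is the correlation.\<close>

lemma containment_pair:
  assumes "finite D" "balanced V D \<noteq> {}" "\<And>x y. (x, y) \<in> D \<Longrightarrow> (y, x) \<in> D" "e \<in> D" "e' \<in> D" "e \<noteq> e'"
  shows "containment V D {e, e'} = 1 + arc_corr V D e e'"
proof -
  have *: "of_bool ({e, e'} \<subseteq> A) = (1 + real_of_int (arc_sign A e) + real_of_int (arc_sign A e')
      + of_int (arc_sign A e * arc_sign A e')) / 4" if "A \<in> balanced V D" for A
  proof -
    have "of_bool ({e, e'} \<subseteq> A) = of_bool (e \<in> A) * (of_bool (e' \<in> A) :: real)" by simp
    also have "\<dots> = (1 + real_of_int (arc_sign A e)) / 2 * ((1 + real_of_int (arc_sign A e')) / 2)"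
      using of_bool_arc_sign[OF that] assms(4,5) by metis
    finally show ?thesis by (simp add: algebra_simps)
  qed
  have "real (card {A \<in> balanced V D. {e, e'} \<subseteq> A}) = (\<Sum>A\<in>balanced V D.
      (1 + real_of_int (arc_sign A e) + real_of_int (arc_sign A e') + of_int (arc_sign A e * arc_sign A e')) / 4)"
    unfolding card_filter_sum[OF finite_balanced[OF assms(1)]]
    by (intro sum.cong refl *)
  also have "\<dots> = (card (balanced V D) + (\<Sum>A\<in>balanced V D. of_int (arc_sign A e * arc_sign A e'))) / 4"
  proof -
    have "(\<Sum>A\<in>balanced V D. real_of_int (arc_sign A e)) = 0" for e
      using sum_arc_sign_balanced[OF assms(3), where V = V and e = e] by (simp flip: of_int_sum)
    then show ?thesis by (simp add: sum_divide_distrib[symmetric] sum.distrib)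
  qed
  finally show ?thesis using assms finite_balanced[OF assms(1)]
    by (simp add: containment_def arc_corr_def field_simps)
qed

text \<open>One orientation out of at most \<open>2 ^ card D\<close> suffices. The bound depends on
  the size of the part only.\<close>

lemma containment_lower:
  assumes "finite D" "F \<subseteq> D" "\<exists>A\<in>balanced V D. F \<subseteq> A"
  shows "containment V D F \<ge> 1 / 2 ^ card D"
proof -
  have fin: "finite (balanced V D)" using assms(1) by (rule finite_balanced)
  have "card (balanced V D) \<le> card (Pow D)"
    by (intro card_mono) (use assms(1) in \<open>auto simp: balanced_def orients_def\<close>)
  then have le: "real (card (balanced V D)) \<le> 2 ^ card D" 
    using assms(1) of_nat_mono[where 'a = real] by (fastforce simp: card_Pow)
  have pos: "card (balanced V D) > 0" using assms(3) fin by (auto simp: card_gt_0_iff)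
  have "{A \<in> balanced V D. F \<subseteq> A} \<noteq> {}" using assms(3) by auto
  then have 1: "card {A \<in> balanced V D. F \<subseteq> A} \<ge> 1" using fin by (simp add: Suc_le_eq card_gt_0_iff)
  have "1 * 1 \<le> 2 ^ card F * real (card {A \<in> balanced V D. F \<subseteq> A})"
    using 1 by (intro mult_mono) auto
  then have "1 / 2 ^ card D \<le> 2 ^ card F * real (card {A \<in> balanced V D. F \<subseteq> A}) / card (balanced V D)"
    using le pos by (intro frac_le) auto
  then show ?thesis by (simp add: containment_def)
qed

section \<open>Random bijections\<close>

text \<open>The placements of \<open>H\<close>; extensional, so that they compare directly with
  \<open>arc_preserving_bijections\<close>.\<close>

definition bijections :: "'a set \<Rightarrow> 'b set \<Rightarrow> ('a \<Rightarrow> 'b) set" where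
  "bijections X V = {\<phi> \<in> X \<rightarrow>\<^sub>E V. bij_betw \<phi> X V}"

lemma finite_bijections: "finite X \<Longrightarrow> finite V \<Longrightarrow> finite (bijections X V)"
  by (simp add: bijections_def finite_PiE)

lemma bij_betw_bijections_fix:
  assumes "x \<in> X" "y \<in> V"
  shows "bij_betw (\<lambda>\<phi>. \<phi>(x := undefined)) {\<phi> \<in> bijections X V. \<phi> x = y}
    (bijections (X - {x}) (V - {y}))"
proof (rule bij_betw_byWitness[where f' = "\<lambda>\<phi>. \<phi>(x := y)"])
  show "\<forall>\<phi>\<in>bijections (X - {x}) (V - {y}). (\<phi>(x := y))(x := undefined) = \<phi>"
    by (auto simp: bijections_def PiE_def extensional_def)
  show "(\<lambda>\<phi>. \<phi>(x := undefined)) ` {\<phi> \<in> bijections X V. \<phi> x = y} \<subseteq> bijections (X - {x}) (V - {y})"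
  proof (rule image_subsetI)
    fix \<phi> assume "\<phi> \<in> {\<phi> \<in> bijections X V. \<phi> x = y}"
    then have phi: "bij_betw \<phi> X V" "\<phi> x = y" "\<phi> \<in> X \<rightarrow>\<^sub>E V" by (auto simp: bijections_def)
    have "bij_betw \<phi> (X - {x}) (V - {\<phi> x})"
      by (rule bij_betw_DiffI) (use phi assms in \<open>auto simp: bij_betw_def\<close>)
    then have "bij_betw (\<phi>(x := undefined)) (X - {x}) (V - {y})"
      using phi(2) by (subst bij_betw_cong[where g = \<phi>]) auto
    moreover have "\<phi>(x := undefined) \<in> extensional (X - {x})"
      using phi(3) by (auto simp: PiE_def extensional_def)
    ultimately show "\<phi>(x := undefined) \<in> bijections (X - {x}) (V - {y})"
      by (auto simp: bijections_def PiE_def bij_betw_def)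
  qed
  show "(\<lambda>\<phi>. \<phi>(x := y)) ` bijections (X - {x}) (V - {y}) \<subseteq> {\<phi> \<in> bijections X V. \<phi> x = y}"
  proof (rule image_subsetI)
    fix \<phi> assume phi: "\<phi> \<in> bijections (X - {x}) (V - {y})"
    then have "bij_betw (\<phi>(x := y)) (X - {x}) (V - {y})"
      by (subst bij_betw_cong[where g = \<phi>]) (auto simp: bijections_def)
    then have "bij_betw (\<phi>(x := y)) ((X - {x}) \<union> {x}) ((V - {y}) \<union> {(\<phi>(x := y)) x})"
      by (intro notIn_Un_bij_betw) auto
    then have "bij_betw (\<phi>(x := y)) X V" using assms by (simp add: insert_absorb)
    moreover have "\<phi>(x := y) \<in> extensional X"
      using phi assms by (auto simp: bijections_def PiE_def extensional_def)
    ultimately show "\<phi>(x := y) \<in> {\<phi> \<in> bijections X V. \<phi> x = y}"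
      by (auto simp: bijections_def PiE_def bij_betw_def)
  qed
qed (auto simp: fun_eq_iff)

lemma card_bijections:
  fixes X :: "'a set" and V :: "'b set"
  assumes "finite X" "finite V" "card X = card V"
  shows "card (bijections X V) = fact (card V)"
  using assms
proof (induction X arbitrary: V rule: finite_induct)
  case empty
  then have "bijections ({} :: 'a set) V = {\<lambda>_. undefined}" by (auto simp: bijections_def bij_betw_def)
  then show ?case using empty by simp
next
  case (insert x X)
  have "V \<noteq> {}" using insert by auto
  have "bijections (insert x X) V = (\<Union>y\<in>V. {\<phi> \<in> bijections (insert x X) V. \<phi> x = y})"
    by (auto simp: bijections_def)
  then have "card (bijections (insert x X) V) = card (\<Union>y\<in>V. {\<phi> \<in> bijections (insert x X) V. \<phi> x = y})"
    by simp
  also have "\<dots> = (\<Sum>y\<in>V. card {\<phi> \<in> bijections (insert x X) V. \<phi> x = y})"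
    using insert finite_bijections[of "insert x X" V] by (intro card_UN_disjoint) auto
  also have "\<dots> = (\<Sum>y\<in>V. fact (card V - 1))"
  proof (rule sum.cong[OF refl])
    fix y assume y: "y \<in> V"
    have "card {\<phi> \<in> bijections (insert x X) V. \<phi> x = y} = card (bijections X (V - {y}))"
      using bij_betw_same_card[OF bij_betw_bijections_fix[of x "insert x X" y V]] insert(2) y by simp
    also have "\<dots> = fact (card (V - {y}))"
      using insert y by (intro insert.IH) (auto simp: card_Diff_singleton)
    finally show "card {\<phi> \<in> bijections (insert x X) V. \<phi> x = y} = fact (card V - 1)"
      using y insert.prems by (simp add: card_Diff_singleton)
  qed
  also have "\<dots> = fact (card V)"
    using \<open>V \<noteq> {}\<close> insert.prems by (simp add: fact_reduce[of "card V"] card_gt_0_iff)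
  finally show ?case .
qed

lemma card_bijections_fix_list:
  assumes "finite X" "finite V" "card X = card V" "distinct xs" "set xs \<subseteq> X" "distinct ys" "set ys \<subseteq> V"
    and "length xs = length ys"
  shows "card {\<phi> \<in> bijections X V. map \<phi> xs = ys} = fact (card V - length xs)"
  using assms
proof (induction xs arbitrary: ys X V)
  case Nil
  then show ?case using card_bijections by simp
next
  case (Cons x xs zs)
  then obtain y ys where zs: "zs = y # ys" by (cases zs) auto
  have xy: "x \<in> X" "y \<in> V" using Cons.prems zs by auto
  let ?S = "{\<phi> \<in> bijections X V. \<phi> x = y}"
  have bij: "bij_betw (\<lambda>\<phi>. \<phi>(x := undefined)) ?S (bijections (X - {x}) (V - {y}))"
    using bij_betw_bijections_fix[OF xy] .
  have map_eq: "map (\<phi>(x := undefined)) xs = map \<phi> xs" for \<phi> :: "'a \<Rightarrow> 'b"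
    using Cons.prems by auto
  have "bij_betw (\<lambda>\<phi>. \<phi>(x := undefined)) {\<phi> \<in> ?S. map \<phi> xs = ys}
      {\<phi> \<in> bijections (X - {x}) (V - {y}). map \<phi> xs = ys}"
    unfolding bij_betw_def
  proof
    show "inj_on (\<lambda>\<phi>. \<phi>(x := undefined)) {\<phi> \<in> ?S. map \<phi> xs = ys}"
      using bij by (auto simp: bij_betw_def intro: inj_on_subset)
    have "\<psi> \<in> (\<lambda>\<phi>. \<phi>(x := undefined)) ` {\<phi> \<in> ?S. map \<phi> xs = ys}"
      if "\<psi> \<in> bijections (X - {x}) (V - {y})" "map \<psi> xs = ys" for \<psi>
    proof -
      have "\<psi> \<in> (\<lambda>\<phi>. \<phi>(x := undefined)) ` ?S" using bij that(1) unfolding bij_betw_def by blast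
      then obtain \<phi> where "\<phi> \<in> ?S" "\<psi> = \<phi>(x := undefined)" by blast
      then show ?thesis using that(2) map_eq by auto
    qed
    moreover have "(\<lambda>\<phi>. \<phi>(x := undefined)) ` {\<phi> \<in> ?S. map \<phi> xs = ys}
        \<subseteq> {\<phi> \<in> bijections (X - {x}) (V - {y}). map \<phi> xs = ys}"
      using bij map_eq unfolding bij_betw_def by (auto simp del: fun_upd_apply)
    ultimately show "(\<lambda>\<phi>. \<phi>(x := undefined)) ` {\<phi> \<in> ?S. map \<phi> xs = ys}
        = {\<phi> \<in> bijections (X - {x}) (V - {y}). map \<phi> xs = ys}" by blast
  qed
  then have "card {\<phi> \<in> ?S. map \<phi> xs = ys} = card {\<phi> \<in> bijections (X - {x}) (V - {y}). map \<phi> xs = ys}"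
    by (rule bij_betw_same_card)
  also have "\<dots> = fact (card (V - {y}) - length xs)"
    using Cons.prems zs xy by (intro Cons.IH) (auto simp: card_Diff_singleton)
  also have "{\<phi> \<in> ?S. map \<phi> xs = ys} = {\<phi> \<in> bijections X V. map \<phi> (x # xs) = zs}"
    using zs by auto
  finally show ?case using xy Cons.prems by (simp add: card_Diff_singleton)
qed

section \<open>Averages over random placements\<close>

definition lists_in :: "nat \<Rightarrow> 'b set \<Rightarrow> 'b list set" where
  "lists_in r V = {ys. length ys = r \<and> set ys \<subseteq> V}"

lemma finite_lists_in: "finite V \<Longrightarrow> finite (lists_in r V)"
  using finite_lists_length_eq[of V r] by (simp add: lists_in_def conj_commute)

lemma card_lists_in: "finite V \<Longrightarrow> card (lists_in r V) = card V ^ r"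
  using card_lists_length_eq[of V r] by (simp add: lists_in_def conj_commute)

lemma sum_lists_in_Suc:
  "(\<Sum>ys\<in>lists_in (Suc r) V. f ys) = (\<Sum>y\<in>V. \<Sum>ys\<in>lists_in r V. f (y # ys))"
proof -
  have "(\<Sum>ys\<in>lists_in (Suc r) V. f ys) = (\<Sum>(y, ys)\<in>V \<times> lists_in r V. f (y # ys))"
    by (rule sum.reindex_bij_witness[of _ "\<lambda>(y, ys). y # ys" "\<lambda>ys. (hd ys, tl ys)"])
      (auto simp: lists_in_def length_Suc_conv)
  then show ?thesis by (simp add: sum.cartesian_product)
qed

lemma lists_in_0: "lists_in 0 V = {[]}"
  by (auto simp: lists_in_def)

text \<open>The images of \<open>r\<close> distinct points form a uniformly random list of distinct
  vertices, since each such list is attained by \<open>fact (n - r)\<close> bijections, where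
  \<open>n\<close> is \<open>card V\<close>.\<close>

lemma sum_bijections_list:
  fixes g :: "'b list \<Rightarrow> real"
  assumes "finite X" "finite V" "card X = card V" "distinct xs" "set xs \<subseteq> X"
  shows "(\<Sum>\<phi>\<in>bijections X V. g (map \<phi> xs)) =
    fact (card V - length xs) * (\<Sum>ys\<in>{ys \<in> lists_in (length xs) V. distinct ys}. g ys)"
proof -
  let ?L = "{ys \<in> lists_in (length xs) V. distinct ys}"
  have "(\<lambda>\<phi>. map \<phi> xs) ` bijections X V \<subseteq> ?L"
  proof (rule image_subsetI)
    fix \<phi> assume "\<phi> \<in> bijections X V"
    then have "inj_on \<phi> (set xs)" "\<phi> ` set xs \<subseteq> V"
      using assms(5) by (auto simp: bijections_def bij_betw_def intro: inj_on_subset)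
    then show "map \<phi> xs \<in> ?L" using assms(4) by (auto simp: lists_in_def distinct_map)
  qed
  then have "(\<Sum>\<phi>\<in>bijections X V. g (map \<phi> xs)) =
      (\<Sum>ys\<in>?L. \<Sum>\<phi>\<in>{\<phi> \<in> bijections X V. map \<phi> xs = ys}. g (map \<phi> xs))"
    using assms by (intro sum.group[symmetric]) (auto simp: finite_bijections finite_lists_in)
  also have "\<dots> = (\<Sum>ys\<in>?L. fact (card V - length xs) * g ys)"
  proof (rule sum.cong[OF refl])
    fix ys assume "ys \<in> ?L"
    then have "card {\<phi> \<in> bijections X V. map \<phi> xs = ys} = fact (card V - length xs)"
      using assms by (intro card_bijections_fix_list) (auto simp: lists_in_def)
    then show "(\<Sum>\<phi>\<in>{\<phi> \<in> bijections X V. map \<phi> xs = ys}. g (map \<phi> xs)) = fact (card V - length xs) * g ys"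
      by simp
  qed
  finally show ?thesis by (simp add: sum_distrib_left)
qed

text \<open>Passing from \<open>fact n\<close> to \<open>fact (n - r)\<close> drops \<open>r\<close>
  factors, and each of them is at least \<open>n / 2\<close>.\<close>

lemma fact_diff_le:
  assumes "2 * r \<le> n"
  shows "fact (n - r) \<le> fact n * (2 / real n) ^ r"
  using assms
proof (induction r)
  case (Suc r)
  then have n: "n > 0" by simp
  have "fact (n - r) = real (n - r) * fact (n - Suc r)"
    using Suc by (subst fact_reduce) auto
  moreover have "real n / 2 \<le> real (n - r)" using Suc by (simp add: of_nat_diff)
  ultimately have "real n / 2 * fact (n - Suc r) \<le> fact (n - r)"
    by (simp add: mult_right_mono)
  also have "\<dots> \<le> fact n * (2 / real n) ^ r" using Suc by simp
  finally have "fact (n - Suc r) \<le> fact n * (2 / real n) ^ r / (real n / 2)"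
    using n by (simp add: field_simps)
  then show ?case by (simp add: mult_ac)
qed simp

text \<open>Sampling without replacement is dominated, up to a factor \<open>2 ^ r\<close> for
  \<open>r\<close> points, by sampling with replacement, where sums over lists become iterated sums
  over \<open>V\<close>.\<close>

lemma sum_bijections_le:
  fixes g :: "'b list \<Rightarrow> real"
  assumes "finite X" "finite V" "card X = card V" "distinct xs" "set xs \<subseteq> X" "2 * length xs \<le> card V"
    and "\<And>ys. g ys \<ge> 0"
  shows "(\<Sum>\<phi>\<in>bijections X V. g (map \<phi> xs)) \<le>
    fact (card V) * (2 / real (card V)) ^ length xs * (\<Sum>ys\<in>lists_in (length xs) V. g ys)"
  unfolding sum_bijections_list[OF assms(1-5)]
proof (rule mult_mono)
  show "(\<Sum>ys\<in>{ys \<in> lists_in (length xs) V. distinct ys}. g ys) \<le> (\<Sum>ys\<in>lists_in (length xs) V. g ys)"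
    by (intro sum_mono2) (use assms finite_lists_in in auto)
qed (use fact_diff_le[OF assms(6)] assms(7) in \<open>auto intro: sum_nonneg\<close>)

text \<open>Exchanging the images of two points preserves the uniform distribution. This is the
  source of the cancellation for disjoint arcs.\<close>

lemma sum_bijections_transpose:
  assumes "x \<in> X" "y \<in> X"
  shows "(\<Sum>\<phi>\<in>bijections X V. f (\<phi> \<circ> transpose x y)) = (\<Sum>\<phi>\<in>bijections X V. f \<phi>)"
proof -
  have "\<phi> \<circ> transpose x y \<in> bijections X V" if "\<phi> \<in> bijections X V" for \<phi>
  proof -
    have "bij_betw (transpose x y) X X"
      using assms by (intro bij_betw_byWitness[where f' = "transpose x y"]) (auto simp: transpose_def)
    then have "bij_betw (\<phi> \<circ> transpose x y) X V"
      using that by (auto simp: bijections_def intro: bij_betw_trans)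
    moreover have "\<phi> \<circ> transpose x y \<in> extensional X"
      using that assms by (auto simp: bijections_def PiE_def extensional_def transpose_def)
    ultimately show ?thesis by (auto simp: bijections_def PiE_def bij_betw_def)
  qed
  then show ?thesis
    by (intro sum.reindex_bij_witness[of _ "\<lambda>\<phi>. \<phi> \<circ> transpose x y" "\<lambda>\<phi>. \<phi> \<circ> transpose x y"])
      (auto simp: o_assoc[symmetric])
qed

section \<open>Random regular tournaments with a block structure\<close>

text \<open>All parts are treated as orientations on the common set \<open>V\<close>, whereas the
  symmetry and extension arguments live on the vertices of a single part. This passes between the
  two views.\<close>

lemma balanced_support:
  assumes "finite V" "U \<subseteq> V" "D \<subseteq> U \<times> U"
  shows "balanced V D = balanced U D"
proof -
  have "(\<forall>x\<in>V. (\<Sum>y\<in>V. arc_sign A (x, y)) = 0) \<longleftrightarrow> (\<forall>x\<in>U. (\<Sum>y\<in>U. arc_sign A (x, y)) = 0)"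
    if "orients A D" for A
  proof -
    have zero: "arc_sign A (x, y) = 0" if "x \<notin> U \<or> y \<notin> U" for x y
      using that \<open>orients A D\<close> assms(3) by (auto simp: arc_sign_def orients_def)
    have "(\<Sum>y\<in>V. arc_sign A (x, y)) = (\<Sum>y\<in>U. arc_sign A (x, y))" for x
      by (rule sum.mono_neutral_right) (use assms zero in auto)
    moreover have "(\<Sum>y\<in>U. arc_sign A (x, y)) = 0" if "x \<notin> U" for x
      using that zero by simp
    ultimately show ?thesis using assms(2) by auto
  qed
  then show ?thesis by (auto simp: balanced_def)
qed

text \<open>Even blocks give even degrees in both kinds of parts: the degrees are block sizes, also
  in the clique of a block with \<open>p\<close>. The bound \<open>8 * k < m\<close> feeds the
  extension lemmas, and \<open>3 \<le> m\<close> keeps the correlations that enter the logarithms at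
  most \<open>1/2\<close> in absolute value.\<close>

locale block_partition =
  fixes V :: "'v :: linorder set" and p :: 'v and b :: "'v \<Rightarrow> nat" and m k :: nat
  assumes finite_V: "finite V" and p_in_V: "p \<in> V" and odd_V: "odd (card V)"
    and even_block: "\<And>x. x \<in> V - {p} \<Longrightarrow> even (card {y \<in> V - {p}. b y = b x})"
    and block_ge: "\<And>x. x \<in> V - {p} \<Longrightarrow> m \<le> card {y \<in> V - {p}. b y = b x}"
    and block_le: "\<And>x. x \<in> V - {p} \<Longrightarrow> card {y \<in> V - {p}. b y = b x} \<le> 2 * m"
    and m_large: "8 * k < m" "3 \<le> m"
begin

definition blk :: "nat \<Rightarrow> 'v set" where "blk i = {y \<in> V - {p}. b y = i}"
text \<open>An arc has one label if it lies in the clique formed by a block and \<open>p\<close>, and two labels if it joins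
  two blocks, so that the label set identifies the part containing the arc.\<close>

definition label :: "'v \<Rightarrow> nat set" where "label x = (if x = p then {} else {b x})"
definition cls :: "'v \<times> 'v \<Rightarrow> nat set" where "cls e = label (fst e) \<union> label (snd e)"
definition classes :: "nat set set" where "classes = cls ` clique V"
definition class_arcs :: "nat set \<Rightarrow> ('v \<times> 'v) set" where "class_arcs c = {e \<in> clique V. cls e = c}"
abbreviation class_oris :: "nat set \<Rightarrow> ('v \<times> 'v) set set" where
  "class_oris c \<equiv> balanced V (class_arcs c)"
text \<open>Pairs inside a clique get the value 0, because a clique receiving two or more arcs is
  charged as a bad class anyway.\<close>

definition rho :: "'v \<times> 'v \<Rightarrow> 'v \<times> 'v \<Rightarrow> real" where
  "rho e e' = (if cls e = cls e' \<and> card (cls e) = 2 then arc_corr V (class_arcs (cls e)) e e' else 0)"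

lemma finite_blk [simp]: "finite (blk i)"
  using finite_V by (simp add: blk_def)

lemma card_V_minus_p: "real (card (V - {p})) = real (card V) - 1"
  using card_Suc_Diff1[OF finite_V p_in_V] by linarith

lemma mem_blk: "x \<in> blk i \<longleftrightarrow> x \<in> V \<and> x \<noteq> p \<and> b x = i"
  by (auto simp: blk_def)

lemma blk_subset: "blk i \<subseteq> V" "p \<notin> blk i"
  by (auto simp: blk_def)

lemma blk_size:
  assumes "i \<in> b ` (V - {p})"
  shows "even (card (blk i))" "m \<le> card (blk i)" "card (blk i) \<le> 2 * m"
  using assms even_block block_ge block_le by (auto simp: blk_def)

lemma finite_clique: "finite (clique V)"
  by (rule finite_subset[of _ "V \<times> V"]) (use finite_V in \<open>auto simp: clique_def\<close>)

lemma finite_classes: "finite classes"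
  using finite_clique by (simp add: classes_def)

lemma finite_class_arcs: "finite (class_arcs c)"
  using finite_clique by (simp add: class_arcs_def)

lemma class_arcs_sym: "(x, y) \<in> class_arcs c \<Longrightarrow> (y, x) \<in> class_arcs c"
  by (auto simp: class_arcs_def clique_def cls_def Un_commute)

lemma cls_eq_doubleton:
  assumes "i \<noteq> j"
  shows "cls (x, y) = {i, j} \<longleftrightarrow> x \<noteq> p \<and> y \<noteq> p \<and> (b x = i \<and> b y = j \<or> b x = j \<and> b y = i)"
proof (cases "x = p \<or> y = p")
  case True
  then have "card (cls (x, y)) \<le> 1" by (auto simp: cls_def label_def)
  moreover have "card {i, j} = 2" using assms by simp
  ultimately have "cls (x, y) \<noteq> {i, j}" by auto
  then show ?thesis using True by blast
next
  case False
  then have "cls (x, y) = {b x, b y}" by (auto simp: cls_def label_def)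
  then show ?thesis using False by (simp add: doubleton_eq_iff)
qed

lemma class_arcs_doubleton:
  assumes "i \<noteq> j"
  shows "class_arcs {i, j} = biclique (blk i) (blk j)"
proof (intro set_eqI)
  fix e :: "'v \<times> 'v"
  obtain x y where e: "e = (x, y)" by (cases e)
  show "e \<in> class_arcs {i, j} \<longleftrightarrow> e \<in> biclique (blk i) (blk j)"
    unfolding e class_arcs_def biclique_def blk_def clique_def
    using cls_eq_doubleton[OF assms, of x y] assms by auto
qed

lemma classes_cases:
  assumes "c \<in> classes"
  obtains i where "i \<in> b ` (V - {p})" "c = {i}" "class_arcs c = clique (insert p (blk i))"
  | i j where "i \<in> b ` (V - {p})" "j \<in> b ` (V - {p})" "i \<noteq> j" "c = {i, j}"
      "class_arcs c = biclique (blk i) (blk j)"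
proof -
  obtain x y where xy: "x \<in> V" "y \<in> V" "x \<noteq> y" "c = label x \<union> label y"
    using assms by (auto simp: classes_def cls_def clique_def)
  note classes_thesis = that
  have single: thesis if "i \<in> b ` (V - {p})" "c = {i}" for i
  proof (rule classes_thesis(1)[of i])
    show "class_arcs c = clique (insert p (blk i))"
      using that(2) p_in_V
      by (auto simp: class_arcs_def clique_def cls_def label_def blk_def split: if_splits)
  qed (use that in auto)
  consider "x = p" | "y = p" | "x \<noteq> p" "y \<noteq> p" "b x = b y" | "x \<noteq> p" "y \<noteq> p" "b x \<noteq> b y" by blast
  then show thesis
  proof cases
    case 1 then show ?thesis using xy by (intro single[of "b y"]) (auto simp: label_def)
  next
    case 2 then show ?thesis using xy by (intro single[of "b x"]) (auto simp: label_def)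
  next
    case 3 then show ?thesis using xy by (intro single[of "b x"]) (auto simp: label_def)
  next
    case 4
    then have "c = {b x, b y}" using xy(4) by (auto simp: label_def)
    then have "class_arcs c = biclique (blk (b x)) (blk (b y))"
      using 4(3) by (simp add: class_arcs_doubleton)
    then show ?thesis using 4 xy by (intro classes_thesis(2)[of "b x" "b y"]) (auto simp: label_def)
  qed
qed

text \<open>Here the parity and size conditions of the blocks are spent. The case of empty
  \<open>F\<close> also shows that the sample space of every part is nonempty.\<close>

lemma class_extension:
  assumes "c \<in> classes" "F \<subseteq> class_arcs c" "bounded_orientation k F"
  shows "\<exists>A\<in>class_oris c. F \<subseteq> A"
  using assms(1)
proof (cases rule: classes_cases)
  case (1 i)
  have "\<exists>A\<in>balanced (insert p (blk i)) (clique (insert p (blk i))). F \<subseteq> A"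
  proof (rule clique_balanced_extension)
    show "odd (card (insert p (blk i)))" "4 * k < card (insert p (blk i))"
      using blk_size[OF 1(1)] blk_subset[of i] m_large by auto
  qed (use assms 1 in auto)
  moreover have "class_oris c = balanced (insert p (blk i)) (class_arcs c)"
    by (rule balanced_support) (use finite_V p_in_V blk_subset 1 in \<open>auto simp: clique_def\<close>)
  ultimately show ?thesis using 1 by simp
next
  case (2 i j)
  have "\<exists>A\<in>balanced (blk i \<union> blk j) (biclique (blk i) (blk j)). F \<subseteq> A"
  proof (rule biclique_balanced_extension)
    show "blk i \<inter> blk j = {}" using 2 by (auto simp: blk_def)
    show "8 * k < card (blk i)" "8 * k < card (blk j)"
      using blk_size(2)[OF 2(1)] blk_size(2)[OF 2(2)] m_large by linarith+
  qed (use assms 2 blk_size in auto)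
  moreover have "class_oris c = balanced (blk i \<union> blk j) (class_arcs c)"
    by (rule balanced_support) (use finite_V blk_subset 2 in \<open>auto simp: biclique_def\<close>)
  ultimately show ?thesis using 2 by simp
qed

lemma class_balanced_nonempty: "c \<in> classes \<Longrightarrow> class_oris c \<noteq> {}"
  using class_extension[of c "{}"] by (auto simp: bounded_orientation_def)

text \<open>Two blocks have at most \<open>4 * m\<close> vertices, and one block with
  \<open>p\<close> at most \<open>2 * m + 1\<close>; the base \<open>4 * m + 1\<close> covers
  both.\<close>

lemma card_class_arcs_le:
  assumes "c \<in> classes"
  shows "card (class_arcs c) \<le> (4 * m + 1)\<^sup>2"
proof -
  have "\<exists>U. finite U \<and> card U \<le> 4 * m + 1 \<and> class_arcs c \<subseteq> U \<times> U"
    using assms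
  proof (cases rule: classes_cases)
    case (1 i)
    then show ?thesis using blk_size(3)[OF 1(1)] blk_subset[of i]
      by (intro exI[of _ "insert p (blk i)"]) (auto simp: clique_def)
  next
    case (2 i j)
    then show ?thesis using blk_size(3)[OF 2(1)] blk_size(3)[OF 2(2)] card_Un_le[of "blk i" "blk j"]
      by (intro exI[of _ "blk i \<union> blk j"]) (auto simp: biclique_def)
  qed
  then obtain U where U: "finite U" "card U \<le> 4 * m + 1" "class_arcs c \<subseteq> U \<times> U" by blast
  have "card (class_arcs c) \<le> card (U \<times> U)" using U by (intro card_mono) auto
  also have "\<dots> \<le> (4 * m + 1)\<^sup>2"
    using U by (simp add: card_cartesian_product power2_eq_square mult_mono del: mult_Suc mult_Suc_right)
  finally show ?thesis .
qed

section \<open>Explicit correlations and their sums over vertex lists\<close>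

definition path_corr :: "'v \<Rightarrow> 'v \<Rightarrow> 'v \<Rightarrow> real" where
  "path_corr x y z = (if x \<noteq> p \<and> y \<noteq> p \<and> z \<noteq> p \<and> b x = b z \<and> b y \<noteq> b x
     then 1 / (real (card (blk (b x))) - 1) else 0)"

text \<open>Only the absolute value is recorded: the sign depends on whether the two arcs run the
  same way between the blocks, and the sizes of disjoint pairs matter through their squares.\<close>

definition pair_corr :: "'v \<Rightarrow> 'v \<Rightarrow> 'v \<Rightarrow> 'v \<Rightarrow> real" where
  "pair_corr x y z w = (if x \<noteq> p \<and> y \<noteq> p \<and> z \<noteq> p \<and> w \<noteq> p \<and> b x \<noteq> b y \<and>
       (b z = b x \<and> b w = b y \<or> b z = b y \<and> b w = b x)
     then 1 / ((real (card (blk (b x))) - 1) * (real (card (blk (b y))) - 1)) else 0)"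

lemma cls_swap [simp]: "cls (prod.swap e) = cls e"
  by (auto simp: cls_def)

lemma rho_swap: "rho (prod.swap e) e' = - rho e e'"
proof -
  have "(if C then - a else 0) = - (if C then a else 0)" for C and a :: real by simp
  then show ?thesis unfolding rho_def cls_swap arc_corr_swap .
qed

lemma rho_commute: "rho e e' = rho e' e"
proof (cases "cls e = cls e' \<and> card (cls e) = 2")
  case True
  then show ?thesis using arc_corr_commute[of V "class_arcs (cls e)" e e'] by (simp add: rho_def)
next
  case False
  then have "\<not> (cls e' = cls e \<and> card (cls e') = 2)" by metis
  then show ?thesis using False unfolding rho_def by (simp only: if_False)
qed

lemma class_two:
  assumes "x \<in> V" "y \<in> V" "x \<noteq> p" "y \<noteq> p" "b x \<noteq> b y"
  shows "class_arcs (cls (x, y)) = biclique (blk (b x)) (blk (b y))"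
    and "arc_corr V (class_arcs (cls (x, y))) =
      arc_corr (blk (b x) \<union> blk (b y)) (biclique (blk (b x)) (blk (b y)))"
    and "balanced (blk (b x) \<union> blk (b y)) (biclique (blk (b x)) (blk (b y))) \<noteq> {}"
    and "blk (b x) \<inter> blk (b y) = {}"
proof -
  show D: "class_arcs (cls (x, y)) = biclique (blk (b x)) (blk (b y))"
    using class_arcs_doubleton[OF assms(5)] assms(3,4) by (simp add: cls_def label_def insert_commute)
  have B: "class_oris (cls (x, y)) = balanced (blk (b x) \<union> blk (b y)) (class_arcs (cls (x, y)))"
    unfolding D by (rule balanced_support) (use finite_V blk_subset in \<open>auto simp: biclique_def\<close>)
  show "arc_corr V (class_arcs (cls (x, y))) =
      arc_corr (blk (b x) \<union> blk (b y)) (biclique (blk (b x)) (blk (b y)))"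
    by (intro ext) (simp only: arc_corr_def B, simp only: D)
  have "cls (x, y) \<in> classes" using assms by (auto simp: classes_def clique_def)
  then show "balanced (blk (b x) \<union> blk (b y)) (biclique (blk (b x)) (blk (b y))) \<noteq> {}"
    using class_balanced_nonempty B D by metis
  show "blk (b x) \<inter> blk (b y) = {}" using assms by (auto simp: blk_def)
qed

lemma card_cls_eq_2: "card (cls (x, y)) = 2 \<longleftrightarrow> x \<noteq> p \<and> y \<noteq> p \<and> b x \<noteq> b y"
  by (auto simp: cls_def label_def card_insert_if)

text \<open>Two arcs leaving a balanced vertex are negatively correlated; reversing one of them
  makes the pair consistent and the value positive. The common vertex is \<open>y\<close>, so the
  side length that enters is that of the block containing \<open>x\<close> and
  \<open>z\<close>.\<close>

lemma rho_path:
  assumes "x \<in> V" "y \<in> V" "z \<in> V" "x \<noteq> y" "y \<noteq> z" "x \<noteq> z"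
  shows "rho (x, y) (y, z) = path_corr x y z"
proof (cases "x \<noteq> p \<and> y \<noteq> p \<and> z \<noteq> p \<and> b x = b z \<and> b y \<noteq> b x")
  case True
  then have c: "cls (x, y) = cls (y, z)" "card (cls (x, y)) = 2"
    by (auto simp: cls_def label_def)
  have xyV: "b y \<noteq> b x" "y \<noteq> p" "x \<noteq> p" using True by auto
  note two = class_two[OF assms(2,1) xyV(2,3,1)]
  have "arc_corr V (class_arcs (cls (y, x))) (y, x) (y, z) = - 1 / (real (card (blk (b x))) - 1)"
    unfolding two(2)
    by (rule biclique_corr_adjacent) (use two(3,4) assms True in \<open>simp_all add: mem_blk\<close>)
  then have "rho (y, x) (y, z) = - path_corr x y z"
    using True c by (simp add: rho_def path_corr_def cls_def Un_commute)
  then show ?thesis using rho_swap[of "(y, x)" "(y, z)"] by simp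
next
  case False
  then have "\<not> (cls (x, y) = cls (y, z) \<and> card (cls (x, y)) = 2)"
    unfolding card_cls_eq_2 using cls_eq_doubleton[of "b x" "b y" y z]
    by (auto simp: cls_def label_def split: if_splits)
  then show ?thesis using False by (auto simp: rho_def path_corr_def)
qed

lemma rho_disjoint:
  assumes "x \<in> V" "y \<in> V" "z \<in> V" "w \<in> V" "distinct [x, y, z, w]"
  shows "\<bar>rho (x, y) (z, w)\<bar> = pair_corr x y z w"
proof -
  have straight: "\<bar>rho (x, y) (z, w)\<bar> = 1 / ((real (card (blk (b x))) - 1) * (real (card (blk (b y))) - 1))"
    if "x \<in> V" "y \<in> V" "z \<in> V" "w \<in> V" "distinct [x, y, z, w]"
      "x \<noteq> p" "y \<noteq> p" "z \<noteq> p" "w \<noteq> p" "b x \<noteq> b y" "b z = b x" "b w = b y" for x y z w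
  proof -
    have c: "cls (x, y) = cls (z, w)" "card (cls (x, y)) = 2"
      using that by (auto simp: cls_def label_def)
    note two = class_two[OF that(1,2,6,7,10)]
    have "arc_corr V (class_arcs (cls (x, y))) (x, y) (z, w) =
        1 / ((real (card (blk (b x))) - 1) * (real (card (blk (b y))) - 1))"
      unfolding two(2)
      by (rule biclique_corr_disjoint) (use two(3,4) that in \<open>simp_all add: mem_blk\<close>)
    moreover have "card (blk (b x)) \<ge> 3" "card (blk (b y)) \<ge> 3"
      using blk_size(2)[of "b x"] blk_size(2)[of "b y"] m_large that by auto
    ultimately show ?thesis using c by (simp add: rho_def)
  qed
  consider "x \<noteq> p \<and> y \<noteq> p \<and> z \<noteq> p \<and> w \<noteq> p \<and> b x \<noteq> b y \<and> b z = b x \<and> b w = b y"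
    | "x \<noteq> p \<and> y \<noteq> p \<and> z \<noteq> p \<and> w \<noteq> p \<and> b x \<noteq> b y \<and> b z = b y \<and> b w = b x"
    | "\<not> (x \<noteq> p \<and> y \<noteq> p \<and> z \<noteq> p \<and> w \<noteq> p \<and> b x \<noteq> b y \<and> (b z = b x \<and> b w = b y \<or> b z = b y \<and> b w = b x))"
    by blast
  then show ?thesis
  proof cases
    case 1 then show ?thesis using straight[of x y z w] assms by (simp add: pair_corr_def)
  next
    case 2
    then have "\<bar>rho (x, y) (w, z)\<bar> = pair_corr x y z w"
      using straight[of x y w z] assms by (auto simp: pair_corr_def)
    then show ?thesis using rho_swap[of "(z, w)" "(x, y)"] rho_commute[of "(x, y)"] by simp
  next
    case 3
    then have "\<not> (cls (x, y) = cls (z, w) \<and> card (cls (x, y)) = 2)"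
      unfolding card_cls_eq_2 using cls_eq_doubleton[of "b x" "b y" z w] cls_eq_doubleton[of "b x" "b y" x y]
    by blast
    then show ?thesis using 3 unfolding rho_def pair_corr_def by (simp only: if_False abs_zero)
  qed
qed

lemma path_corr_bounds: 
  assumes "x \<in> V"
  shows "0 \<le> path_corr x y z" "path_corr x y z \<le> 1 / (real m - 1)"
proof -
  have "x \<noteq> p \<Longrightarrow> real (card (blk (b x))) - 1 \<ge> real m - 1" using blk_size(2)[of "b x"] assms by auto
  then show "0 \<le> path_corr x y z" "path_corr x y z \<le> 1 / (real m - 1)"
    using m_large by (auto simp: path_corr_def intro!: divide_left_mono mult_pos_pos)
qed

lemma pair_corr_bounds:
  assumes "x \<in> V" "y \<in> V"
  shows "0 \<le> pair_corr x y z w" "pair_corr x y z w \<le> 1 / (real m - 1)"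
proof -
  have *: "x \<noteq> p \<Longrightarrow> real (card (blk (b x))) - 1 \<ge> real m - 1" if "x \<in> V" for x
    using blk_size(2)[of "b x"] that by auto
  have m: "real m - 1 \<ge> 2" using m_large by simp
  have "1 / (s * t) \<le> 1 / (real m - 1)" if "s \<ge> real m - 1" "t \<ge> real m - 1" for s t :: real
  proof -
    have "(real m - 1) * 1 \<le> s * t" using that m by (intro mult_mono) auto
    then show ?thesis using m that by (intro divide_left_mono mult_pos_pos) auto
  qed
  then show "0 \<le> pair_corr x y z w" "pair_corr x y z w \<le> 1 / (real m - 1)"
    using *[OF assms(1)] *[OF assms(2)] m by (auto simp: pair_corr_def)
qed

text \<open>For \<open>x\<close> and \<open>y\<close> in different blocks there are
  \<open>card (blk (b x)) - 1\<close> choices of \<open>z\<close>, each worth the reciprocal of this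
  number. The block size cancels and the pair contributes at least 1; this is why the gain does not
  decay as \<open>m\<close> grows.\<close>

lemma sum_path_corr_ge:
  "(\<Sum>ys\<in>{ys \<in> lists_in 3 V. distinct ys}. path_corr (ys ! 0) (ys ! 1) (ys ! 2)) \<ge>
    (real (card V) - 1) * (real (card V) - 1 - 2 * real m)"
proof -
  have "(\<Sum>ys\<in>{ys \<in> lists_in 3 V. distinct ys}. path_corr (ys ! 0) (ys ! 1) (ys ! 2)) =
      (\<Sum>ys\<in>lists_in 3 V. if distinct ys then path_corr (ys ! 0) (ys ! 1) (ys ! 2) else 0)"
    using finite_lists_in[OF finite_V] by (simp add: sum.If_cases Int_def)
  also have "\<dots> = (\<Sum>x\<in>V. \<Sum>y\<in>V. \<Sum>z\<in>V. if distinct [x, y, z] then path_corr x y z else 0)"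
    by (simp add: numeral_3_eq_3 numeral_2_eq_2 sum_lists_in_Suc lists_in_0 cong: if_cong)
  also have "\<dots> \<ge> (\<Sum>x\<in>V. \<Sum>y\<in>V. if x \<noteq> p \<and> y \<noteq> p \<and> b x \<noteq> b y then 1 else 0)"
  proof (intro sum_mono)
    fix x y assume xy: "x \<in> V" "y \<in> V"
    show "(if x \<noteq> p \<and> y \<noteq> p \<and> b x \<noteq> b y then 1 else 0) \<le>
      (\<Sum>z\<in>V. if distinct [x, y, z] then path_corr x y z else 0)"
    proof (cases "x \<noteq> p \<and> y \<noteq> p \<and> b x \<noteq> b y")
      case True
      have "blk (b x) - {x} \<subseteq> V" using blk_subset by auto
      have cardB: "card (blk (b x)) \<ge> 3" using blk_size(2)[of "b x"] True xy m_large by auto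
      have "x \<in> blk (b x)" using True xy by (auto simp: blk_def)
      then have "real (card (blk (b x) - {x})) = real (card (blk (b x))) - 1"
        using cardB by (simp add: card_Diff_singleton of_nat_diff)
      then have "1 = (\<Sum>z\<in>blk (b x) - {x}. 1 / (real (card (blk (b x))) - 1))"
        using cardB by simp
      also have "\<dots> = (\<Sum>z\<in>blk (b x) - {x}. if distinct [x, y, z] then path_corr x y z else 0)"
      proof (rule sum.cong[OF refl])
        fix z assume "z \<in> blk (b x) - {x}"
        then have z: "z \<noteq> p" "b z = b x" "x \<noteq> z" by (auto simp: mem_blk)
        moreover have "x \<noteq> y" "y \<noteq> z" using True z(2) by metis+
        ultimately show "1 / (real (card (blk (b x))) - 1) =
            (if distinct [x, y, z] then path_corr x y z else 0)"
          using True by (simp add: path_corr_def)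
      qed
      also have "\<dots> \<le> (\<Sum>z\<in>V. if distinct [x, y, z] then path_corr x y z else 0)"
        by (rule sum_mono2) (use finite_V blk_subset path_corr_bounds xy in auto)
      finally show ?thesis using True by simp
    qed (use path_corr_bounds xy in \<open>auto intro!: sum_nonneg\<close>)
  qed
  finally have "(\<Sum>ys\<in>{ys \<in> lists_in 3 V. distinct ys}. path_corr (ys ! 0) (ys ! 1) (ys ! 2)) \<ge>
      (\<Sum>x\<in>V. \<Sum>y\<in>V. if x \<noteq> p \<and> y \<noteq> p \<and> b x \<noteq> b y then 1 else 0)" .
  moreover have "(\<Sum>x\<in>V. \<Sum>y\<in>V. if x \<noteq> p \<and> y \<noteq> p \<and> b x \<noteq> b y then 1 else 0 :: real) \<ge>
      (\<Sum>x\<in>V - {p}. real (card V) - 1 - 2 * real m)"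
  proof -
    have "(\<Sum>x\<in>V - {p}. real (card V) - 1 - 2 * real m) \<le>
        (\<Sum>x\<in>V - {p}. \<Sum>y\<in>V. if x \<noteq> p \<and> y \<noteq> p \<and> b x \<noteq> b y then 1 else 0)"
    proof (rule sum_mono)
      fix x assume x: "x \<in> V - {p}"
      have "(\<Sum>y\<in>V. if x \<noteq> p \<and> y \<noteq> p \<and> b x \<noteq> b y then 1 else 0 :: real) = card (V - {p} - blk (b x))"
        using finite_V x by (simp add: sum.If_cases) (auto intro!: arg_cong[where f = card] simp: blk_def)
      also have "\<dots> = real (card V) - 1 - card (blk (b x))"
      proof -
        have "card (V - {p} - blk (b x)) = card (V - {p}) - card (blk (b x))"
          using blk_subset by (intro card_Diff_subset) auto
        moreover have "card (blk (b x)) \<le> card (V - {p})"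
          using blk_subset finite_V by (intro card_mono) auto
        ultimately show ?thesis using card_V_minus_p by (simp add: of_nat_diff)
      qed
      also have "\<dots> \<ge> real (card V) - 1 - 2 * real m"
        using blk_size(3)[of "b x"] x by auto
      finally show "real (card V) - 1 - 2 * real m \<le>
          (\<Sum>y\<in>V. if x \<noteq> p \<and> y \<noteq> p \<and> b x \<noteq> b y then 1 else 0)" .
    qed
    also have "\<dots> \<le> (\<Sum>x\<in>V. \<Sum>y\<in>V. if x \<noteq> p \<and> y \<noteq> p \<and> b x \<noteq> b y then 1 else 0)"
      by (rule sum_mono2) (use finite_V in \<open>auto intro!: sum_nonneg\<close>)
    finally show ?thesis .
  qed
  moreover have "(\<Sum>x\<in>V - {p}. real (card V) - 1 - 2 * real m) = (real (card V) - 1) * (real (card V) - 1 - 2 * real m)"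
    using card_V_minus_p by simp
  ultimately show ?thesis by linarith
qed

lemma block_ratio:
  assumes "x \<in> V" "x \<noteq> p"
  shows "real (card (blk (b x))) / (real (card (blk (b x))) - 1)\<^sup>2 \<le> 2 / (real m - 1)"
proof -
  define s where "s = real (card (blk (b x)))"
  have s: "s \<ge> real m" "real m \<ge> 3"
    using blk_size(2)[of "b x"] assms m_large by (auto simp: s_def)
  have "s / (s - 1)\<^sup>2 \<le> (2 * (s - 1)) / (s - 1)\<^sup>2" using s by (intro divide_right_mono) auto
  also have "\<dots> = 2 / (s - 1)"
    unfolding power2_eq_square using s by (intro nonzero_mult_divide_mult_cancel_right) auto
  also have "\<dots> \<le> 2 / (real m - 1)" using s by (intro divide_left_mono mult_pos_pos) auto
  finally show ?thesis by (simp add: s_def)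
qed

text \<open>The block size cancels only once, so the squares keep a factor of order
  \<open>1/m\<close> compared with the linear sum. Repeated vertices may be included in an upper
  bound.\<close>

lemma sum_path_corr_sq_le:
  "(\<Sum>ys\<in>lists_in 3 V. (path_corr (ys ! 0) (ys ! 1) (ys ! 2))\<^sup>2) \<le> 2 * (real (card V))\<^sup>2 / (real m - 1)"
proof -
  have "(\<Sum>ys\<in>lists_in 3 V. (path_corr (ys ! 0) (ys ! 1) (ys ! 2))\<^sup>2) =
      (\<Sum>x\<in>V. \<Sum>y\<in>V. \<Sum>z\<in>V. (path_corr x y z)\<^sup>2)"
    by (simp add: numeral_3_eq_3 numeral_2_eq_2 sum_lists_in_Suc lists_in_0 cong: if_cong)
  also have "\<dots> \<le> (\<Sum>x\<in>V. \<Sum>y\<in>V. 2 / (real m - 1))"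
  proof (intro sum_mono)
    fix x y assume xy: "x \<in> V" "y \<in> V"
    show "(\<Sum>z\<in>V. (path_corr x y z)\<^sup>2) \<le> 2 / (real m - 1)"
    proof (cases "x = p")
      case True then show ?thesis using m_large by (simp add: path_corr_def)
    next
      case False
      have "(\<Sum>z\<in>V. (path_corr x y z)\<^sup>2) \<le> (\<Sum>z\<in>V. if z \<in> blk (b x) then 1 / (real (card (blk (b x))) - 1)\<^sup>2 else 0)"
        by (intro sum_mono) (auto simp: path_corr_def blk_def power_one_over power_divide)
      also have "\<dots> = real (card (blk (b x))) / (real (card (blk (b x))) - 1)\<^sup>2"
        using finite_V blk_subset[of "b x"] by (simp add: sum.If_cases Int_absorb1)
      finally show ?thesis using block_ratio[of x] xy False by simp
    qed
  qed
  also have "\<dots> = 2 * (real (card V))\<^sup>2 / (real m - 1)" by (simp add: power2_eq_square)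
  finally show ?thesis .
qed

text \<open>With blocks of sizes \<open>s\<close> and \<open>t\<close>, at most
  \<open>2 * s * t\<close> pairs \<open>z\<close>, \<open>w\<close> contribute. The total is of
  order \<open>n^2 / m\<close> over \<open>n^4\<close> lists, small enough to compensate for as many
  as \<open>(k * n)^2\<close> disjoint pairs of arcs.\<close>

lemma sum_pair_corr_sq_le:
  "(\<Sum>ys\<in>lists_in 4 V. (pair_corr (ys ! 0) (ys ! 1) (ys ! 2) (ys ! 3))\<^sup>2) \<le> 8 * (real (card V))\<^sup>2 / (real m - 1)"
proof -
  have 4: "(4 :: nat) = Suc (Suc (Suc (Suc 0)))" by simp
  have "(\<Sum>ys\<in>lists_in 4 V. (pair_corr (ys ! 0) (ys ! 1) (ys ! 2) (ys ! 3))\<^sup>2) =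
      (\<Sum>x\<in>V. \<Sum>y\<in>V. \<Sum>z\<in>V. \<Sum>w\<in>V. (pair_corr x y z w)\<^sup>2)"
    unfolding 4 by (simp add: sum_lists_in_Suc lists_in_0 numeral_2_eq_2 numeral_3_eq_3)
  also have "\<dots> \<le> (\<Sum>x\<in>V. \<Sum>y\<in>V. 8 / (real m - 1))"
  proof (intro sum_mono)
    fix x y assume xy: "x \<in> V" "y \<in> V"
    have m: "real m - 1 \<ge> 2" using m_large by simp
    show "(\<Sum>z\<in>V. \<Sum>w\<in>V. (pair_corr x y z w)\<^sup>2) \<le> 8 / (real m - 1)"
    proof (cases "x = p \<or> y = p")
      case True then show ?thesis using m by (auto simp: pair_corr_def)
    next
      case False
      define s t where "s = real (card (blk (b x)))" and "t = real (card (blk (b y)))"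
      define r where "r = (1 / ((s - 1) * (t - 1)))\<^sup>2"
      let ?x = "blk (b x)" and ?y = "blk (b y)"
      have "(\<Sum>z\<in>V. \<Sum>w\<in>V. (pair_corr x y z w)\<^sup>2) \<le>
          (\<Sum>z\<in>V. \<Sum>w\<in>V. r * (of_bool (z \<in> ?x) * of_bool (w \<in> ?y) + of_bool (z \<in> ?y) * of_bool (w \<in> ?x)))"
        by (intro sum_mono) (auto simp: pair_corr_def blk_def r_def s_def t_def)
      also have "\<dots> = r * ((\<Sum>z\<in>V. of_bool (z \<in> ?x)) * (\<Sum>w\<in>V. of_bool (w \<in> ?y)) +
          (\<Sum>z\<in>V. of_bool (z \<in> ?y)) * (\<Sum>w\<in>V. of_bool (w \<in> ?x)))"
        by (simp add: sum_distrib_left[symmetric] sum_distrib_right[symmetric] sum.distrib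
            del: sum_of_bool_eq)
      also have "\<dots> = r * (s * t + t * s)"
        using finite_V blk_subset by (simp add: s_def t_def Int_absorb1)
      also have "\<dots> = 2 * ((s / (s - 1)\<^sup>2) * (t / (t - 1)\<^sup>2))"
        by (simp add: r_def power_divide power_mult_distrib)
      also have "\<dots> \<le> 2 * (2 / (real m - 1) * (2 / (real m - 1)))"
        using block_ratio[of x] block_ratio[of y] xy False m
        by (intro mult_left_mono mult_mono) (auto simp: s_def t_def)
      \<comment> \<open>One of the two small factors is given away, so that the bound takes the same
        form as the one for paths.\<close>
      also have "\<dots> \<le> 2 * (2 / (real m - 1) * 1)"
        using m by (intro mult_left_mono) auto
      also have "\<dots> \<le> 8 / (real m - 1)" using m by (simp add: divide_right_mono)
      finally show ?thesis .
    qed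
  qed
  also have "\<dots> = 8 * (real (card V))\<^sup>2 / (real m - 1)" by (simp add: power2_eq_square)
  finally show ?thesis .
qed

end

definition ends :: "'a \<times> 'a \<Rightarrow> 'a set" where "ends e = {fst e, snd e}"

text \<open>By \<open>1 + x \<le> exp x\<close> for the sum of the logarithms. The average of a
  product over parts is thereby reduced to the average of a sum.\<close>

lemma prod_ge_one_plus_sum_ln:
  assumes "\<And>c. c \<in> C \<Longrightarrow> f c > (0 :: real)"
  shows "1 + (\<Sum>c\<in>C. ln (f c)) \<le> (\<Prod>c\<in>C. f c)"
proof (cases "finite C")
  case True
  have "1 + (\<Sum>c\<in>C. ln (f c)) \<le> exp (\<Sum>c\<in>C. ln (f c))" by (rule exp_ge_add_one_self)
  also have "\<dots> = (\<Prod>c\<in>C. f c)" using True assms by (simp add: exp_sum)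
  finally show ?thesis .
qed simp

section \<open>Independent orientations of the parts\<close>

context block_partition
begin

definition tours :: "('v \<times> 'v) set set" where
  "tours = {A. A \<subseteq> clique V \<and> (\<forall>c\<in>classes. A \<inter> class_arcs c \<in> class_oris c)}"

lemma class_arcs_Union: "clique V = (\<Union>c\<in>classes. class_arcs c)"
  by (auto simp: class_arcs_def classes_def)

lemma class_arcs_inter: "A \<subseteq> clique V \<Longrightarrow> A \<inter> class_arcs c = {e \<in> A. cls e = c}"
  by (auto simp: class_arcs_def)

lemma tours_orients:
  assumes "A \<in> tours"
  shows "orients A (clique V)"
proof -
  have "((x, y) \<in> A) = ((y, x) \<notin> A)" if "(x, y) \<in> clique V" for x y
  proof -
    have "cls (x, y) \<in> classes" "(x, y) \<in> class_arcs (cls (x, y))" using that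
      by (auto simp: classes_def class_arcs_def)
    moreover from this have "(y, x) \<in> class_arcs (cls (x, y))" using class_arcs_sym by auto
    ultimately show ?thesis using assms unfolding tours_def balanced_def orients_def by blast
  qed
  then show ?thesis using assms by (auto simp: orients_def tours_def)
qed

lemma tours_balanced:
  assumes A: "A \<in> tours" and x: "x \<in> V"
  shows "(\<Sum>y\<in>V. arc_sign A (x, y)) = 0"
proof -
  have sub: "A \<subseteq> clique V" using A by (auto simp: tours_def)
  have "arc_sign A (x, y) = (\<Sum>c\<in>classes. arc_sign (A \<inter> class_arcs c) (x, y))" if "y \<in> V" for y
  proof (cases "x = y")
    case True then show ?thesis by (simp add: arc_sign_def)
  next
    case False
    then have mem: "(x, y) \<in> clique V" using x that by (auto simp: clique_def)
    have sw: "cls (y, x) = cls (x, y)" using cls_swap[of "(x, y)"] by simp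
    have "(\<Sum>c\<in>classes. arc_sign (A \<inter> class_arcs c) (x, y)) =
        (\<Sum>c\<in>{cls (x, y)}. arc_sign (A \<inter> class_arcs c) (x, y))"
      by (rule sum.mono_neutral_right)
        (use finite_classes mem sw in \<open>auto simp: classes_def class_arcs_def arc_sign_def\<close>)
    also have "\<dots> = arc_sign A (x, y)"
      using sub sw by (auto simp: arc_sign_def class_arcs_def)
    finally show ?thesis by simp
  qed
  then have "(\<Sum>y\<in>V. arc_sign A (x, y)) = (\<Sum>y\<in>V. \<Sum>c\<in>classes. arc_sign (A \<inter> class_arcs c) (x, y))"
    by simp
  also have "\<dots> = (\<Sum>c\<in>classes. \<Sum>y\<in>V. arc_sign (A \<inter> class_arcs c) (x, y))"
    by (rule sum.swap)
  also have "\<dots> = 0"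
    using A x by (intro sum.neutral) (auto simp: tours_def balanced_def)
  finally show ?thesis .
qed

text \<open>Restriction to the parts is a bijection onto the product of the sample spaces, and the
  condition \<open>F \<subseteq> A\<close> splits over the parts. This is the independence of the
  parts in counting form.\<close>

lemma card_tours_containing:
  assumes F: "F \<subseteq> clique V"
  shows "card {A \<in> tours. F \<subseteq> A} =
    (\<Prod>c\<in>classes. card {B \<in> class_oris c. F \<inter> class_arcs c \<subseteq> B})"
proof -
  let ?S = "\<lambda>c. {B \<in> class_oris c. F \<inter> class_arcs c \<subseteq> B}"
  have sub: "B \<subseteq> class_arcs c" if "B \<in> ?S c" for B c
    using that by (auto simp: balanced_def orients_def)
  have disj: "c = c'" if "e \<in> class_arcs c" "e \<in> class_arcs c'" for e c c'
    using that by (auto simp: class_arcs_def)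
  have inter: "(\<Union>c\<in>classes. h c) \<inter> class_arcs c = h c" if "h \<in> PiE classes ?S" "c \<in> classes" for h c
  proof -
    have "h c' \<subseteq> class_arcs c'" if "c' \<in> classes" for c'
      by (rule sub, rule PiE_mem[OF \<open>h \<in> PiE classes ?S\<close> that])
    then show ?thesis using that(2) disj by blast
  qed
  have "bij_betw (\<lambda>A. \<lambda>c\<in>classes. A \<inter> class_arcs c) {A \<in> tours. F \<subseteq> A} (PiE classes ?S)"
  proof (rule bij_betw_byWitness[where f' = "\<lambda>h. \<Union>c\<in>classes. h c"])
    show "\<forall>A\<in>{A \<in> tours. F \<subseteq> A}. (\<Union>c\<in>classes. (\<lambda>c\<in>classes. A \<inter> class_arcs c) c) = A"
      using class_arcs_Union by (auto simp: tours_def)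
    show "\<forall>h\<in>PiE classes ?S. (\<lambda>c\<in>classes. (\<Union>c\<in>classes. h c) \<inter> class_arcs c) = h"
    proof
      fix h assume h: "h \<in> PiE classes ?S"
      show "(\<lambda>c\<in>classes. (\<Union>c\<in>classes. h c) \<inter> class_arcs c) = h"
      proof
        fix c show "(\<lambda>c\<in>classes. (\<Union>c\<in>classes. h c) \<inter> class_arcs c) c = h c"
          using inter[OF h, of c] PiE_arb[OF h, of c] by (cases "c \<in> classes") auto
      qed
    qed
    show "(\<lambda>A. \<lambda>c\<in>classes. A \<inter> class_arcs c) ` {A \<in> tours. F \<subseteq> A} \<subseteq> PiE classes ?S"
      by (auto simp: tours_def)
    show "(\<lambda>h. \<Union>c\<in>classes. h c) ` PiE classes ?S \<subseteq> {A \<in> tours. F \<subseteq> A}"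
    proof (rule image_subsetI)
      fix h assume h: "h \<in> PiE classes ?S"
      have hS: "h c \<in> ?S c" if "c \<in> classes" for c using h that by (rule PiE_mem)
      have "(\<Union>c\<in>classes. h c) \<subseteq> clique V"
        unfolding class_arcs_Union by (rule UN_mono[OF order_refl]) (rule sub[OF hS])
      moreover have "F \<subseteq> (\<Union>c\<in>classes. h c)"
      proof
        fix e assume "e \<in> F"
        then have "cls e \<in> classes" "e \<in> F \<inter> class_arcs (cls e)"
          using F by (auto simp: classes_def class_arcs_def)
        then show "e \<in> (\<Union>c\<in>classes. h c)" using hS[of "cls e"] by blast
      qed
      ultimately show "(\<Union>c\<in>classes. h c) \<in> {A \<in> tours. F \<subseteq> A}"
        using inter[OF h] hS by (simp add: tours_def)
    qed
  qed
  then have "card {A \<in> tours. F \<subseteq> A} = card (PiE classes ?S)" by (rule bij_betw_same_card)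
  then show ?thesis using finite_classes by (simp add: card_PiE)
qed

lemma card_arcs_classes:
  assumes "F \<subseteq> clique V"
  shows "card F = (\<Sum>c\<in>classes. card (F \<inter> class_arcs c))"
proof -
  have "finite F" using assms finite_clique by (rule finite_subset)
  have "card F = card (\<Union>c\<in>classes. F \<inter> class_arcs c)"
    by (rule arg_cong[of _ _ card]) (use class_arcs_Union assms in blast)
  also have "\<dots> = (\<Sum>c\<in>classes. card (F \<inter> class_arcs c))"
    using finite_classes \<open>finite F\<close> by (intro card_UN_disjoint) (auto simp: class_arcs_def)
  finally show ?thesis .
qed

lemma card_tours_pos: "card tours > 0"
proof -
  have "card {A \<in> tours. {} \<subseteq> A} = (\<Prod>c\<in>classes. card (class_oris c))"
    using card_tours_containing[of "{}"] by simp
  moreover have "card (class_oris c) > 0" if "c \<in> classes" for c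
    using class_balanced_nonempty[OF that] finite_balanced[OF finite_class_arcs] by (auto simp: card_gt_0_iff)
  ultimately show ?thesis by (simp add: prod_pos)
qed

definition tour_containment :: "('v \<times> 'v) set \<Rightarrow> real" where
  "tour_containment F = (\<Prod>c\<in>classes. containment V (class_arcs c) (F \<inter> class_arcs c))"

lemma containment_product:
  assumes "F \<subseteq> clique V"
  shows "2 ^ card F * real (card {A \<in> tours. F \<subseteq> A}) =
    card tours * tour_containment F"
proof -
  have pos: "card (class_oris c) > 0" if "c \<in> classes" for c
    using class_balanced_nonempty[OF that] finite_balanced[OF finite_class_arcs] by (auto simp: card_gt_0_iff)
  have "card tours = (\<Prod>c\<in>classes. card (class_oris c))"
    using card_tours_containing[of "{}"] by simp
  then have "card tours * tour_containment F =
      (\<Prod>c\<in>classes. real (card (class_oris c)) * containment V (class_arcs c) (F \<inter> class_arcs c))"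
    by (simp add: tour_containment_def prod.distrib)
  also have "\<dots> = (\<Prod>c\<in>classes. 2 ^ card (F \<inter> class_arcs c) *
      real (card {B \<in> class_oris c. F \<inter> class_arcs c \<subseteq> B}))"
    by (intro prod.cong refl) (use pos in \<open>auto simp: containment_def\<close>)
  also have "\<dots> = 2 ^ card F * real (card {A \<in> tours. F \<subseteq> A})"
    unfolding card_tours_containing[OF assms] card_arcs_classes[OF assms]
    by (simp add: prod.distrib power_sum)
  finally show ?thesis by simp
qed

text \<open>\<open>F\<close> has no opposite arcs, so two distinct arcs of \<open>F\<close> share at
  most one vertex. Reversing arcs, which only changes the sign of \<open>rho\<close>, turns every
  adjacent pair into a path.\<close>

lemma rho_abs_le:
  assumes F: "F \<subseteq> clique V" "bounded_orientation k F" and e: "e \<in> F" "e' \<in> F" "e \<noteq> e'"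
  shows "\<bar>rho e e'\<bar> \<le> 1 / (real m - 1)"
proof -
  obtain x y z w where ee: "e = (x, y)" "e' = (z, w)" by (cases e, cases e')
  have V: "x \<in> V" "y \<in> V" "z \<in> V" "w \<in> V" and ne: "x \<noteq> y" "z \<noteq> w"
    using F e ee by (auto simp: clique_def)
  have anti: "\<not> (x = w \<and> y = z)" using F(2) e ee by (auto simp: bounded_orientation_def)
  have abs: "\<bar>rho (prod.swap f) f'\<bar> = \<bar>rho f f'\<bar>" "\<bar>rho f (prod.swap f')\<bar> = \<bar>rho f f'\<bar>" for f f'
    using rho_swap rho_commute by (metis abs_minus_cancel)+
  have path: "\<bar>rho (u, v) (v, t)\<bar> \<le> 1 / (real m - 1)"
    if "u \<in> V" "v \<in> V" "t \<in> V" "u \<noteq> v" "v \<noteq> t" "u \<noteq> t" for u v t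
    using rho_path[OF that] path_corr_bounds[OF that(1), of v t] by simp
  consider "y = z" | "x = w" | "x = z" | "y = w" | "distinct [x, y, z, w]" using ne by auto
  then show ?thesis
  proof cases
    case 1 then show ?thesis using path[of x y w] V ne anti ee by auto
  next
    case 2 then show ?thesis using path[of z w y] V ne anti ee rho_commute[of e e'] by auto
  next
    case 3 then show ?thesis using path[of y x w] abs(1)[of "(x, y)" "(z, w)"] V ne e(3) ee by auto
  next
    case 4 then show ?thesis using path[of x y z] abs(2)[of "(x, y)" "(z, w)"] V ne e(3) ee by auto
  next
    case 5 then show ?thesis
      using rho_disjoint[OF V] pair_corr_bounds[OF V(1,2), of z w] ee by simp
  qed
qed

section \<open>Bad parts and the logarithms of the factors\<close>

definition bad_pairs :: "('v \<times> 'v) set \<Rightarrow> (('v \<times> 'v) \<times> ('v \<times> 'v)) set" where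
  "bad_pairs F = {(e1, e2). e1 \<in> F \<and> e2 \<in> F \<and> e1 \<noteq> e2 \<and> cls e1 = cls e2 \<and> card (cls e1) = 1}"

text \<open>The third arc of a bad triple is required to contain a new vertex, which makes bad triples rare.
  Three arcs of a bipartite part can always be ordered in this way.\<close>

definition bad_triples :: "('v \<times> 'v) set \<Rightarrow> (('v \<times> 'v) \<times> ('v \<times> 'v) \<times> ('v \<times> 'v)) set" where
  "bad_triples F = {(e1, e2, e3). e1 \<in> F \<and> e2 \<in> F \<and> e3 \<in> F \<and> e1 \<noteq> e2 \<and>
     \<not> ends e3 \<subseteq> ends e1 \<union> ends e2 \<and> cls e1 = cls e2 \<and> cls e1 = cls e3 \<and> card (cls e1) = 2}"

definition bad_classes :: "('v \<times> 'v) set \<Rightarrow> nat set set" where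
  "bad_classes F = {c \<in> classes. card c = 1 \<and> card (F \<inter> class_arcs c) \<ge> 2 \<or> card (F \<inter> class_arcs c) \<ge> 3}"

lemma card_classes_cases: "c \<in> classes \<Longrightarrow> card c = 1 \<or> card c = 2"
  by (erule classes_cases) auto

text \<open>If \<open>w\<close> has no new vertex, it joins an end of \<open>u\<close> to the
  opposite end of \<open>v\<close>, and the three arcs form a path with \<open>w\<close> in the
  middle. Then \<open>v\<close>, taken third, contributes its outer end. Parallel edges cannot occur
  because \<open>F\<close> has no opposite arcs.\<close>

lemma biclass_triple:
  assumes F: "F \<subseteq> clique V" "bounded_orientation k F" and c: "c \<in> classes" "card c = 2"
    and three: "card (F \<inter> class_arcs c) \<ge> 3"
  shows "\<exists>e1 e2 e3. (e1, e2, e3) \<in> bad_triples F \<and> cls e1 = c"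
proof -
  obtain i j where ij: "i \<noteq> j" "c = {i, j}" "class_arcs c = biclique (blk i) (blk j)"
    using c(1) by (rule classes_cases) (use c(2) in auto)
  obtain T where T: "T \<subseteq> F \<inter> class_arcs c" "card T = 3"
    using three by (metis obtain_subset_with_card_n)
  then obtain u v w where uvw: "T = {u, v, w}" "u \<noteq> v" "u \<noteq> w" "v \<noteq> w"
    by (auto simp: card_3_iff)
  have F3: "u \<in> F" "v \<in> F" "w \<in> F" and cls3: "cls u = c" "cls v = c" "cls w = c"
    using T uvw by (auto simp: class_arcs_def)
  have ends: "\<exists>x y. ends e = {x, y} \<and> x \<in> blk i \<and> y \<in> blk j \<and> (e = (x, y) \<or> e = (y, x))" if "e \<in> T" for e
  proof -
    obtain a b where e: "e = (a, b)" by (cases e)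
    have "e \<in> biclique (blk i) (blk j)" using T(1) that ij(3) by blast
    then consider "a \<in> blk i" "b \<in> blk j" | "a \<in> blk j" "b \<in> blk i"
      unfolding e by (auto simp: biclique_def)
    then show ?thesis
    proof cases
      case 1 then show ?thesis unfolding e by (intro exI[of _ a] exI[of _ b]) (simp add: ends_def)
    next
      case 2 then show ?thesis unfolding e by (intro exI[of _ b] exI[of _ a]) (simp add: ends_def insert_commute)
    qed
  qed
  have anti: "(a, b) \<in> F \<Longrightarrow> (b, a) \<notin> F" for a b using F(2) by (auto simp: bounded_orientation_def)
  obtain xu yu where u: "ends u = {xu, yu}" "xu \<in> blk i" "yu \<in> blk j" "u = (xu, yu) \<or> u = (yu, xu)"
    using ends[of u] uvw by auto
  obtain xv yv where v: "ends v = {xv, yv}" "xv \<in> blk i" "yv \<in> blk j" "v = (xv, yv) \<or> v = (yv, xv)"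
    using ends[of v] uvw by auto
  obtain xw yw where w: "ends w = {xw, yw}" "xw \<in> blk i" "yw \<in> blk j" "w = (xw, yw) \<or> w = (yw, xw)"
    using ends[of w] uvw by auto
  have uw: "\<not> (xw = xu \<and> yw = yu)" and vw: "\<not> (xw = xv \<and> yw = yv)"
    using u(4) v(4) w(4) F3 uvw(2-4) anti by metis+
  have sep: "x \<noteq> y" if "x \<in> blk i" "y \<in> blk j" for x y using that ij(1) by (auto simp: mem_blk)
  show ?thesis
  proof (cases "ends w \<subseteq> ends u \<union> ends v")
    case False
    then have "(u, v, w) \<in> bad_triples F" using F3 cls3 uvw c by (auto simp: bad_triples_def)
    then show ?thesis using cls3 by blast
  next
    case True
    moreover have sep: "xw \<noteq> yu" "xw \<noteq> yv" "yw \<noteq> xu" "yw \<noteq> xv" "xv \<noteq> yu" "xv \<noteq> yw" "yv \<noteq> xu" "yv \<noteq> xw"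
      using sep u(2,3) v(2,3) w(2,3) by metis+
    ultimately have "xw = xu \<or> xw = xv" "yw = yu \<or> yw = yv"
      unfolding u(1) v(1) w(1) by auto
    then have "\<not> ends v \<subseteq> ends u \<union> ends w"
      unfolding u(1) v(1) w(1) using uw vw sep by auto
    then have "(u, w, v) \<in> bad_triples F" using F3 cls3 uvw c by (auto simp: bad_triples_def)
    then show ?thesis using cls3 by blast
  qed
qed

lemma finite_bad: 
  assumes "finite F"
  shows "finite (bad_pairs F)" "finite (bad_triples F)"
proof -
  show "finite (bad_pairs F)"
    by (rule finite_subset[of _ "F \<times> F"]) (use assms in \<open>auto simp: bad_pairs_def\<close>)
  show "finite (bad_triples F)"
    by (rule finite_subset[of _ "F \<times> F \<times> F"]) (use assms in \<open>auto simp: bad_triples_def\<close>)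
qed

lemma card_bad_classes_le:
  assumes F: "F \<subseteq> clique V" "bounded_orientation k F"
  shows "card (bad_classes F) \<le> card (bad_pairs F) + card (bad_triples F)"
proof -
  have finF: "finite F" using F by (auto simp: bounded_orientation_def)
  have "bad_classes F \<subseteq> (\<lambda>(e1, e2). cls e1) ` bad_pairs F \<union> (\<lambda>(e1, e2, e3). cls e1) ` bad_triples F"
  proof
    fix c assume c: "c \<in> bad_classes F"
    then have cc: "c \<in> classes" by (simp add: bad_classes_def)
    show "c \<in> (\<lambda>(e1, e2). cls e1) ` bad_pairs F \<union> (\<lambda>(e1, e2, e3). cls e1) ` bad_triples F"
    proof (cases "card c = 1")
      case True
      then have "card (F \<inter> class_arcs c) \<ge> 2" using c by (auto simp: bad_classes_def)
      then obtain T where T: "T \<subseteq> F \<inter> class_arcs c" "card T = 2" by (metis obtain_subset_with_card_n)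
      then obtain u v where "T = {u, v}" "u \<noteq> v" by (auto simp: card_2_iff)
      then have "(u, v) \<in> bad_pairs F" "cls u = c" using T(1) True
        by (auto simp: bad_pairs_def class_arcs_def)
      then show ?thesis by force
    next
      case False
      then have "card c = 2" "card (F \<inter> class_arcs c) \<ge> 3"
        using c card_classes_cases[OF cc] by (auto simp: bad_classes_def)
      then show ?thesis using biclass_triple[OF F cc] by force
    qed
  qed
  then have "card (bad_classes F) \<le> card ((\<lambda>(e1, e2). cls e1) ` bad_pairs F \<union> (\<lambda>(e1, e2, e3). cls e1) ` bad_triples F)"
    using finite_bad[OF finF] by (intro card_mono) auto
  also have "\<dots> \<le> card ((\<lambda>(e1, e2). cls e1) ` bad_pairs F) + card ((\<lambda>(e1, e2, e3). cls e1) ` bad_triples F)"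
    by (rule card_Un_le)
  also have "\<dots> \<le> card (bad_pairs F) + card (bad_triples F)"
    using finite_bad[OF finF] by (intro add_mono card_image_le)
  finally show ?thesis .
qed

text \<open>A good part has no arc, one arc, or two arcs in a bipartite part; the containment is
  then 1, 1 or \<open>1 + rho\<close> exactly, and \<open>ln (1 + x)\<close> is at least
  \<open>x - 2 * x^2\<close> when \<open>x\<close> is at most \<open>1/2\<close> in absolute value.
  The double sum runs over ordered pairs, hence the division by 2.\<close>

lemma ln_containment_ge:
  assumes F: "F \<subseteq> clique V" "bounded_orientation k F" and c: "c \<in> classes"
  defines "Fc \<equiv> F \<inter> class_arcs c"
  shows "containment V (class_arcs c) Fc > 0"
    and "ln (containment V (class_arcs c) Fc) \<ge>
      (\<Sum>e\<in>Fc. \<Sum>e'\<in>Fc - {e}. rho e e' - 2 * (rho e e')\<^sup>2) / 2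
      - 2 * real ((4 * m + 1) ^ 4) * of_bool (c \<in> bad_classes F)" (is "_ \<ge> ?R")
proof -
  let ?D = "class_arcs c"
  have finF: "finite F" using F by (auto simp: bounded_orientation_def)
  have finFc: "finite Fc" using finF by (simp add: Fc_def)
  have FcD: "Fc \<subseteq> ?D" by (simp add: Fc_def)
  have bFc: "bounded_orientation k Fc"
  proof -
    have "card (Fc `` {x}) \<le> card (F `` {x})" "card (Fc\<inverse> `` {x}) \<le> card (F\<inverse> `` {x})" for x
      using finF by (auto intro!: card_mono finite_Image simp: Fc_def)
    then show ?thesis using F(2) finFc unfolding bounded_orientation_def
      by (metis (no_types, lifting) Fc_def Int_iff order_trans)
  qed
  have low: "containment V ?D Fc \<ge> 1 / 2 ^ card ?D"
    using containment_lower[OF finite_class_arcs FcD class_extension[OF c FcD bFc]] .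
  moreover have "(0 :: real) < 1 / 2 ^ card ?D" by simp
  ultimately show pos: "containment V ?D Fc > 0" by linarith
  have ne: "balanced V ?D \<noteq> {}" using class_balanced_nonempty[OF c] .
  have m2: "1 / (real m - 1) \<le> 1 / 2" using m_large by (intro divide_left_mono) auto
  have rho2: "\<bar>rho e e'\<bar> \<le> 1 / 2" if "e \<in> Fc" "e' \<in> Fc" "e \<noteq> e'" for e e'
    using rho_abs_le[OF F, of e e'] that m2 by (auto simp: Fc_def)
  show "ln (containment V ?D Fc) \<ge> ?R"
  proof (cases "c \<in> bad_classes F")
    case True
    let ?d = "real (card ?D)"
    have dle: "?d \<le> real ((4 * m + 1)\<^sup>2)" using card_class_arcs_le[OF c] of_nat_mono by blast
    have "card Fc \<le> card ?D" using finite_class_arcs FcD by (intro card_mono)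
    have "Fc \<noteq> {}"
      using True by (auto simp: bad_classes_def Fc_def)
    then have "1 \<le> card Fc" using finFc by (simp add: Suc_le_eq card_gt_0_iff)
    then have d1: "1 \<le> ?d" using \<open>card Fc \<le> card ?D\<close> by linarith
    have "(\<Sum>e\<in>Fc. \<Sum>e'\<in>Fc - {e}. rho e e' - 2 * (rho e e')\<^sup>2) \<le> (\<Sum>e\<in>Fc. \<Sum>e'\<in>Fc - {e}. 1)"
    proof (intro sum_mono)
      fix e e' assume "e \<in> Fc" "e' \<in> Fc - {e}"
      then have "rho e e' \<le> 1 / 2" using rho2[of e e'] by auto
      then show "rho e e' - 2 * (rho e e')\<^sup>2 \<le> 1" using zero_le_power2[of "rho e e'"] by linarith
    qed
    also have "\<dots> \<le> (\<Sum>e\<in>Fc. real (card Fc))"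
      by (intro sum_mono) (use finFc in \<open>auto intro!: card_mono\<close>)
    also have "\<dots> = (real (card Fc))\<^sup>2" by (simp add: power2_eq_square)
    also have "\<dots> \<le> ?d\<^sup>2" using \<open>card Fc \<le> card ?D\<close> by (intro power_mono) auto
    finally have s: "(\<Sum>e\<in>Fc. \<Sum>e'\<in>Fc - {e}. rho e e' - 2 * (rho e e')\<^sup>2) \<le> ?d\<^sup>2" .
    have "ln (1 / 2 ^ card ?D) \<le> ln (containment V ?D Fc)" using low pos by (subst ln_le_cancel_iff) auto
    moreover have "ln (1 / 2 ^ card ?D) = - (?d * ln (2 :: real))" by (simp add: ln_div ln_realpow)
    moreover have "?d * ln (2 :: real) \<le> ?d * 1" using ln_le_minus_one[of "2 :: real"] by (intro mult_left_mono) auto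
    ultimately have l: "ln (containment V ?D Fc) \<ge> - ?d" by linarith
    have "?d * 1 \<le> ?d * ?d" using d1 by (intro mult_left_mono) auto
    then have "?d \<le> ?d\<^sup>2" by (simp add: power2_eq_square)
    moreover have "?d\<^sup>2 \<le> (real ((4 * m + 1)\<^sup>2))\<^sup>2" using dle by (intro power_mono) auto
    moreover have "(real ((4 * m + 1)\<^sup>2))\<^sup>2 = real ((4 * m + 1) ^ 4)" by (simp add: power_mult[symmetric])
    ultimately have k: "?d \<le> real ((4 * m + 1) ^ 4)" "?d\<^sup>2 \<le> real ((4 * m + 1) ^ 4)" by linarith+
    \<comment> \<open>With \<open>d = card ?D\<close>, the logarithm is at least \<open>- d\<close>
      and half the double sum is at most \<open>d^2 / 2\<close>. Both \<open>d\<close> and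
      \<open>d^2\<close> are at most \<open>(4 * m + 1) ^ 4\<close>, so twice this number covers the
      difference.\<close>
    have "(\<Sum>e\<in>Fc. \<Sum>e'\<in>Fc - {e}. rho e e' - 2 * (rho e e')\<^sup>2) / 2 - 2 * real ((4 * m + 1) ^ 4)
        \<le> ln (containment V ?D Fc)"
      using l s k d1 by linarith
    then show ?thesis using True by simp
  next
    case False
    then have good: "card Fc \<le> 1 \<or> card c = 2 \<and> card Fc = 2"
      using card_classes_cases[OF c] c by (auto simp: bad_classes_def Fc_def)
    then consider "Fc = {}" | e where "Fc = {e}" | "card c = 2" "card Fc = 2"
      using finFc by (metis card_0_eq card_1_singletonE le_Suc_eq le_zero_eq One_nat_def)
    then show ?thesis
    proof cases
      case 1 then show ?thesis
        using containment_empty[OF finite_class_arcs ne] False by simp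
    next
      case (2 e) then show ?thesis
        using containment_singleton[OF finite_class_arcs ne class_arcs_sym] FcD False by simp
    next
      case 3
      then obtain e e' where e: "Fc = {e, e'}" "e \<noteq> e'" by (auto simp: card_2_iff)
      have "cls e = c" "cls e' = c" using FcD e by (auto simp: class_arcs_def)
      then have r: "arc_corr V ?D e e' = rho e e'" using 3 by (simp add: rho_def)
      have "containment V ?D Fc = 1 + rho e e'"
        unfolding e(1) r[symmetric]
        by (rule containment_pair[OF finite_class_arcs ne class_arcs_sym]) (use FcD e in auto)
      moreover have "rho e e' - 2 * (rho e e')\<^sup>2 \<le> ln (1 + rho e e')"
        using abs_ln_one_plus_x_minus_x_bound[OF rho2[of e e']] e by auto
      moreover have "{e, e'} - {e} = {e'}" "{e, e'} - {e'} = {e}" using e by auto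
      ultimately show ?thesis using e False rho_commute[of e e'] by simp
    qed
  qed
qed

text \<open>Since \<open>rho\<close> vanishes between different parts, the double sums over the
  parts add up to the one over \<open>F\<close>. The random partition of \<open>F\<close> thus
  disappears from the main term.\<close>

lemma containment_product_ge:
  assumes F: "F \<subseteq> clique V" "bounded_orientation k F"
  shows "tour_containment F \<ge>
    1 + (\<Sum>e\<in>F. \<Sum>e'\<in>F - {e}. rho e e' - 2 * (rho e e')\<^sup>2) / 2
    - 2 * real ((4 * m + 1) ^ 4) * (real (card (bad_pairs F)) + real (card (bad_triples F)))"
proof -
  have finF: "finite F" using F by (auto simp: bounded_orientation_def)
  let ?q = "\<lambda>e e'. rho e e' - 2 * (rho e e')\<^sup>2"
  let ?F = "\<lambda>c. F \<inter> class_arcs c"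
  have "(\<Sum>e\<in>F. \<Sum>e'\<in>F - {e}. ?q e e') = (\<Sum>c\<in>classes. \<Sum>e\<in>?F c. \<Sum>e'\<in>F - {e}. ?q e e')"
  proof -
    have "(\<Sum>c\<in>classes. \<Sum>e\<in>{e \<in> F. cls e = c}. \<Sum>e'\<in>F - {e}. ?q e e') = (\<Sum>e\<in>F. \<Sum>e'\<in>F - {e}. ?q e e')"
      using finF finite_classes F(1) by (intro sum.group) (auto simp: classes_def)
    then show ?thesis by (simp add: class_arcs_inter[OF F(1)])
  qed
  also have "\<dots> = (\<Sum>c\<in>classes. \<Sum>e\<in>?F c. \<Sum>e'\<in>?F c - {e}. ?q e e')"
  proof (rule sum.cong[OF refl], rule sum.cong[OF refl])
    fix c e assume "e \<in> ?F c"
    then have e: "cls e = c" by (auto simp: class_arcs_def)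
    show "(\<Sum>e'\<in>F - {e}. ?q e e') = (\<Sum>e'\<in>?F c - {e}. ?q e e')"
      by (rule sum.mono_neutral_right)
        (use finF F(1) e in \<open>auto simp: class_arcs_inter[OF F(1)] rho_def\<close>)
  qed
  finally have split: "(\<Sum>e\<in>F. \<Sum>e'\<in>F - {e}. ?q e e') =
      (\<Sum>c\<in>classes. \<Sum>e\<in>?F c. \<Sum>e'\<in>?F c - {e}. ?q e e')" .
  let ?K = "2 * real ((4 * m + 1) ^ 4)"
  have bad: "(\<Sum>c\<in>classes. of_bool (c \<in> bad_classes F)) = real (card (bad_classes F))"
  proof -
    have "{c \<in> classes. c \<in> bad_classes F} = bad_classes F" by (auto simp: bad_classes_def)
    then show ?thesis using card_filter_sum[OF finite_classes, of "\<lambda>c. c \<in> bad_classes F"] by simp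
  qed
  define X where "X c = (\<Sum>e\<in>?F c. \<Sum>e'\<in>?F c - {e}. ?q e e')" for c
  have sums: "(\<Sum>c\<in>classes. X c / 2 - ?K * of_bool (c \<in> bad_classes F)) =
      (\<Sum>c\<in>classes. X c) / 2 - ?K * real (card (bad_classes F))"
    by (simp only: sum_subtractf sum_divide_distrib[symmetric] sum_distrib_left[symmetric] bad)
  have "?K * real (card (bad_classes F)) \<le> ?K * (real (card (bad_pairs F)) + real (card (bad_triples F)))"
    using card_bad_classes_le[OF F] by (intro mult_left_mono) auto
  then have "1 + (\<Sum>e\<in>F. \<Sum>e'\<in>F - {e}. ?q e e') / 2
      - ?K * (real (card (bad_pairs F)) + real (card (bad_triples F))) \<le>
      1 + (\<Sum>c\<in>classes. X c / 2 - ?K * of_bool (c \<in> bad_classes F))"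
    unfolding sums split X_def[symmetric] by linarith
  also have "\<dots> \<le> 1 + (\<Sum>c\<in>classes. ln (containment V (class_arcs c) (?F c)))"
    unfolding X_def by (intro add_left_mono sum_mono ln_containment_ge(2)[OF F])
  also have "\<dots> \<le> (\<Prod>c\<in>classes. containment V (class_arcs c) (?F c))"
    using ln_containment_ge(1)[OF F] by (intro prod_ge_one_plus_sum_ln)
  finally show ?thesis unfolding tour_containment_def .
qed

end

section \<open>Averaging over the placement\<close>

text \<open>The order of the tests is harmless in an orientation, where distinct arcs share at most
  one vertex.\<close>

definition pair_sign :: "'a \<times> 'a \<Rightarrow> 'a \<times> 'a \<Rightarrow> real" where
  "pair_sign e e' = (if snd e = fst e' \<or> snd e' = fst e then 1
     else if fst e = fst e' \<or> snd e = snd e' then - 1 else 0)"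

text \<open>\<open>X\<close> and \<open>E\<close> stand for the vertices and arcs of
  \<open>H\<close>. The bound \<open>12 \<le> card V\<close> admits up to 6 tracked points in
  \<open>sum_bijections_le\<close>, and \<open>4 * m \<le> card V\<close> keeps a positive
  proportion of the vertex pairs in different blocks.\<close>

locale random_embedding = block_partition V p b m k
  for V :: "'v :: linorder set" and p b m k +
  fixes X :: "'a set" and E :: "('a \<times> 'a) set"
  assumes finite_X: "finite X" and card_X: "card X = card V"
    and E_sub: "E \<subseteq> X \<times> X" and E_anti: "\<And>x y. (x, y) \<in> E \<Longrightarrow> (y, x) \<notin> E"
    and deg_le: "\<And>x. card {e \<in> E. x \<in> ends e} \<le> k"
    and k_pos: "k > 0" and n_large: "4 * m \<le> card V" "12 \<le> card V"
begin

abbreviation "n \<equiv> card V"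
abbreviation "\<Omega> \<equiv> bijections X V"

lemma finite_E: "finite E"
  using finite_X E_sub by (auto intro: finite_subset)

lemma E_ne: "(x, y) \<in> E \<Longrightarrow> x \<noteq> y"
  using E_anti by auto

lemma card_touching: "finite W \<Longrightarrow> card {e \<in> E. ends e \<inter> W \<noteq> {}} \<le> k * card W"
proof -
  assume W: "finite W"
  have "{e \<in> E. ends e \<inter> W \<noteq> {}} = (\<Union>x\<in>W. {e \<in> E. x \<in> ends e})" by auto
  then have "card {e \<in> E. ends e \<inter> W \<noteq> {}} \<le> (\<Sum>x\<in>W. card {e \<in> E. x \<in> ends e})"
    using W by (simp add: card_UN_le)
  also have "\<dots> \<le> (\<Sum>x\<in>W. k)" by (intro sum_mono deg_le)
  finally show ?thesis by (simp add: mult.commute)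
qed

lemma card_E: "card E \<le> k * n"
proof -
  have "{e \<in> E. ends e \<inter> X \<noteq> {}} = E" using E_sub by (auto simp: ends_def)
  then show ?thesis using card_touching[OF finite_X] card_X by simp
qed

lemma real_card_E: "real (card E) \<le> real k * real n"
  using card_E by (metis of_nat_mono of_nat_mult)

lemma card_touching_arc: "card {e' \<in> E. ends e' \<inter> ends e \<noteq> {}} \<le> 2 * k"
proof -
  have "card (ends e) \<le> 2" by (auto simp: ends_def card_insert_if)
  then have "k * card (ends e) \<le> k * 2" by (rule mult_left_mono) simp
  moreover have "finite (ends e)" by (simp add: ends_def)
  ultimately show ?thesis using card_touching[of "ends e"] by linarith
qed

definition img :: "('a \<Rightarrow> 'v) \<Rightarrow> ('v \<times> 'v) set" where "img \<phi> = map_prod \<phi> \<phi> ` E"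

lemma bij_facts:
  assumes "\<phi> \<in> \<Omega>"
  shows "inj_on \<phi> X" "\<phi> ` X = V"
  using assms by (auto simp: bijections_def bij_betw_def)

lemma inj_on_img:
  assumes "\<phi> \<in> \<Omega>"
  shows "inj_on (map_prod \<phi> \<phi>) E"
  using map_prod_inj_on[OF bij_facts(1)[OF assms] bij_facts(1)[OF assms]] E_sub inj_on_subset by blast

lemma img_clique:
  assumes "\<phi> \<in> \<Omega>"
  shows "img \<phi> \<subseteq> clique V"
  using bij_facts[OF assms] E_sub E_ne unfolding img_def clique_def
  by (fastforce dest: inj_onD)

lemma img_bounded:
  assumes phi: "\<phi> \<in> \<Omega>"
  shows "bounded_orientation k (img \<phi>)"
  unfolding bounded_orientation_def
proof (intro conjI allI impI)
  note inj = inj_onD[OF bij_facts(1)[OF phi]]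
  show "finite (img \<phi>)" using finite_E by (simp add: img_def)
  show "(y, x) \<notin> img \<phi>" if xy: "(x, y) \<in> img \<phi>" for x y
  proof
    assume "(y, x) \<in> img \<phi>"
    then obtain c c' where h: "(c, c') \<in> E" "y = \<phi> c" "x = \<phi> c'" by (auto simp: img_def)
    obtain a a' where h': "(a, a') \<in> E" "x = \<phi> a" "y = \<phi> a'" using xy by (auto simp: img_def)
    have "a = c'" "a' = c" using inj[of a c'] inj[of a' c] E_sub h h' by auto
    then show False using h h' E_anti by auto
  qed
  have *: "card {y. (x, y) \<in> img \<phi>} \<le> k" "card {y. (y, x) \<in> img \<phi>} \<le> k" for x
  proof -
    have "card {y. (x, y) \<in> img \<phi>} \<le> k \<and> card {y. (y, x) \<in> img \<phi>} \<le> k"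
    proof (cases "\<exists>a\<in>X. x = \<phi> a")
      case False
      then have "{y. (x, y) \<in> img \<phi>} = {}" "{y. (y, x) \<in> img \<phi>} = {}" using E_sub by (auto simp: img_def)
      then show ?thesis by simp
    next
      case True
      then obtain a where a: "a \<in> X" "x = \<phi> a" by blast
      have s1: "{y. (x, y) \<in> img \<phi>} \<subseteq> (\<lambda>e. \<phi> (snd e)) ` {e \<in> E. a \<in> ends e}"
      proof
        fix y assume "y \<in> {y. (x, y) \<in> img \<phi>}"
        then obtain c d where cd: "(c, d) \<in> E" "x = \<phi> c" "y = \<phi> d" by (auto simp: img_def)
        then have "c = a" using inj[of c a] a E_sub by auto
        then show "y \<in> (\<lambda>e. \<phi> (snd e)) ` {e \<in> E. a \<in> ends e}" using cd by (force simp: ends_def)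
      qed
      have s2: "{y. (y, x) \<in> img \<phi>} \<subseteq> (\<lambda>e. \<phi> (fst e)) ` {e \<in> E. a \<in> ends e}"
      proof
        fix y assume "y \<in> {y. (y, x) \<in> img \<phi>}"
        then obtain c d where cd: "(c, d) \<in> E" "x = \<phi> d" "y = \<phi> c" by (auto simp: img_def)
        then have "d = a" using inj[of d a] a E_sub by auto
        then show "y \<in> (\<lambda>e. \<phi> (fst e)) ` {e \<in> E. a \<in> ends e}" using cd by (force simp: ends_def)
      qed
      show ?thesis
        using surj_card_le[OF _ s1] surj_card_le[OF _ s2] deg_le[of a] finite_E by auto
    qed
    then show "card {y. (x, y) \<in> img \<phi>} \<le> k" "card {y. (y, x) \<in> img \<phi>} \<le> k" by auto
  qed
  show "card (img \<phi> `` {x}) \<le> k" for x using *(1)[of x] by (simp add: Image_singleton)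
  show "card ((img \<phi>)\<inverse> `` {x}) \<le> k" for x using *(2)[of x] by (simp add: Image_singleton)
qed

lemma sum_img:
  assumes phi: "\<phi> \<in> \<Omega>"
  shows "(\<Sum>e\<in>img \<phi>. \<Sum>e'\<in>img \<phi> - {e}. f e e') =
    (\<Sum>e\<in>E. \<Sum>e'\<in>E - {e}. f (map_prod \<phi> \<phi> e) (map_prod \<phi> \<phi> e'))"
proof -
  note inj = inj_on_img[OF phi]
  have "img \<phi> - {map_prod \<phi> \<phi> e} = map_prod \<phi> \<phi> ` (E - {e})" if "e \<in> E" for e
    using inj that by (auto simp: img_def inj_on_def)
  moreover have "inj_on (map_prod \<phi> \<phi>) (E - {e})" for e using inj by (rule inj_on_subset) auto
  ultimately have "(\<Sum>e'\<in>img \<phi> - {map_prod \<phi> \<phi> e}. f (map_prod \<phi> \<phi> e) e') =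
      (\<Sum>e'\<in>E - {e}. f (map_prod \<phi> \<phi> e) (map_prod \<phi> \<phi> e'))" if "e \<in> E" for e
    using that by (simp add: sum.reindex)
  then show ?thesis unfolding img_def
    by (subst sum.reindex[OF inj]) (auto simp: img_def)
qed

section \<open>First and second moments of the correlations\<close>

definition path_total :: real where
  "path_total = fact (n - 3) * (\<Sum>ys\<in>{ys \<in> lists_in 3 V. distinct ys}. path_corr (ys ! 0) (ys ! 1) (ys ! 2))"

lemma rho_placed_path:
  assumes "\<phi> \<in> \<Omega>" "x \<in> X" "y \<in> X" "z \<in> X" "x \<noteq> y" "y \<noteq> z" "x \<noteq> z"
  shows "rho (\<phi> x, \<phi> y) (\<phi> y, \<phi> z) = path_corr (\<phi> x) (\<phi> y) (\<phi> z)"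
  by (rule rho_path) (use bij_facts[OF assms(1)] assms in \<open>auto dest: inj_onD\<close>)

lemma sum_rho_path:
  assumes "x \<in> X" "y \<in> X" "z \<in> X" "x \<noteq> y" "y \<noteq> z" "x \<noteq> z"
  shows "(\<Sum>\<phi>\<in>\<Omega>. rho (\<phi> x, \<phi> y) (\<phi> y, \<phi> z)) = path_total"
proof -
  have "(\<Sum>\<phi>\<in>\<Omega>. rho (\<phi> x, \<phi> y) (\<phi> y, \<phi> z)) =
      (\<Sum>\<phi>\<in>\<Omega>. (\<lambda>ys. path_corr (ys ! 0) (ys ! 1) (ys ! 2)) (map \<phi> [x, y, z]))"
    by (intro sum.cong refl) (simp add: rho_placed_path assms)
  also have "\<dots> = path_total"
    using sum_bijections_list[OF finite_X finite_V card_X, of "[x, y, z]"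
        "\<lambda>ys. path_corr (ys ! 0) (ys ! 1) (ys ! 2)"] assms
    by (simp add: path_total_def numeral_3_eq_3)
  finally show ?thesis .
qed

text \<open>Exchanging the places of \<open>z\<close> and \<open>w\<close> reverses the second arc
  and flips the sign of the correlation.\<close>

lemma sum_rho_disjoint:
  assumes "x \<in> X" "y \<in> X" "z \<in> X" "w \<in> X" "distinct [x, y, z, w]"
  shows "(\<Sum>\<phi>\<in>\<Omega>. rho (\<phi> x, \<phi> y) (\<phi> z, \<phi> w)) = 0"
proof -
  have swap: "rho (\<phi> x, \<phi> y) (\<phi> w, \<phi> z) = - rho (\<phi> x, \<phi> y) (\<phi> z, \<phi> w)" for \<phi>
    using rho_swap[of "(\<phi> z, \<phi> w)" "(\<phi> x, \<phi> y)"] rho_commute[of "(\<phi> x, \<phi> y)"] by simp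
  have "(\<Sum>\<phi>\<in>\<Omega>. rho (\<phi> x, \<phi> y) (\<phi> z, \<phi> w)) =
      (\<Sum>\<phi>\<in>\<Omega>. rho (\<phi> x, \<phi> y) (\<phi> w, \<phi> z))"
    using sum_bijections_transpose[OF assms(3,4), of "\<lambda>\<phi>. rho (\<phi> x, \<phi> y) (\<phi> z, \<phi> w)" V] assms(5) by simp
  then show ?thesis unfolding swap by (simp add: sum_negf)
qed

lemma arc_pair_cases:
  assumes "e \<in> E" "e' \<in> E" "e \<noteq> e'"
  obtains (consistent) x y z where "x \<in> X" "y \<in> X" "z \<in> X" "x \<noteq> y" "y \<noteq> z" "x \<noteq> z"
      "pair_sign e e' = 1" "ends e \<union> ends e' = {x, y, z}"
      "e = (x, y) \<and> e' = (y, z) \<or> e' = (x, y) \<and> e = (y, z)"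
  | (inconsistent) x y z where "x \<in> X" "y \<in> X" "z \<in> X" "x \<noteq> y" "y \<noteq> z" "x \<noteq> z"
      "pair_sign e e' = - 1" "ends e \<union> ends e' = {x, y, z}"
      "e = (x, y) \<and> e' = (z, y) \<or> e = (y, x) \<and> e' = (y, z)"
  | (disjoint) x y z w where "x \<in> X" "y \<in> X" "z \<in> X" "w \<in> X" "distinct [x, y, z, w]"
      "pair_sign e e' = 0" "e = (x, y)" "e' = (z, w)" "ends e \<inter> ends e' = {}" "card (ends e \<union> ends e') = 4"
proof -
  obtain x y z w where e: "e = (x, y)" "e' = (z, w)" by (cases e, cases e')
  have V: "x \<in> X" "y \<in> X" "z \<in> X" "w \<in> X" using E_sub assms e by auto
  have ne: "x \<noteq> y" "z \<noteq> w" using assms e E_ne by auto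
  have anti: "\<not> (x = w \<and> y = z)" using assms e E_anti by auto
  consider "y = z" | "x = w" | "y \<noteq> z" "x \<noteq> w" "x = z" | "y \<noteq> z" "x \<noteq> w" "y = w"
    | "distinct [x, y, z, w]" using ne by auto
  then show thesis
  proof cases
    case 1 then show ?thesis using V ne anti e
      by (intro consistent[of x y w]) (auto simp: pair_sign_def ends_def)
  next
    case 2 then show ?thesis using V ne anti e
      by (intro consistent[of z x y]) (auto simp: pair_sign_def ends_def)
  next
    case 3 then show ?thesis using V ne anti e assms(3)
      by (intro inconsistent[of y x w]) (auto simp: pair_sign_def ends_def)
  next
    case 4 then show ?thesis using V ne anti e assms(3)
      by (intro inconsistent[of x y z]) (auto simp: pair_sign_def ends_def)
  next
    case 5 then show ?thesis using V e
      by (intro disjoint[of x y z w]) (auto simp: pair_sign_def ends_def)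
  qed
qed

text \<open>All adjacent pairs have the same average up to sign, so the first moment sees
  \<open>H\<close> only through the sum of \<open>pair_sign\<close>.\<close>

lemma sum_rho:
  assumes "e \<in> E" "e' \<in> E" "e \<noteq> e'"
  shows "(\<Sum>\<phi>\<in>\<Omega>. rho (map_prod \<phi> \<phi> e) (map_prod \<phi> \<phi> e')) = path_total * pair_sign e e'"
  using assms
proof (cases rule: arc_pair_cases)
  case (consistent x y z)
  have "(\<Sum>\<phi>\<in>\<Omega>. rho (map_prod \<phi> \<phi> e) (map_prod \<phi> \<phi> e')) =
      (\<Sum>\<phi>\<in>\<Omega>. rho (\<phi> x, \<phi> y) (\<phi> y, \<phi> z))"
    using consistent(9) rho_commute by (intro sum.cong refl) auto
  then show ?thesis using sum_rho_path[OF consistent(1-6)] consistent(7) by simp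
next
  case (inconsistent x y z)
  have "rho (map_prod \<phi> \<phi> e) (map_prod \<phi> \<phi> e') = - rho (\<phi> x, \<phi> y) (\<phi> y, \<phi> z)" for \<phi>
    using inconsistent(9) rho_swap[of "(\<phi> x, \<phi> y)" "(\<phi> y, \<phi> z)"]
      rho_swap[of "(\<phi> y, \<phi> z)" "(\<phi> x, \<phi> y)"] rho_commute[of "(\<phi> x, \<phi> y)"] by auto
  then show ?thesis using sum_rho_path[OF inconsistent(1-6)] inconsistent(7) by (simp add: sum_negf)
next
  case (disjoint x y z w)
  then show ?thesis using sum_rho_disjoint[OF disjoint(1-5)] by simp
qed

lemma path_total_ge: "path_total \<ge> fact n / (2 * real n)"
proof -
  have n: "real n \<ge> 12" "real n \<ge> 4 * real m" using n_large by linarith+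
  have fact3: "fact n = real n * (real n - 1) * (real n - 2) * fact (n - 3)"
  proof -
    have "n = Suc (Suc (Suc (n - 3)))" using n_large(2) by simp
    then obtain l where l: "n = Suc (Suc (Suc l))" by blast
    show ?thesis unfolding l by (simp add: algebra_simps)
  qed
  \<comment> \<open>By \<open>4 * m \<le> n\<close> the factor \<open>n - 1 - 2 * m\<close> is at
    least \<open>(n - 2) / 2\<close>; this loss of one half is the 2 in the claimed bound.\<close>
  have "(real n - 1) * ((real n - 2) / 2) \<le> (real n - 1) * (real n - 1 - 2 * real m)"
    using n by (intro mult_left_mono) auto
  then have "fact (n - 3) * ((real n - 1) * ((real n - 2) / 2)) \<le> path_total"
    unfolding path_total_def using sum_path_corr_ge by (intro mult_left_mono) auto
  moreover have "fact n / (2 * real n) = fact (n - 3) * ((real n - 1) * ((real n - 2) / 2))"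
    using n unfolding fact3 by (simp add: field_simps)
  ultimately show ?thesis by simp
qed

lemma sum_rho_sq_path:
  assumes "x \<in> X" "y \<in> X" "z \<in> X" "x \<noteq> y" "y \<noteq> z" "x \<noteq> z"
  shows "(\<Sum>\<phi>\<in>\<Omega>. (rho (\<phi> x, \<phi> y) (\<phi> y, \<phi> z))\<^sup>2) \<le> fact n * (16 / (real m - 1)) / real n"
proof -
  have n: "real n > 0" using n_large by simp
  have "(\<Sum>\<phi>\<in>\<Omega>. (rho (\<phi> x, \<phi> y) (\<phi> y, \<phi> z))\<^sup>2) =
      (\<Sum>\<phi>\<in>\<Omega>. (\<lambda>ys. (path_corr (ys ! 0) (ys ! 1) (ys ! 2))\<^sup>2) (map \<phi> [x, y, z]))"
    by (intro sum.cong refl) (simp add: rho_placed_path assms)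
  also have "\<dots> \<le> fact n * (2 / real n) ^ length [x, y, z] *
      (\<Sum>ys\<in>lists_in (length [x, y, z]) V. (path_corr (ys ! 0) (ys ! 1) (ys ! 2))\<^sup>2)"
    by (rule sum_bijections_le[OF finite_X finite_V card_X]) (use assms n_large in auto)
  \<comment> \<open>The 16 is \<open>2 ^ 3\<close>, the price of sampling with replacement, times
    the 2 of \<open>sum_path_corr_sq_le\<close>.\<close>
  also have "\<dots> \<le> fact n * (2 / real n) ^ 3 * (2 * (real n)\<^sup>2 / (real m - 1))"
    using sum_path_corr_sq_le by (simp only: list.size add_0_right One_nat_def add_Suc_right numeral_3_eq_3)
      (intro mult_left_mono, auto simp: numeral_3_eq_3)
  also have "\<dots> = fact n * (16 / (real m - 1)) / real n"
  proof -
    have "a * (2 / N) ^ 3 * (2 * N\<^sup>2 / M) = a * (16 / M) / N" if "N > 0" for a N M :: real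
      using that by (simp add: power2_eq_square power3_eq_cube mult_ac)
    then show ?thesis using n by blast
  qed
  finally show ?thesis .
qed

lemma sum_rho_sq_disjoint:
  assumes "x \<in> X" "y \<in> X" "z \<in> X" "w \<in> X" "distinct [x, y, z, w]"
  shows "(\<Sum>\<phi>\<in>\<Omega>. (rho (\<phi> x, \<phi> y) (\<phi> z, \<phi> w))\<^sup>2) \<le> fact n * (128 / (real m - 1)) / (real n)\<^sup>2"
proof -
  have n: "real n > 0" using n_large by simp
  let ?g = "\<lambda>ys. (pair_corr (ys ! 0) (ys ! 1) (ys ! 2) (ys ! 3))\<^sup>2"
  have l4: "length [x, y, z, w] = 4" by simp
  have "(\<Sum>\<phi>\<in>\<Omega>. (rho (\<phi> x, \<phi> y) (\<phi> z, \<phi> w))\<^sup>2) =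
      (\<Sum>\<phi>\<in>\<Omega>. ?g (map \<phi> [x, y, z, w]))"
  proof (rule sum.cong[OF refl])
    fix \<phi> assume phi: "\<phi> \<in> \<Omega>"
    have "\<bar>rho (\<phi> x, \<phi> y) (\<phi> z, \<phi> w)\<bar> = pair_corr (\<phi> x) (\<phi> y) (\<phi> z) (\<phi> w)"
      by (rule rho_disjoint) (use bij_facts[OF phi] assms in \<open>auto dest: inj_onD\<close>)
    then show "(rho (\<phi> x, \<phi> y) (\<phi> z, \<phi> w))\<^sup>2 = ?g (map \<phi> [x, y, z, w])"
      using power2_abs[of "rho (\<phi> x, \<phi> y) (\<phi> z, \<phi> w)"] by simp
  qed
  also have "\<dots> \<le> fact n * (2 / real n) ^ length [x, y, z, w] * (\<Sum>ys\<in>lists_in (length [x, y, z, w]) V. ?g ys)"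
    by (rule sum_bijections_le[OF finite_X finite_V card_X]) (use assms n_large in auto)
  also have "\<dots> \<le> fact n * (2 / real n) ^ 4 * (8 * (real n)\<^sup>2 / (real m - 1))"
    unfolding l4 using sum_pair_corr_sq_le by (intro mult_left_mono) auto
  also have "\<dots> = fact n * (128 / (real m - 1)) / (real n)\<^sup>2"
  proof -
    have "a * (2 / N) ^ 4 * (8 * N\<^sup>2 / M) = a * (128 / M) / N\<^sup>2" if "N > 0" for a N M :: real
      using that by (simp add: power2_eq_square power4_eq_xxxx mult_ac)
    then show ?thesis using n by blast
  qed
  finally show ?thesis .
qed

text \<open>Put \<open>c = 16 * fact n / (m - 1)\<close>. An arc meets at most \<open>2 * k\<close>
  arcs, each costing \<open>c / n\<close>, and there are at most \<open>k * n\<close> arcs to pay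
  the disjoint price \<open>8 * c / n^2\<close>: together \<open>10 * k * c / n\<close>. Over
  \<open>k * n\<close> arcs this yields the constant 160.\<close>

lemma sum_rho_sq_total:
  "(\<Sum>e\<in>E. \<Sum>e'\<in>E - {e}. \<Sum>\<phi>\<in>\<Omega>. (rho (map_prod \<phi> \<phi> e) (map_prod \<phi> \<phi> e'))\<^sup>2)
    \<le> fact n * (160 * (real k)\<^sup>2 / (real m - 1))"
proof -
  let ?Q = "\<lambda>e e'. \<Sum>\<phi>\<in>\<Omega>. (rho (map_prod \<phi> \<phi> e) (map_prod \<phi> \<phi> e'))\<^sup>2"
  have n: "real n > 0" "real m - 1 > 0" using n_large m_large by auto
  define c where "c = fact n * (16 / (real m - 1))"
  have c: "c \<ge> 0" using n by (simp add: c_def)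
  have each: "?Q e e' \<le>
      c / real n * of_bool (ends e' \<inter> ends e \<noteq> {}) + 8 * c / (real n)\<^sup>2"
    if "e \<in> E" "e' \<in> E" "e \<noteq> e'" for e e'
    using that
  proof (cases rule: arc_pair_cases)
    case (consistent x y z)
    have "?Q e e' =
        (\<Sum>\<phi>\<in>\<Omega>. (rho (\<phi> x, \<phi> y) (\<phi> y, \<phi> z))\<^sup>2)"
      using consistent(9) rho_commute by (intro sum.cong refl) auto
    also have "\<dots> \<le> c / real n" using sum_rho_sq_path[OF consistent(1-6)] by (simp add: c_def)
    moreover have "ends e' \<inter> ends e \<noteq> {}" using consistent(9) by (auto simp: ends_def)
    ultimately show ?thesis using c by (simp add: add_increasing2)
  next
    case (inconsistent x y z)
    have "(rho (map_prod \<phi> \<phi> e) (map_prod \<phi> \<phi> e'))\<^sup>2 = (rho (\<phi> x, \<phi> y) (\<phi> y, \<phi> z))\<^sup>2" for \<phi>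
      using inconsistent(9) rho_swap[of "(\<phi> x, \<phi> y)" "(\<phi> y, \<phi> z)"]
        rho_swap[of "(\<phi> y, \<phi> z)" "(\<phi> x, \<phi> y)"] rho_commute[of "(\<phi> x, \<phi> y)"] by auto
    then have "?Q e e' \<le> c / real n"
      using sum_rho_sq_path[OF inconsistent(1-6)] by (simp add: c_def)
    moreover have "ends e' \<inter> ends e \<noteq> {}" using inconsistent(9) by (auto simp: ends_def)
    ultimately show ?thesis using c by (simp add: add_increasing2)
  next
    case (disjoint x y z w)
    then show ?thesis using sum_rho_sq_disjoint[OF disjoint(1-5)] c n
      by (simp add: c_def Int_commute mult.commute[of 128])
  qed
  have inner: "(\<Sum>e'\<in>E - {e}. ?Q e e')
      \<le> 10 * real k * c / real n" if e: "e \<in> E" for e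
  proof -
    have "(\<Sum>e'\<in>E - {e}. ?Q e e')
        \<le> (\<Sum>e'\<in>E - {e}. c / real n * of_bool (ends e' \<inter> ends e \<noteq> {}) + 8 * c / (real n)\<^sup>2)"
      by (intro sum_mono each[OF e]) auto
    also have "\<dots> \<le> (\<Sum>e'\<in>E. c / real n * of_bool (ends e' \<inter> ends e \<noteq> {}) + 8 * c / (real n)\<^sup>2)"
      using finite_E c n by (intro sum_mono2) auto
    also have "\<dots> = c / real n * real (card {e' \<in> E. ends e' \<inter> ends e \<noteq> {}}) + real (card E) * (8 * c / (real n)\<^sup>2)"
      using finite_E by (simp only: sum.distrib sum_distrib_left[symmetric] card_filter_sum[symmetric] sum_constant)
    also have "\<dots> \<le> c / real n * (2 * real k) + (real k * real n) * (8 * c / (real n)\<^sup>2)"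
    proof (intro add_mono mult_left_mono mult_right_mono)
      show "real (card {e' \<in> E. ends e' \<inter> ends e \<noteq> {}}) \<le> 2 * real k"
        using card_touching_arc[of e] by linarith
    qed (use c n real_card_E in auto)
    also have "\<dots> = 10 * real k * c / real n" using n by (simp add: power2_eq_square field_simps)
    finally show ?thesis .
  qed
  have "(\<Sum>e\<in>E. \<Sum>e'\<in>E - {e}. ?Q e e')
      \<le> (\<Sum>e\<in>E. 10 * real k * c / real n)" by (intro sum_mono inner)
  also have "\<dots> \<le> (real k * real n) * (10 * real k * c / real n)"
    using c n real_card_E by (simp only: sum_constant) (intro mult_right_mono, auto)
  also have "\<dots> = fact n * (160 * (real k)\<^sup>2 / (real m - 1))"
    using n by (simp add: c_def power2_eq_square)
  finally show ?thesis .
qed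

end

section \<open>Rarity of the bad parts\<close>

context block_partition
begin

text \<open>Candidate vertex sets of the parts, indexed by the number of labels. Allowing
  \<open>i = j\<close> in the second case only enlarges the family over which the union bound
  runs.\<close>

definition supports :: "nat \<Rightarrow> 'v set set" where
  "supports r = (if r = 1 then (\<lambda>i. insert p (blk i)) ` b ` (V - {p})
     else (\<lambda>(i, j). blk i \<union> blk j) ` (b ` (V - {p}) \<times> b ` (V - {p})))"

lemma finite_supports: "finite (supports r)"
  using finite_V by (simp add: supports_def)

lemma card_supports_le: "card (supports 1) \<le> card V" "card (supports 2) \<le> (card V)\<^sup>2"
proof -
  have I: "card (b ` (V - {p})) \<le> card V"
    using finite_V by (meson card_image_le card_mono finite_Diff Diff_subset le_trans)
  show "card (supports 1) \<le> card V"
    using card_image_le[of "b ` (V - {p})" "\<lambda>i. insert p (blk i)"] I finite_V by (simp add: supports_def)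
  have "card (supports 2) \<le> card (b ` (V - {p}) \<times> b ` (V - {p}))"
  proof -
    have "supports 2 = (\<lambda>(i, j). blk i \<union> blk j) ` (b ` (V - {p}) \<times> b ` (V - {p}))"
      by (simp add: supports_def)
    then show ?thesis using finite_V by (simp only:) (intro card_image_le, simp)
  qed
  also have "\<dots> \<le> (card V)\<^sup>2"
    using I by (simp add: card_cartesian_product power2_eq_square mult_mono)
  finally show "card (supports 2) \<le> (card V)\<^sup>2" .
qed

lemma supports_size:
  assumes "U \<in> supports r"
  shows "U \<subseteq> V" "card U \<le> 4 * m"
proof -
  show "U \<subseteq> V" using assms p_in_V blk_subset by (auto simp: supports_def split: if_splits)
  show "card U \<le> 4 * m"
  proof (cases "r = 1")
    case True
    then obtain i where i: "i \<in> b ` (V - {p})" "U = insert p (blk i)"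
      using assms unfolding supports_def by auto
    then show ?thesis using blk_size(3)[OF i(1)] blk_subset[of i] m_large by simp
  next
    case False
    then obtain i j where i: "i \<in> b ` (V - {p})" "j \<in> b ` (V - {p})" "U = blk i \<union> blk j"
      using assms unfolding supports_def by auto
    then show ?thesis using blk_size(3)[OF i(1)] blk_size(3)[OF i(2)] card_Un_le[of "blk i" "blk j"] by simp
  qed
qed

lemma class_support:
  assumes "c \<in> classes"
  shows "\<exists>U\<in>supports (card c). \<forall>e\<in>class_arcs c. ends e \<subseteq> U"
  using assms
proof (cases rule: classes_cases)
  case (1 i)
  have "insert p (blk i) \<in> supports (card c)" using 1 by (auto simp: supports_def)
  moreover have "\<forall>e\<in>class_arcs c. ends e \<subseteq> insert p (blk i)"
    unfolding 1(3) by (auto simp: clique_def ends_def)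
  ultimately show ?thesis by blast
next
  case (2 i j)
  have "card c \<noteq> 1" using 2 by simp
  then have "blk i \<union> blk j \<in> supports (card c)" using 2(1,2) unfolding supports_def by auto
  moreover have "\<forall>e\<in>class_arcs c. ends e \<subseteq> blk i \<union> blk j"
    unfolding 2(5) by (auto simp: biclique_def ends_def)
  ultimately show ?thesis by blast
qed

end

context random_embedding
begin

abbreviation placed :: "nat \<Rightarrow> ('a \<Rightarrow> 'v) \<Rightarrow> 'a set \<Rightarrow> bool" where
  "placed r \<phi> W \<equiv> \<exists>U\<in>supports r. \<phi> ` W \<subseteq> U"

text \<open>A union bound over the supports: with replacement, a vertex hits a set of at most
  \<open>4 * m\<close> vertices with probability \<open>4 * m / n\<close>, and the comparison
  doubles the base to \<open>8 * m\<close>. The exponent of \<open>8 * m\<close> is raised to 6, the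
  most vertices that three arcs can span, to have a single constant.\<close>

lemma sum_placed_le:
  assumes W: "W \<subseteq> X" "card W \<le> 6"
  shows "(\<Sum>\<phi>\<in>\<Omega>. of_bool (placed r \<phi> W)) \<le>
    fact n * real (card (supports r)) * real (8 * m) ^ 6 * (1 / real n) ^ card W"
proof -
  have finW: "finite W" using W(1) finite_X by (rule finite_subset)
  obtain xs where xs: "set xs = W" "distinct xs" using finite_distinct_list[OF finW] by blast
  have len: "length xs = card W" using xs distinct_card by metis
  let ?L = "\<lambda>ys. of_bool (\<exists>U\<in>supports r. set ys \<subseteq> U) :: real"
  have "(\<Sum>\<phi>\<in>\<Omega>. of_bool (placed r \<phi> W)) = (\<Sum>\<phi>\<in>\<Omega>. ?L (map \<phi> xs))"
    using xs by simp
  also have "\<dots> \<le> fact n * (2 / real n) ^ length xs * (\<Sum>ys\<in>lists_in (length xs) V. ?L ys)"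
    by (rule sum_bijections_le[OF finite_X finite_V card_X]) (use xs W len n_large in auto)
  also have "\<dots> \<le> fact n * (2 / real n) ^ length xs * (real (card (supports r)) * real (4 * m) ^ length xs)"
  proof (rule mult_left_mono)
    have "(\<Sum>ys\<in>lists_in (length xs) V. ?L ys) = real (card {ys \<in> lists_in (length xs) V. \<exists>U\<in>supports r. set ys \<subseteq> U})"
      using finite_lists_in[OF finite_V] by (rule card_filter_sum[symmetric])
    also have "card {ys \<in> lists_in (length xs) V. \<exists>U\<in>supports r. set ys \<subseteq> U} \<le>
        card (\<Union>U\<in>supports r. lists_in (length xs) U)"
    proof (rule card_mono)
      show "finite (\<Union>U\<in>supports r. lists_in (length xs) U)"
        using finite_supports finite_lists_in finite_subset[OF supports_size(1) finite_V] by blast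
    qed (auto simp: lists_in_def)
    also have "\<dots> \<le> (\<Sum>U\<in>supports r. card (lists_in (length xs) U))"
      using finite_supports by (rule card_UN_le)
    also have "\<dots> \<le> (\<Sum>U\<in>supports r. (4 * m) ^ length xs)"
    proof (rule sum_mono)
      fix U assume U: "U \<in> supports r"
      then have "finite U" using supports_size(1) finite_V by (blast intro: finite_subset)
      then show "card (lists_in (length xs) U) \<le> (4 * m) ^ length xs"
        using power_mono[OF supports_size(2)[OF U]] by (simp add: card_lists_in del: power_mult_distrib)
    qed
    also have "\<dots> = card (supports r) * (4 * m) ^ length xs" by simp
    finally show "(\<Sum>ys\<in>lists_in (length xs) V. ?L ys) \<le> real (card (supports r)) * real (4 * m) ^ length xs"
      by (simp flip: of_nat_power of_nat_mult)
  qed auto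
  also have "\<dots> = fact n * real (card (supports r)) * real (8 * m) ^ card W * (1 / real n) ^ card W"
  proof -
    have "(2 / real n) ^ card W * real (4 * m) ^ card W = real (8 * m) ^ card W * (1 / real n) ^ card W"
      unfolding power_mult_distrib[symmetric] by (rule arg_cong[where f = "\<lambda>x. x ^ card W"]) simp
    then show ?thesis unfolding len by (simp only: mult_ac)
  qed
  also have "\<dots> \<le> fact n * real (card (supports r)) * real (8 * m) ^ 6 * (1 / real n) ^ card W"
    using W(2) m_large by (intro mult_right_mono mult_left_mono power_increasing) auto
  finally show ?thesis .
qed

lemma card_pair_ends:
  assumes "e \<in> E" "e' \<in> E" "e \<noteq> e'"
  shows "3 \<le> card (ends e \<union> ends e')" "card (ends e \<union> ends e') \<le> 4"
    and "ends e' \<inter> ends e = {} \<Longrightarrow> card (ends e \<union> ends e') = 4"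
  using assms by (cases rule: arc_pair_cases; auto simp: ends_def card_insert_if)+

text \<open>A bound for the expected number of arc pairs inside a given support, up to powers of
  \<open>m\<close>.\<close>

definition pair_weight :: real where
  "pair_weight = (\<Sum>e1\<in>E. \<Sum>e2\<in>E - {e1}. (1 / real n) ^ card (ends e1 \<union> ends e2))"

text \<open>Adjacent pairs span three vertices and number at most of order \<open>k^2 * n\<close>;
  disjoint pairs span four and number at most \<open>(k * n)^2\<close>. Both contribute order
  \<open>k^2 / n^2\<close>.\<close>

lemma weight_pairs: "pair_weight \<le> 5 * (real k)\<^sup>2 / (real n)\<^sup>2"
proof -
  define u where "u = 1 / real n"
  have u: "0 < u" "u \<le> 1" "real n * u = 1" using n_large by (auto simp: u_def)
  note kn = real_card_E
  have inner: "(\<Sum>e2\<in>E - {e1}. u ^ card (ends e1 \<union> ends e2)) \<le> 5 * real k * u ^ 3" if e: "e1 \<in> E" for e1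
  proof -
    have "(\<Sum>e2\<in>E - {e1}. u ^ card (ends e1 \<union> ends e2)) \<le>
        (\<Sum>e2\<in>E - {e1}. u ^ 3 * of_bool (ends e2 \<inter> ends e1 \<noteq> {}) + u ^ 4)"
    proof (rule sum_mono)
      fix e2 assume "e2 \<in> E - {e1}"
      then have e2: "e2 \<in> E" "e1 \<noteq> e2" by auto
      show "u ^ card (ends e1 \<union> ends e2) \<le> u ^ 3 * of_bool (ends e2 \<inter> ends e1 \<noteq> {}) + u ^ 4"
      proof (cases "ends e2 \<inter> ends e1 = {}")
        case True then show ?thesis using card_pair_ends(3)[OF e e2] by simp
      next
        case False
        have "u ^ card (ends e1 \<union> ends e2) \<le> u ^ 3"
          using card_pair_ends(1)[OF e e2] u by (intro power_decreasing) auto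
        then show ?thesis using False u by (simp add: add_increasing2)
      qed
    qed
    also have "\<dots> \<le> (\<Sum>e2\<in>E. u ^ 3 * of_bool (ends e2 \<inter> ends e1 \<noteq> {}) + u ^ 4)"
      using finite_E u by (intro sum_mono2) auto
    also have "\<dots> = u ^ 3 * real (card {e2 \<in> E. ends e2 \<inter> ends e1 \<noteq> {}}) + real (card E) * u ^ 4"
      using finite_E by (simp only: sum.distrib sum_distrib_left[symmetric] card_filter_sum[symmetric] sum_constant)
    also have "\<dots> \<le> u ^ 3 * (4 * real k) + (real k * real n) * u ^ 4"
    proof (intro add_mono mult_left_mono mult_right_mono)
      show "real (card {e2 \<in> E. ends e2 \<inter> ends e1 \<noteq> {}}) \<le> 4 * real k"
        using card_touching_arc[of e1] by linarith
    qed (use u kn in auto)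
    also have "real k * real n * u ^ 4 = real k * u ^ 3"
    proof -
      have "real k * real n * u ^ 4 = real k * u ^ 3 * (real n * u)" by (simp add: eval_nat_numeral)
      then show ?thesis unfolding u(3) by simp
    qed
    finally show ?thesis by (simp add: algebra_simps)
  qed
  have "(\<Sum>e1\<in>E. \<Sum>e2\<in>E - {e1}. u ^ card (ends e1 \<union> ends e2)) \<le> (\<Sum>e1\<in>E. 5 * real k * u ^ 3)"
    by (intro sum_mono inner)
  also have "\<dots> \<le> (real k * real n) * (5 * real k * u ^ 3)"
    using kn u by (simp only: sum_constant) (intro mult_right_mono, auto)
  also have "\<dots> = 5 * (real k)\<^sup>2 * u\<^sup>2 * (real n * u)" by (simp add: eval_nat_numeral)
  also have "\<dots> = 5 * (real k)\<^sup>2 / (real n)\<^sup>2" using u(3) by (simp add: u_def power_divide)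
  finally show ?thesis by (simp add: u_def pair_weight_def)
qed

text \<open>A third arc with a new vertex either meets \<open>W\<close>, with at most
  \<open>4 * k\<close> choices and at least one factor \<open>1/n\<close>, or avoids it, with at
  most \<open>k * n\<close> choices and two such factors. Either way a factor of order
  \<open>k / n\<close> is won; this is the purpose of the new vertex in
  \<open>bad_triples\<close>.\<close>

lemma weight_third:
  assumes W: "finite W" "card W \<le> 4"
  shows "(\<Sum>e\<in>{e \<in> E. \<not> ends e \<subseteq> W}. (1 / real n) ^ card (W \<union> ends e)) \<le>
    (1 / real n) ^ card W * (5 * real k / real n)"
proof -
  define u where "u = 1 / real n"
  have u: "0 < u" "u \<le> 1" "real n * u = 1" using n_large by (auto simp: u_def)
  note kn = real_card_E
  have "(\<Sum>e\<in>{e \<in> E. \<not> ends e \<subseteq> W}. u ^ card (W \<union> ends e)) \<le>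
      (\<Sum>e\<in>{e \<in> E. \<not> ends e \<subseteq> W}. u ^ card W * (u * of_bool (ends e \<inter> W \<noteq> {}) + u\<^sup>2))"
  proof (rule sum_mono)
    fix e assume e: "e \<in> {e \<in> E. \<not> ends e \<subseteq> W}"
    have fin: "finite (W \<union> ends e)" using W by (simp add: ends_def)
    show "u ^ card (W \<union> ends e) \<le> u ^ card W * (u * of_bool (ends e \<inter> W \<noteq> {}) + u\<^sup>2)"
    proof (cases "ends e \<inter> W = {}")
      case True
      have "card (ends e) = 2" using e E_ne by (cases e) (auto simp: ends_def)
      then have "card (W \<union> ends e) = card W + 2"
        using True W by (subst card_Un_disjoint) (auto simp: ends_def)
      then show ?thesis using True by (simp add: power2_eq_square mult_ac)
    next
      case False
      have "W \<subset> W \<union> ends e" using e by auto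
      then have "card W < card (W \<union> ends e)" using fin by (rule psubset_card_mono[rotated])
      then have "u ^ card (W \<union> ends e) \<le> u ^ (card W + 1)" using u by (intro power_decreasing) auto
      also have "\<dots> \<le> u ^ card W * (u * of_bool (ends e \<inter> W \<noteq> {}) + u\<^sup>2)"
        using False u by (simp add: mult.commute[of u] mult_left_mono)
      finally show ?thesis .
    qed
  qed
  also have "\<dots> \<le> (\<Sum>e\<in>E. u ^ card W * (u * of_bool (ends e \<inter> W \<noteq> {}) + u\<^sup>2))"
    using finite_E u by (intro sum_mono2) auto
  also have "\<dots> = u ^ card W * (u * real (card {e \<in> E. ends e \<inter> W \<noteq> {}}) + real (card E) * u\<^sup>2)"
    using finite_E by (simp only: sum.distrib sum_distrib_left[symmetric] card_filter_sum[symmetric] sum_constant)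
  also have "\<dots> \<le> u ^ card W * (u * (4 * real k) + (real k * real n) * u\<^sup>2)"
  proof (intro add_mono mult_left_mono mult_right_mono)
    have "card {e \<in> E. ends e \<inter> W \<noteq> {}} \<le> k * card W" by (rule card_touching[OF W(1)])
    also have "\<dots> \<le> k * 4" using W(2) by (rule mult_left_mono) simp
    finally show "real (card {e \<in> E. ends e \<inter> W \<noteq> {}}) \<le> 4 * real k" by linarith
  qed (use u kn in auto)
  also have "real k * real n * u\<^sup>2 = real k * u"
  proof -
    have "real k * real n * u\<^sup>2 = real k * u * (real n * u)" by (simp add: power2_eq_square)
    then show ?thesis unfolding u(3) by simp
  qed
  also have "u * (4 * real k) + real k * u = 5 * real k / real n" by (simp add: u_def)
  finally show ?thesis by (simp add: u_def)
qed

lemma img_arc_ends: "ends (map_prod \<phi> \<phi> e) = \<phi> ` ends e"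
  by (cases e) (auto simp: ends_def)

text \<open>Translates equality of random labels into confinement to one of few small sets, to which
  the union bound applies.\<close>

lemma img_same_class:
  assumes phi: "\<phi> \<in> \<Omega>" and S: "S \<subseteq> E" "e \<in> S"
    and same: "\<And>e'. e' \<in> S \<Longrightarrow> cls (map_prod \<phi> \<phi> e') = cls (map_prod \<phi> \<phi> e)"
  shows "\<exists>U\<in>supports (card (cls (map_prod \<phi> \<phi> e))). \<phi> ` (\<Union>e'\<in>S. ends e') \<subseteq> U"
proof -
  have cl: "map_prod \<phi> \<phi> e' \<in> clique V" if "e' \<in> S" for e'
    using img_clique[OF phi] S(1) that by (auto simp: img_def)
  then have "cls (map_prod \<phi> \<phi> e) \<in> classes" using S(2) by (auto simp: classes_def)
  then obtain U where U: "U \<in> supports (card (cls (map_prod \<phi> \<phi> e)))"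
    "\<forall>f\<in>class_arcs (cls (map_prod \<phi> \<phi> e)). ends f \<subseteq> U" using class_support by blast
  have "\<phi> ` ends e' \<subseteq> U" if "e' \<in> S" for e'
  proof -
    have "map_prod \<phi> \<phi> e' \<in> class_arcs (cls (map_prod \<phi> \<phi> e))"
      using cl[OF that] same[OF that] by (simp add: class_arcs_def)
    then have "ends (map_prod \<phi> \<phi> e') \<subseteq> U" using U(2) by blast
    then show ?thesis by (simp add: img_arc_ends)
  qed
  then have "\<phi> ` (\<Union>e'\<in>S. ends e') \<subseteq> U" by blast
  then show ?thesis using U(1) by blast
qed

lemma bad_pairs_le:
  assumes phi: "\<phi> \<in> \<Omega>"
  shows "real (card (bad_pairs (img \<phi>))) \<le>
    (\<Sum>e1\<in>E. \<Sum>e2\<in>E - {e1}. of_bool (placed 1 \<phi> (ends e1 \<union> ends e2)))"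
proof -
  let ?g = "map_prod \<phi> \<phi>"
  have finI: "finite (img \<phi>)" using finite_E by (simp add: img_def)
  have "bad_pairs (img \<phi>) = (SIGMA e1:img \<phi>. {e2 \<in> img \<phi> - {e1}. cls e1 = cls e2 \<and> card (cls e1) = 1})"
    by (auto simp: bad_pairs_def)
  then have "real (card (bad_pairs (img \<phi>))) =
      (\<Sum>e1\<in>img \<phi>. real (card {e2 \<in> img \<phi> - {e1}. cls e1 = cls e2 \<and> card (cls e1) = 1}))"
    using finI by (simp add: card_SigmaI)
  also have "\<dots> = (\<Sum>e1\<in>img \<phi>. \<Sum>e2\<in>img \<phi> - {e1}. of_bool (cls e1 = cls e2 \<and> card (cls e1) = 1))"
    by (intro sum.cong refl card_filter_sum) (use finI in auto)
  also have "\<dots> = (\<Sum>e1\<in>E. \<Sum>e2\<in>E - {e1}. of_bool (cls (?g e1) = cls (?g e2) \<and> card (cls (?g e1)) = 1))"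
    by (rule sum_img[OF phi])
  also have "\<dots> \<le> (\<Sum>e1\<in>E. \<Sum>e2\<in>E - {e1}. of_bool (placed 1 \<phi> (ends e1 \<union> ends e2)))"
  proof (intro sum_mono)
    fix e1 e2 assume e: "e1 \<in> E" "e2 \<in> E - {e1}"
    have mono: "of_bool P \<le> (of_bool Q :: real)" if "P \<Longrightarrow> Q" for P Q
      using that by (cases P; cases Q) auto
    show "of_bool (cls (?g e1) = cls (?g e2) \<and> card (cls (?g e1)) = 1) \<le>
        (of_bool (placed 1 \<phi> (ends e1 \<union> ends e2)) :: real)"
    proof (rule mono)
      assume h: "cls (?g e1) = cls (?g e2) \<and> card (cls (?g e1)) = 1"
      have sub: "{e1, e2} \<subseteq> E" using e by blast
      have same: "cls (?g e') = cls (?g e1)" if "e' \<in> {e1, e2}" for e'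
      proof -
        have "e' = e1 \<or> e' = e2" using that by blast
        then show ?thesis using h by (elim disjE) (simp_all only:)
      qed
      have "placed (card (cls (?g e1))) \<phi> (\<Union>e'\<in>{e1, e2}. ends e')"
        by (rule img_same_class[OF phi sub insertI1 same])
      moreover have "(\<Union>e'\<in>{e1, e2}. ends e') = ends e1 \<union> ends e2" by blast
      ultimately show "placed 1 \<phi> (ends e1 \<union> ends e2)" using h by metis
    qed
  qed
  finally show ?thesis .
qed

lemma bad_triples_le:
  assumes phi: "\<phi> \<in> \<Omega>"
  shows "real (card (bad_triples (img \<phi>))) \<le>
    (\<Sum>e1\<in>E. \<Sum>e2\<in>E - {e1}. \<Sum>e3\<in>{e \<in> E. \<not> ends e \<subseteq> ends e1 \<union> ends e2}.
       of_bool (placed 2 \<phi> (ends e1 \<union> ends e2 \<union> ends e3)))"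
proof -
  let ?g = "map_prod \<phi> \<phi>"
  let ?T = "\<lambda>e1 e2. {e3 \<in> img \<phi>. \<not> ends e3 \<subseteq> ends e1 \<union> ends e2 \<and> cls e1 = cls e2 \<and> cls e1 = cls e3 \<and> card (cls e1) = 2}"
  have finI: "finite (img \<phi>)" using finite_E by (simp add: img_def)
  have "bad_triples (img \<phi>) = (SIGMA e1:img \<phi>. SIGMA e2:img \<phi> - {e1}. ?T e1 e2)"
    by (auto simp: bad_triples_def)
  then have "real (card (bad_triples (img \<phi>))) = (\<Sum>e1\<in>img \<phi>. \<Sum>e2\<in>img \<phi> - {e1}. real (card (?T e1 e2)))"
    using finI by (simp add: card_SigmaI)
  also have "\<dots> = (\<Sum>e1\<in>E. \<Sum>e2\<in>E - {e1}. real (card (?T (?g e1) (?g e2))))"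
    by (rule sum_img[OF phi])
  also have "\<dots> \<le> (\<Sum>e1\<in>E. \<Sum>e2\<in>E - {e1}. \<Sum>e3\<in>{e \<in> E. \<not> ends e \<subseteq> ends e1 \<union> ends e2}.
       of_bool (placed 2 \<phi> (ends e1 \<union> ends e2 \<union> ends e3)))"
  proof (intro sum_mono)
    fix e1 e2 assume e: "e1 \<in> E" "e2 \<in> E - {e1}"
    let ?S = "{e3 \<in> {e \<in> E. \<not> ends e \<subseteq> ends e1 \<union> ends e2}. placed 2 \<phi> (ends e1 \<union> ends e2 \<union> ends e3)}"
    have "?T (?g e1) (?g e2) \<subseteq> ?g ` ?S"
    proof
      fix f assume f: "f \<in> ?T (?g e1) (?g e2)"
      then have "f \<in> ?g ` E" unfolding img_def by blast
      then obtain e3 where e3': "f = ?g e3" "e3 \<in> E" by (rule imageE)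
      note e3 = e3'(2,1)
      have "\<not> ends e3 \<subseteq> ends e1 \<union> ends e2"
      proof -
        have "\<not> ends (?g e3) \<subseteq> ends (?g e1) \<union> ends (?g e2)" using f unfolding e3(2) by blast
        then show ?thesis unfolding img_arc_ends by blast
      qed
      moreover have "placed 2 \<phi> (ends e1 \<union> ends e2 \<union> ends e3)"
      proof -
        have h: "cls (?g e1) = cls (?g e2)" "cls (?g e1) = cls (?g e3)" "card (cls (?g e1)) = 2"
          using f unfolding e3(2) by blast+
        have sub: "{e1, e2, e3} \<subseteq> E" using e e3 by blast
        have same: "cls (?g e') = cls (?g e1)" if "e' \<in> {e1, e2, e3}" for e'
        proof -
          have "e' = e1 \<or> e' = e2 \<or> e' = e3" using that by blast
          then show ?thesis using h by (elim disjE) (simp_all only:)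
        qed
        have "placed (card (cls (?g e1))) \<phi> (\<Union>e'\<in>{e1, e2, e3}. ends e')"
          by (rule img_same_class[OF phi sub insertI1 same])
        moreover have "(\<Union>e'\<in>{e1, e2, e3}. ends e') = ends e1 \<union> ends e2 \<union> ends e3" by blast
        ultimately show ?thesis using h by metis
      qed
      ultimately show "f \<in> ?g ` ?S" using e3 by blast
    qed
    then have "card (?T (?g e1) (?g e2)) \<le> card ?S" using finite_E by (intro surj_card_le) auto
    then have "real (card (?T (?g e1) (?g e2))) \<le> real (card ?S)" by simp
    also have "\<dots> = (\<Sum>e3\<in>{e \<in> E. \<not> ends e \<subseteq> ends e1 \<union> ends e2}.
       of_bool (placed 2 \<phi> (ends e1 \<union> ends e2 \<union> ends e3)))"
      by (rule card_filter_sum) (use finite_E in auto)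
    finally show "real (card (?T (?g e1) (?g e2))) \<le> (\<Sum>e3\<in>{e \<in> E. \<not> ends e \<subseteq> ends e1 \<union> ends e2}.
       of_bool (placed 2 \<phi> (ends e1 \<union> ends e2 \<union> ends e3)))" .
  qed
  finally show ?thesis .
qed

lemma ends_subset: "e \<in> E \<Longrightarrow> ends e \<subseteq> X"
  using E_sub by (auto simp: ends_def)

lemma card_ends_le: "card (ends e) \<le> 2"
  by (auto simp: ends_def card_insert_if)

lemma sum_bad_pairs:
  "(\<Sum>\<phi>\<in>\<Omega>. real (card (bad_pairs (img \<phi>)))) \<le> fact n * (5 * (real k)\<^sup>2 * real (8 * m) ^ 6 / real n)"
proof -
  have n: "real n > 0" using n_large by simp
  have "(\<Sum>\<phi>\<in>\<Omega>. real (card (bad_pairs (img \<phi>)))) \<le>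
      (\<Sum>\<phi>\<in>\<Omega>. \<Sum>e1\<in>E. \<Sum>e2\<in>E - {e1}. of_bool (placed 1 \<phi> (ends e1 \<union> ends e2)))"
    by (intro sum_mono bad_pairs_le)
  also have "\<dots> = (\<Sum>e1\<in>E. \<Sum>e2\<in>E - {e1}. \<Sum>\<phi>\<in>\<Omega>. of_bool (placed 1 \<phi> (ends e1 \<union> ends e2)))"
    by (subst sum.swap) (intro sum.cong refl sum.swap)
  also have "\<dots> \<le> (\<Sum>e1\<in>E. \<Sum>e2\<in>E - {e1}. fact n * real n * real (8 * m) ^ 6 * (1 / real n) ^ card (ends e1 \<union> ends e2))"
  proof (intro sum_mono)
    fix e1 e2 assume e: "e1 \<in> E" "e2 \<in> E - {e1}"
    have "(\<Sum>\<phi>\<in>\<Omega>. of_bool (placed 1 \<phi> (ends e1 \<union> ends e2))) \<le>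
        fact n * real (card (supports 1)) * real (8 * m) ^ 6 * (1 / real n) ^ card (ends e1 \<union> ends e2)"
      by (rule sum_placed_le) (use e ends_subset card_pair_ends(2)[of e1 e2] in auto)
    also have "\<dots> \<le> fact n * real n * real (8 * m) ^ 6 * (1 / real n) ^ card (ends e1 \<union> ends e2)"
      using card_supports_le(1) by (intro mult_right_mono mult_left_mono) auto
    finally show "(\<Sum>\<phi>\<in>\<Omega>. of_bool (placed 1 \<phi> (ends e1 \<union> ends e2))) \<le>
        fact n * real n * real (8 * m) ^ 6 * (1 / real n) ^ card (ends e1 \<union> ends e2)" .
  qed
  also have "\<dots> = fact n * real n * real (8 * m) ^ 6 * pair_weight"
    by (simp only: pair_weight_def sum_distrib_left)
  also have "\<dots> \<le> fact n * real n * real (8 * m) ^ 6 * (5 * (real k)\<^sup>2 / (real n)\<^sup>2)"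
    by (rule mult_left_mono[OF weight_pairs]) simp
  also have "\<dots> = fact n * (5 * (real k)\<^sup>2 * real (8 * m) ^ 6 / real n)"
    using n by (simp add: power2_eq_square)
  finally show ?thesis .
qed

text \<open>Up to \<open>n^2\<close> bipartite supports only cancel the pair weight of order
  \<open>1 / n^2\<close>; the new vertex of the third arc supplies the decisive \<open>1/n\<close>.
  The 25 is the product of the two constants 5. For bad pairs, \<open>n\<close> supports against the
  pair weight are enough.\<close>

lemma sum_bad_triples:
  "(\<Sum>\<phi>\<in>\<Omega>. real (card (bad_triples (img \<phi>)))) \<le> fact n * (25 * real k ^ 3 * real (8 * m) ^ 6 / real n)"
proof -
  have n: "real n > 0" using n_large by simp
  let ?S = "\<lambda>e1 e2. {e \<in> E. \<not> ends e \<subseteq> ends e1 \<union> ends e2}"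
  let ?P = "\<lambda>\<phi> e1 e2 e3. placed 2 \<phi> (ends e1 \<union> ends e2 \<union> ends e3)"
  let ?c = "fact n * (real n)\<^sup>2 * real (8 * m) ^ 6"
  have "(\<Sum>\<phi>\<in>\<Omega>. real (card (bad_triples (img \<phi>)))) \<le>
      (\<Sum>\<phi>\<in>\<Omega>. \<Sum>e1\<in>E. \<Sum>e2\<in>E - {e1}. \<Sum>e3\<in>?S e1 e2. of_bool (?P \<phi> e1 e2 e3))"
    by (intro sum_mono bad_triples_le)
  also have "\<dots> = (\<Sum>e1\<in>E. \<Sum>e2\<in>E - {e1}. \<Sum>e3\<in>?S e1 e2. \<Sum>\<phi>\<in>\<Omega>. of_bool (?P \<phi> e1 e2 e3))"
    by (simp only: sum.swap[where A = "\<Omega>"])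
  also have "\<dots> \<le> (\<Sum>e1\<in>E. \<Sum>e2\<in>E - {e1}. \<Sum>e3\<in>?S e1 e2. ?c * (1 / real n) ^ card (ends e1 \<union> ends e2 \<union> ends e3))"
  proof (intro sum_mono)
    fix e1 e2 e3 assume e: "e1 \<in> E" "e2 \<in> E - {e1}" "e3 \<in> ?S e1 e2"
    have "(\<Sum>\<phi>\<in>\<Omega>. of_bool (?P \<phi> e1 e2 e3)) \<le> fact n * real (card (supports 2)) *
        real (8 * m) ^ 6 * (1 / real n) ^ card (ends e1 \<union> ends e2 \<union> ends e3)"
    proof (rule sum_placed_le)
      show "ends e1 \<union> ends e2 \<union> ends e3 \<subseteq> X" using e ends_subset by auto
      show "card (ends e1 \<union> ends e2 \<union> ends e3) \<le> 6"
        using card_Un_le[of "ends e1 \<union> ends e2" "ends e3"] card_Un_le[of "ends e1" "ends e2"]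
          card_ends_le[of e1] card_ends_le[of e2] card_ends_le[of e3] by linarith
    qed
    also have "\<dots> \<le> ?c * (1 / real n) ^ card (ends e1 \<union> ends e2 \<union> ends e3)"
    proof (intro mult_right_mono mult_left_mono)
      show "real (card (supports 2)) \<le> (real n)\<^sup>2"
        using card_supports_le(2) by (metis of_nat_mono of_nat_power)
    qed auto
    finally show "(\<Sum>\<phi>\<in>\<Omega>. of_bool (?P \<phi> e1 e2 e3)) \<le>
        ?c * (1 / real n) ^ card (ends e1 \<union> ends e2 \<union> ends e3)" .
  qed
  also have "\<dots> \<le> (\<Sum>e1\<in>E. \<Sum>e2\<in>E - {e1}. ?c * ((1 / real n) ^ card (ends e1 \<union> ends e2) * (5 * real k / real n)))"
  proof (intro sum_mono)
    fix e1 e2 assume e: "e1 \<in> E" "e2 \<in> E - {e1}"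
    have "(\<Sum>e3\<in>?S e1 e2. (1 / real n) ^ card (ends e1 \<union> ends e2 \<union> ends e3)) \<le>
        (1 / real n) ^ card (ends e1 \<union> ends e2) * (5 * real k / real n)"
      by (rule weight_third) (use card_pair_ends(2)[of e1 e2] e in \<open>auto simp: ends_def\<close>)
    then have "?c * (\<Sum>e3\<in>?S e1 e2. (1 / real n) ^ card (ends e1 \<union> ends e2 \<union> ends e3)) \<le>
        ?c * ((1 / real n) ^ card (ends e1 \<union> ends e2) * (5 * real k / real n))"
      by (rule mult_left_mono) simp
    then show "(\<Sum>e3\<in>?S e1 e2. ?c * (1 / real n) ^ card (ends e1 \<union> ends e2 \<union> ends e3)) \<le>
        ?c * ((1 / real n) ^ card (ends e1 \<union> ends e2) * (5 * real k / real n))"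
      by (simp only: sum_distrib_left)
  qed
  also have "\<dots> = ?c * (5 * real k / real n) * pair_weight"
    by (simp only: pair_weight_def sum_distrib_left mult_ac)
  also have "\<dots> \<le> ?c * (5 * real k / real n) * (5 * (real k)\<^sup>2 / (real n)\<^sup>2)"
    by (rule mult_left_mono[OF weight_pairs]) simp
  also have "\<dots> = fact n * (25 * real k ^ 3 * real (8 * m) ^ 6 / real n)"
    using n by (simp add: power2_eq_square power3_eq_cube)
  finally show ?thesis .
qed

section \<open>The averaged containment and the choice of a tournament\<close>

lemma sum_containment_ge:
  assumes net: "\<epsilon> * real n \<le> (\<Sum>e\<in>E. \<Sum>e'\<in>E - {e}. pair_sign e e') / 2" "0 \<le> \<epsilon>"
  shows "(\<Sum>\<phi>\<in>\<Omega>. tour_containment (img \<phi>)) \<ge>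
    fact n * (1 + \<epsilon> / 2 - 160 * (real k)\<^sup>2 / (real m - 1)
      - 60 * real ((4 * m + 1) ^ 4) * real k ^ 3 * real (8 * m) ^ 6 / real n)"
proof -
  have n: "real n > 0" using n_large by simp
  let ?K = "2 * real ((4 * m + 1) ^ 4)"
  let ?r = "\<lambda>\<phi> e e'. rho (map_prod \<phi> \<phi> e) (map_prod \<phi> \<phi> e')"
  let ?net = "\<Sum>e\<in>E. \<Sum>e'\<in>E - {e}. pair_sign e e'"
  let ?bad = "(\<Sum>\<phi>\<in>\<Omega>. real (card (bad_pairs (img \<phi>)))) + (\<Sum>\<phi>\<in>\<Omega>. real (card (bad_triples (img \<phi>))))"
  let ?low = "\<lambda>\<phi>. 1 + (\<Sum>e\<in>E. \<Sum>e'\<in>E - {e}. ?r \<phi> e e' - 2 * (?r \<phi> e e')\<^sup>2) / 2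
      - ?K * (real (card (bad_pairs (img \<phi>))) + real (card (bad_triples (img \<phi>))))"
  have card_B: "real (card \<Omega>) = fact n"
    using card_bijections[OF finite_X finite_V card_X] by simp
  have "(\<Sum>\<phi>\<in>\<Omega>. ?low \<phi>) \<le> (\<Sum>\<phi>\<in>\<Omega>. tour_containment (img \<phi>))"
  proof (rule sum_mono)
    fix \<phi> assume phi: "\<phi> \<in> \<Omega>"
    show "?low \<phi> \<le> tour_containment (img \<phi>)"
      using containment_product_ge[OF img_clique[OF phi] img_bounded[OF phi]]
      unfolding sum_img[OF phi] .
  qed
  moreover have "(\<Sum>\<phi>\<in>\<Omega>. ?low \<phi>) =
    fact n + (\<Sum>\<phi>\<in>\<Omega>. \<Sum>e\<in>E. \<Sum>e'\<in>E - {e}. ?r \<phi> e e' - 2 * (?r \<phi> e e')\<^sup>2) / 2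
      - ?K * (?bad)"
    unfolding sum_subtractf[of "\<lambda>\<phi>. 1 + (\<Sum>e\<in>E. \<Sum>e'\<in>E - {e}. ?r \<phi> e e' - 2 * (?r \<phi> e e')\<^sup>2) / 2"]
    by (simp only: sum.distrib sum_distrib_left[symmetric] sum_divide_distrib[symmetric] sum_constant card_B mult_1_right)
  moreover have "(\<Sum>\<phi>\<in>\<Omega>. \<Sum>e\<in>E. \<Sum>e'\<in>E - {e}. ?r \<phi> e e' - 2 * (?r \<phi> e e')\<^sup>2) =
      path_total * ?net - 2 * (\<Sum>e\<in>E. \<Sum>e'\<in>E - {e}. \<Sum>\<phi>\<in>\<Omega>. (?r \<phi> e e')\<^sup>2)"
  proof -
    have "(\<Sum>\<phi>\<in>\<Omega>. \<Sum>e\<in>E. \<Sum>e'\<in>E - {e}. ?r \<phi> e e' - 2 * (?r \<phi> e e')\<^sup>2) =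
        (\<Sum>e\<in>E. \<Sum>e'\<in>E - {e}. \<Sum>\<phi>\<in>\<Omega>. ?r \<phi> e e' - 2 * (?r \<phi> e e')\<^sup>2)"
      by (simp only: sum.swap[where A = "\<Omega>"])
    also have "\<dots> = (\<Sum>e\<in>E. \<Sum>e'\<in>E - {e}. path_total * pair_sign e e' - 2 * (\<Sum>\<phi>\<in>\<Omega>. (?r \<phi> e e')\<^sup>2))"
    proof (rule sum.cong[OF refl], rule sum.cong[OF refl])
      fix e e' assume "e \<in> E" "e' \<in> E - {e}"
      then have "(\<Sum>\<phi>\<in>\<Omega>. ?r \<phi> e e') = path_total * pair_sign e e'" by (intro sum_rho) auto
      then show "(\<Sum>\<phi>\<in>\<Omega>. ?r \<phi> e e' - 2 * (?r \<phi> e e')\<^sup>2) =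
          path_total * pair_sign e e' - 2 * (\<Sum>\<phi>\<in>\<Omega>. (?r \<phi> e e')\<^sup>2)"
        by (simp only: sum_subtractf sum_distrib_left)
    qed
    finally show ?thesis by (simp only: sum_subtractf sum_distrib_left)
  qed
  ultimately have main: "fact n + (path_total * ?net - 2 * (\<Sum>e\<in>E. \<Sum>e'\<in>E - {e}. \<Sum>\<phi>\<in>\<Omega>. (?r \<phi> e e')\<^sup>2)) / 2
      - ?K * (?bad)
    \<le> (\<Sum>\<phi>\<in>\<Omega>. tour_containment (img \<phi>))"
    by simp
  \<comment> \<open>The ordered net sum is at least \<open>2 * \<epsilon> * n\<close>, and each unit
    is worth at least \<open>1 / (2 * n)\<close> on average. The factor 1/2 for ordered pairs then
    leaves the gain \<open>\<epsilon> / 2\<close>.\<close>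
  have "fact n / (2 * real n) * (2 * \<epsilon> * real n) \<le> path_total * ?net"
    using path_total_ge net n by (intro mult_mono) (auto intro: order_trans[OF _ path_total_ge])
  then have p: "fact n * \<epsilon> \<le> path_total * ?net" using n by simp
  \<comment> \<open>Bad pairs carry \<open>k^2\<close> and bad triples \<open>k^3\<close>; raising
    the former merges the constants to \<open>5 + 25 = 30\<close>, which the factor 2 in
    \<open>?K\<close> doubles to 60.\<close>
  have k1: "(real k)\<^sup>2 \<le> real k ^ 3" using k_pos by (intro power_increasing) auto
  have "5 * (real k)\<^sup>2 * real (8 * m) ^ 6 / real n \<le> 5 * real k ^ 3 * real (8 * m) ^ 6 / real n"
    using k1 n by (intro divide_right_mono mult_right_mono) auto
  then have "fact n * (5 * (real k)\<^sup>2 * real (8 * m) ^ 6 / real n) \<le> fact n * (5 * real k ^ 3 * real (8 * m) ^ 6 / real n)"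
    by (rule mult_left_mono) simp
  then have "?bad \<le>
      fact n * (5 * real k ^ 3 * real (8 * m) ^ 6 / real n) + fact n * (25 * real k ^ 3 * real (8 * m) ^ 6 / real n)"
    using sum_bad_pairs sum_bad_triples by linarith
  also have "\<dots> = fact n * (30 * (real k ^ 3 * real (8 * m) ^ 6 / real n))" by (simp add: algebra_simps)
  finally have "?K * (?bad) \<le>
      ?K * (fact n * (30 * (real k ^ 3 * real (8 * m) ^ 6 / real n)))"
    by (rule mult_left_mono) simp
  also have "\<dots> = fact n * (60 * real ((4 * m + 1) ^ 4) * real k ^ 3 * real (8 * m) ^ 6 / real n)"
    by (simp add: mult_ac)
  finally have bad: "?K * (?bad) \<le>
      fact n * (60 * real ((4 * m + 1) ^ 4) * real k ^ 3 * real (8 * m) ^ 6 / real n)" .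
  have combine: "f * (1 + \<epsilon> / 2 - a - d) \<le> Z"
    if "f + (P - 2 * Q) / 2 - K \<le> Z" "f * \<epsilon> \<le> P" "K \<le> f * d" "Q \<le> f * a" for f P Q K Z a d :: real
  proof -
    have lin: "R \<le> Z" if "R = f + x / 2 - y - z" "f + (P - 2 * Q) / 2 - K \<le> Z" "x \<le> P" "K \<le> z" "Q \<le> y"
      for R x y z using that by (simp add: field_simps)
    show ?thesis by (rule lin[OF _ that]) (simp add: algebra_simps)
  qed
  show ?thesis by (rule combine[OF main p bad sum_rho_sq_total])
qed

text \<open>Double counting of placements against tournaments: if every member of
  \<open>tours\<close> had fewer copies, the averaged containment would be too small.\<close>

lemma exists_tour:
  assumes net: "\<epsilon> * real n \<le> (\<Sum>e\<in>E. \<Sum>e'\<in>E - {e}. pair_sign e e') / 2" "0 \<le> \<epsilon>"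
  shows "\<exists>A\<in>tours. real (card {\<phi> \<in> \<Omega>. img \<phi> \<subseteq> A}) \<ge>
    fact n * (1 + \<epsilon> / 2 - 160 * (real k)\<^sup>2 / (real m - 1)
      - 60 * real ((4 * m + 1) ^ 4) * real k ^ 3 * real (8 * m) ^ 6 / real n) / 2 ^ card E" (is "\<exists>A\<in>tours. ?t / _ \<le> _")
proof (rule ccontr)
  assume "\<not> ?thesis"
  then have less: "real (card {\<phi> \<in> \<Omega>. img \<phi> \<subseteq> A}) < ?t / 2 ^ card E" if "A \<in> tours" for A
    using that by (auto simp: not_le)
  have finB: "finite \<Omega>" using finite_bijections[OF finite_X finite_V] .
  have fint: "finite tours" "tours \<noteq> {}" using card_tours_pos by (auto simp: card_gt_0_iff)
  have "(\<Sum>A\<in>tours. real (card {\<phi> \<in> \<Omega>. img \<phi> \<subseteq> A})) = (\<Sum>\<phi>\<in>\<Omega>. real (card {A \<in> tours. img \<phi> \<subseteq> A}))"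
    unfolding card_filter_sum[OF finB] card_filter_sum[OF fint(1)] by (rule sum.swap)
  then have "2 ^ card E * (\<Sum>A\<in>tours. real (card {\<phi> \<in> \<Omega>. img \<phi> \<subseteq> A})) =
      (\<Sum>\<phi>\<in>\<Omega>. 2 ^ card E * real (card {A \<in> tours. img \<phi> \<subseteq> A}))"
    by (simp add: sum_distrib_left)
  also have "\<dots> = (\<Sum>\<phi>\<in>\<Omega>. card tours * tour_containment (img \<phi>))"
  proof (rule sum.cong[OF refl])
    fix \<phi> assume phi: "\<phi> \<in> \<Omega>"
    have "card (img \<phi>) = card E" unfolding img_def using inj_on_img[OF phi] by (rule card_image)
    then show "2 ^ card E * real (card {A \<in> tours. img \<phi> \<subseteq> A}) =
        card tours * tour_containment (img \<phi>)"
      using containment_product[OF img_clique[OF phi]] by simp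
  qed
  also have "\<dots> \<ge> card tours * ?t"
    using sum_containment_ge[OF net] unfolding sum_distrib_left[symmetric] by (intro mult_left_mono) auto
  finally have ge: "card tours * ?t \<le> 2 ^ card E * (\<Sum>A\<in>tours. real (card {\<phi> \<in> \<Omega>. img \<phi> \<subseteq> A}))" .
  have "(\<Sum>A\<in>tours. real (card {\<phi> \<in> \<Omega>. img \<phi> \<subseteq> A})) < (\<Sum>A\<in>tours. ?t / 2 ^ card E)"
    using less fint by (intro sum_strict_mono) auto
  then have "2 ^ card E * (\<Sum>A\<in>tours. real (card {\<phi> \<in> \<Omega>. img \<phi> \<subseteq> A})) < 2 ^ card E * (card tours * (?t / 2 ^ card E))"
    by (intro mult_strict_left_mono) auto
  then show False using ge by simp
qed

end

section \<open>Counting adjacent pairs of arcs\<close>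

lemma card_eq_fibre:
  assumes "finite S" "\<And>x. x \<in> S \<Longrightarrow> card {y \<in> S. f y = f x} = c"
  shows "card S = c * card (f ` S)"
proof -
  have "card S = (\<Sum>y\<in>f ` S. card {x \<in> S. f x = y})"
    using sum.image_gen[OF assms(1), of "\<lambda>_. 1 :: nat" f] by simp
  also have "\<dots> = (\<Sum>y\<in>f ` S. c)" using assms(2) by (intro sum.cong) auto
  finally show ?thesis by simp
qed

text \<open>The injective \<open>g\<close> stands for an arc written from its common vertex, in
  either direction, so that out-pairs and in-pairs are treated at once. The fibres have size 2
  because the outer ends can be exchanged.\<close>

lemma card_unordered_pairs:
  assumes "finite S" "\<And>v u w. (v, u, w) \<in> S \<Longrightarrow> u \<noteq> w \<and> (v, w, u) \<in> S"
    and g: "\<And>v u v' u'. g v u = g v' u' \<longleftrightarrow> v = v' \<and> u = u'"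
  shows "card S = 2 * card ((\<lambda>(v, u, w). {g v u, g v w}) ` S)"
proof (rule card_eq_fibre[OF assms(1)])
  let ?f = "\<lambda>(v, u, w). {g v u, g v w}"
  fix x assume x: "x \<in> S"
  obtain v u w where vuw: "x = (v, u, w)" by (cases x)
  have xw: "u \<noteq> w" "(v, w, u) \<in> S" using assms(2) x vuw by auto
  have "{y \<in> S. ?f y = ?f x} = {(v, u, w), (v, w, u)}"
    using x xw(2) unfolding vuw by (auto simp: doubleton_eq_iff g)
  then show "card {y \<in> S. ?f y = ?f x} = 2" using xw(1) by simp
qed

context
  fixes H :: "'a pair_pre_digraph" and E
  assumes orient: "orientation H" and E_eq: "E = parcs H"
begin

lemma finite_parcs: "finite E"
  using orient unfolding E_eq orientation_iff pair_digraph_def pair_fin_digraph_def pair_fin_digraph_axioms_def by auto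

lemma parcs_asym: "(x, y) \<in> E \<Longrightarrow> (y, x) \<notin> E"
  using orient unfolding E_eq orientation_iff by auto

lemma parcs_irrefl: "(x, y) \<in> E \<Longrightarrow> x \<noteq> y"
  using parcs_asym by auto

lemma finite_triples: "finite {(u, v, w). (u, v) \<in> E \<and> (v, w) \<in> E \<and> P u v w}"
proof -
  have "{(u, v, w). (u, v) \<in> E \<and> (v, w) \<in> E \<and> P u v w} \<subseteq> fst ` E \<times> fst ` E \<times> snd ` E" by force
  then show ?thesis by (rule finite_subset) (use finite_parcs in auto)
qed

lemma finite_out_triples: "finite {(v, u, w). u \<noteq> w \<and> (v, u) \<in> E \<and> (v, w) \<in> E \<and> P u v w}"
proof -
  have "{(v, u, w). u \<noteq> w \<and> (v, u) \<in> E \<and> (v, w) \<in> E \<and> P u v w} \<subseteq> fst ` E \<times> snd ` E \<times> snd ` E" by force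
  then show ?thesis by (rule finite_subset) (use finite_parcs in auto)
qed

lemma finite_in_triples: "finite {(v, u, w). u \<noteq> w \<and> (u, v) \<in> E \<and> (w, v) \<in> E \<and> P u v w}"
proof -
  have "{(v, u, w). u \<noteq> w \<and> (u, v) \<in> E \<and> (w, v) \<in> E \<and> P u v w} \<subseteq> snd ` E \<times> fst ` E \<times> fst ` E" by force
  then show ?thesis by (rule finite_subset) (use finite_parcs in auto)
qed

lemma num_c_triples: "num_c H = card {(u, v, w). (u, v) \<in> E \<and> (v, w) \<in> E \<and> \<not> adjacent H u w}"
proof -
  let ?S = "{(u, v, w). (u, v) \<in> E \<and> (v, w) \<in> E \<and> \<not> adjacent H u w}"
  let ?f = "\<lambda>(u, v, w). {(u, v), (v, w)}"
  have "induced_consistent_pairs H = ?f ` ?S"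
    unfolding induced_consistent_pairs_def E_eq by force
  moreover have "inj_on ?f ?S"
    using parcs_asym by (auto simp: inj_on_def doubleton_eq_iff)
  ultimately show ?thesis by (simp add: num_c_def card_image)
qed

text \<open>A directed triangle arises from its three rotations, whereas consistent pairs and
  transitive triangles determine the order of their vertices.\<close>

lemma num_f_triples: "3 * num_f H = card {(u, v, w). (u, v) \<in> E \<and> (v, w) \<in> E \<and> (w, u) \<in> E}"
proof -
  let ?S = "{(u, v, w). (u, v) \<in> E \<and> (v, w) \<in> E \<and> (w, u) \<in> E}"
  let ?f = "\<lambda>(u, v, w). {(u, v), (v, w), (w, u)}"
  have "directed_triangles H = ?f ` ?S"
    unfolding directed_triangles_def E_eq by force
  moreover have "card ?S = 3 * card (?f ` ?S)"
  proof (rule card_eq_fibre)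
    show "finite ?S" by (rule finite_triples)
    fix x assume x: "x \<in> ?S"
    obtain u v w where uvw: "x = (u, v, w)" by (cases x)
    have ne: "u \<noteq> v" "v \<noteq> w" "w \<noteq> u" using x uvw parcs_irrefl by auto
    have "{y \<in> ?S. ?f y = ?f x} = {(u, v, w), (v, w, u), (w, u, v)}"
    proof (intro set_eqI iffI)
      fix y assume y: "y \<in> {y \<in> ?S. ?f y = ?f x}"
      obtain a c d where acd: "y = (a, c, d)" by (cases y)
      have "?f y = ?f x" using CollectD[OF y] by (rule conjunct2)
      then have "(a, c) \<in> {(u, v), (v, w), (w, u)}" "(c, d) \<in> {(u, v), (v, w), (w, u)}"
        unfolding acd uvw by auto
      then show "y \<in> {(u, v, w), (v, w, u), (w, u, v)}" using ne acd by auto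
    next
      fix y assume "y \<in> {(u, v, w), (v, w, u), (w, u, v)}"
      then show "y \<in> {y \<in> ?S. ?f y = ?f x}" using x uvw by (auto simp: insert_commute)
    qed
    then show "card {y \<in> ?S. ?f y = ?f x} = 3" using ne by simp
  qed
  ultimately show ?thesis by (simp add: num_f_def)
qed

lemma num_g_triples: "num_g H = card {(u, v, w). (u, v) \<in> E \<and> (v, w) \<in> E \<and> (u, w) \<in> E}"
proof -
  let ?S = "{(u, v, w). (u, v) \<in> E \<and> (v, w) \<in> E \<and> (u, w) \<in> E}"
  let ?f = "\<lambda>(u, v, w). {(u, v), (v, w), (u, w)}"
  have "transitive_triangles H = ?f ` ?S"
    unfolding transitive_triangles_def E_eq by force
  moreover have "inj_on ?f ?S"
  proof (rule inj_onI)
    fix x y assume xy: "x \<in> ?S" "y \<in> ?S" "?f x = ?f y"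
    obtain u v w where uvw: "x = (u, v, w)" by (cases x)
    obtain a c d where acd: "y = (a, c, d)" by (cases y)
    have ne: "u \<noteq> v" "v \<noteq> w" "w \<noteq> u" using xy(1) uvw parcs_irrefl parcs_asym by auto
    have "(a, c) \<in> {(u, v), (v, w), (u, w)}" "(c, d) \<in> {(u, v), (v, w), (u, w)}"
      using xy(3) unfolding acd uvw by auto
    then show "x = y" using ne acd uvw by auto
  qed
  ultimately show ?thesis by (simp add: num_g_def card_image)
qed

lemma num_i_triples: "2 * num_i H =
  card {(v, u, w). u \<noteq> w \<and> (v, u) \<in> E \<and> (v, w) \<in> E \<and> \<not> adjacent H u w} +
  card {(v, u, w). u \<noteq> w \<and> (u, v) \<in> E \<and> (w, v) \<in> E \<and> \<not> adjacent H u w}"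
proof -
  let ?S = "{(v, u, w). u \<noteq> w \<and> (v, u) \<in> E \<and> (v, w) \<in> E \<and> \<not> adjacent H u w}"
  let ?T = "{(v, u, w). u \<noteq> w \<and> (u, v) \<in> E \<and> (w, v) \<in> E \<and> \<not> adjacent H u w}"
  let ?f = "\<lambda>(v, u, w). {(v, u), (v, w)}" and ?g = "\<lambda>(v, u, w). {(u, v), (w, v)}"
  have comm: "adjacent H a c \<longleftrightarrow> adjacent H c a" for a c by (auto simp: parcs_underlying)
  have fin: "finite ?S" "finite ?T" by (rule finite_out_triples, rule finite_in_triples)
  have I: "induced_inconsistent_pairs H = ?f ` ?S \<union> ?g ` ?T"
    unfolding induced_inconsistent_pairs_def E_eq[symmetric]
  proof (rule arg_cong2[where f = "(\<union>)"])
    show "{{(v, u), (v, w)} | u v w. u \<noteq> w \<and> (v, u) \<in> E \<and> (v, w) \<in> E \<and> \<not> adjacent H u w} = ?f ` ?S"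
      by force
    show "{{(u, v), (w, v)} | u v w. u \<noteq> w \<and> (u, v) \<in> E \<and> (w, v) \<in> E \<and> \<not> adjacent H u w} = ?g ` ?T"
      by force
  qed
  have "card ?S = 2 * card (?f ` ?S)"
    by (rule card_unordered_pairs[OF fin(1)]) (use comm in auto)
  moreover have "card ?T = 2 * card (?g ` ?T)"
    by (rule card_unordered_pairs[OF fin(2)]) (use comm in auto)
  moreover have "?f ` ?S \<inter> ?g ` ?T = {}"
    by (auto simp: doubleton_eq_iff)
  then have "card (?f ` ?S \<union> ?g ` ?T) = card (?f ` ?S) + card (?g ` ?T)"
    using fin by (intro card_Un_disjoint) auto
  ultimately show ?thesis by (simp add: num_i_def I)
qed

lemma card_split3:
  assumes "finite S" "S = A \<union> B \<union> C" "A \<inter> B = {}" "A \<inter> C = {}" "B \<inter> C = {}"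
  shows "card S = card A + card B + card C"
  using assms by (simp add: card_Un_disjoint Int_Un_distrib2)

text \<open>The ends of a directed path \<open>u\<close>, \<open>v\<close>, \<open>w\<close> are
  nonadjacent, or joined by \<open>(w, u)\<close> to a directed triangle, or by
  \<open>(u, w)\<close> to a transitive one.\<close>

lemma card_consistent: 
  "card {(u, v, w). (u, v) \<in> E \<and> (v, w) \<in> E} = num_c H + 3 * num_f H + num_g H"
  unfolding num_c_triples num_f_triples num_g_triples
  by (rule card_split3)
    (use finite_triples[of "\<lambda>_ _ _. True"] parcs_asym in \<open>auto simp: parcs_underlying E_eq[symmetric]\<close>)

text \<open>Adjacent out-neighbours of \<open>v\<close> complete a transitive triangle with source
  \<open>v\<close>; the 2 counts both orders of the pair. In \<open>card_in_in\<close> the vertex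
  \<open>v\<close> is the sink instead.\<close>

lemma card_out_out:
  "card {(v, u, w). u \<noteq> w \<and> (v, u) \<in> E \<and> (v, w) \<in> E} =
    card {(v, u, w). u \<noteq> w \<and> (v, u) \<in> E \<and> (v, w) \<in> E \<and> \<not> adjacent H u w} + 2 * num_g H"
proof -
  let ?T = "{(u, v, w). (u, v) \<in> E \<and> (v, w) \<in> E \<and> (u, w) \<in> E}"
  let ?r = "\<lambda>(u, v, w). (u, w, v)"
  have "card {(v, u, w). u \<noteq> w \<and> (v, u) \<in> E \<and> (v, w) \<in> E} =
      card {(v, u, w). u \<noteq> w \<and> (v, u) \<in> E \<and> (v, w) \<in> E \<and> \<not> adjacent H u w} + card ?T + card (?r ` ?T)"
  proof (rule card_split3)
    show "finite {(v, u, w). u \<noteq> w \<and> (v, u) \<in> E \<and> (v, w) \<in> E}"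
      using finite_out_triples[of "\<lambda>_ _ _. True"] by simp
  qed (use parcs_asym parcs_irrefl in \<open>force simp: parcs_underlying E_eq[symmetric] image_iff\<close>)+
  moreover have "card (?r ` ?T) = card ?T" by (rule card_image) (auto simp: inj_on_def)
  ultimately show ?thesis by (simp add: num_g_triples)
qed

lemma card_in_in:
  "card {(v, u, w). u \<noteq> w \<and> (u, v) \<in> E \<and> (w, v) \<in> E} =
    card {(v, u, w). u \<noteq> w \<and> (u, v) \<in> E \<and> (w, v) \<in> E \<and> \<not> adjacent H u w} + 2 * num_g H"
proof -
  let ?T = "{(u, v, w). (u, v) \<in> E \<and> (v, w) \<in> E \<and> (u, w) \<in> E}"
  let ?r = "\<lambda>(u, v, w). (w, u, v)" and ?s = "\<lambda>(u, v, w). (w, v, u)"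
  have "card {(v, u, w). u \<noteq> w \<and> (u, v) \<in> E \<and> (w, v) \<in> E} =
      card {(v, u, w). u \<noteq> w \<and> (u, v) \<in> E \<and> (w, v) \<in> E \<and> \<not> adjacent H u w} + card (?r ` ?T) + card (?s ` ?T)"
  proof (rule card_split3)
    show "finite {(v, u, w). u \<noteq> w \<and> (u, v) \<in> E \<and> (w, v) \<in> E}"
      using finite_in_triples[of "\<lambda>_ _ _. True"] by simp
  qed (use parcs_asym parcs_irrefl in \<open>force simp: parcs_underlying E_eq[symmetric] image_iff\<close>)+
  moreover have "card (?r ` ?T) = card ?T" by (rule card_image) (auto simp: inj_on_def)
  moreover have "card (?s ` ?T) = card ?T" by (rule card_image) (auto simp: inj_on_def)
  ultimately show ?thesis by (simp add: num_g_triples)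
qed

lemma sum_of_bool_arcs:
  "(\<Sum>e\<in>E. \<Sum>e'\<in>E - {e}. of_bool (P e e')) = real (card {(e, e'). e \<in> E \<and> e' \<in> E \<and> e' \<noteq> e \<and> P e e'})"
proof -
  have "{(e, e'). e \<in> E \<and> e' \<in> E \<and> e' \<noteq> e \<and> P e e'} = (SIGMA e:E. {e' \<in> E - {e}. P e e'})" by auto
  then have "real (card {(e, e'). e \<in> E \<and> e' \<in> E \<and> e' \<noteq> e \<and> P e e'}) =
      (\<Sum>e\<in>E. real (card {e' \<in> E - {e}. P e e'}))"
    using finite_parcs by (simp add: card_SigmaI)
  also have "\<dots> = (\<Sum>e\<in>E. \<Sum>e'\<in>E - {e}. of_bool (P e e'))"
    using finite_parcs by (intro sum.cong refl card_filter_sum) auto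
  finally show ?thesis by simp
qed

text \<open>A directed triangle has three consistent pairs, net 3; a transitive triangle has one
  consistent and two inconsistent pairs, net -1. The division by 2 undoes the ordering of the
  pairs.\<close>

lemma sum_pair_sign:
  "(\<Sum>e\<in>E. \<Sum>e'\<in>E - {e}. pair_sign e e') / 2 =
    real (num_c H) + 3 * real (num_f H) - real (num_i H) - real (num_g H)"
proof -
  have ps: "pair_sign e e' = of_bool (snd e = fst e') + of_bool (snd e' = fst e)
      - of_bool (fst e = fst e') - of_bool (snd e = snd e')" if "e \<in> E" "e' \<in> E - {e}" for e e'
    using that parcs_asym parcs_irrefl by (cases e; cases e') (auto simp: pair_sign_def)
  have "(\<Sum>e\<in>E. \<Sum>e'\<in>E - {e}. pair_sign e e') =
      (\<Sum>e\<in>E. \<Sum>e'\<in>E - {e}. of_bool (snd e = fst e')) + (\<Sum>e\<in>E. \<Sum>e'\<in>E - {e}. of_bool (snd e' = fst e))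
      - (\<Sum>e\<in>E. \<Sum>e'\<in>E - {e}. of_bool (fst e = fst e')) - (\<Sum>e\<in>E. \<Sum>e'\<in>E - {e}. of_bool (snd e = snd e'))"
    by (simp only: sum.distrib[symmetric] sum_subtractf[symmetric]) (intro sum.cong refl ps)
  moreover have "card {(e, e'). e \<in> E \<and> e' \<in> E \<and> e' \<noteq> e \<and> snd e = fst e'} = card {(u, v, w). (u, v) \<in> E \<and> (v, w) \<in> E}"
    by (rule bij_betw_same_card[of "\<lambda>(e, e'). (fst e, snd e, snd e')"],
        rule bij_betw_byWitness[where f' = "\<lambda>(u, v, w). ((u, v), (v, w))"]) (use parcs_irrefl in auto)
  moreover have "card {(e, e'). e \<in> E \<and> e' \<in> E \<and> e' \<noteq> e \<and> snd e' = fst e} = card {(u, v, w). (u, v) \<in> E \<and> (v, w) \<in> E}"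
    by (rule bij_betw_same_card[of "\<lambda>(e', e). (fst e, snd e, snd e')"],
        rule bij_betw_byWitness[where f' = "\<lambda>(u, v, w). ((v, w), (u, v))"]) (use parcs_irrefl in auto)
  moreover have "card {(e, e'). e \<in> E \<and> e' \<in> E \<and> e' \<noteq> e \<and> fst e = fst e'} =
      card {(v, u, w). u \<noteq> w \<and> (v, u) \<in> E \<and> (v, w) \<in> E}"
    by (rule bij_betw_same_card[of "\<lambda>(e, e'). (fst e, snd e, snd e')"],
        rule bij_betw_byWitness[where f' = "\<lambda>(v, u, w). ((v, u), (v, w))"]) auto
  moreover have "card {(e, e'). e \<in> E \<and> e' \<in> E \<and> e' \<noteq> e \<and> snd e = snd e'} =
      card {(v, u, w). u \<noteq> w \<and> (u, v) \<in> E \<and> (w, v) \<in> E}"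
    by (rule bij_betw_same_card[of "\<lambda>(e, e'). (snd e, fst e, fst e')"],
        rule bij_betw_byWitness[where f' = "\<lambda>(v, u, w). ((u, v), (w, v))"]) auto
  ultimately have "(\<Sum>e\<in>E. \<Sum>e'\<in>E - {e}. pair_sign e e') =
      2 * real (card {(u, v, w). (u, v) \<in> E \<and> (v, w) \<in> E})
      - real (card {(v, u, w). u \<noteq> w \<and> (v, u) \<in> E \<and> (v, w) \<in> E})
      - real (card {(v, u, w). u \<noteq> w \<and> (u, v) \<in> E \<and> (w, v) \<in> E})"
    unfolding sum_of_bool_arcs by simp
  then show ?thesis
    unfolding card_consistent card_out_out card_in_in using num_i_triples by simp
qed

end

section \<open>The lower bound\<close>

text \<open>The blocks are consecutive intervals of length \<open>m\<close>. The \<open>min\<close>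
  merges the remainder, which is shorter than \<open>m\<close>, into the last interval; that
  interval is even because \<open>n - 1\<close> and \<open>m\<close> are.\<close>

lemma block_partition_nat:
  assumes "odd n" "even m" "8 * k < m" "3 \<le> m" "m < n"
  shows "block_partition {..<n} (n - 1) (\<lambda>x. min (x div m) ((n - 1) div m - 1)) m k"
proof -
  define q where "q = (n - 1) div m"
  define b where "b x = min (x div m) (q - 1)" for x
  have "q * m \<le> n - 1" using div_times_less_eq_dividend[of "n - 1" m] by (simp add: q_def)
  have "n - 1 < Suc q * m" using assms(4) dividend_less_div_times[of m "n - 1"] by (simp add: q_def)
  have q1: "1 \<le> q" using assms by (simp add: q_def Suc_le_eq div_greater_zero_iff)
  have V: "{..<n} - {n - 1} = {..<n - 1}" using assms by auto
  have block: "even (card {y \<in> {..<n - 1}. b y = i}) \<and> m \<le> card {y \<in> {..<n - 1}. b y = i} \<and>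
      card {y \<in> {..<n - 1}. b y = i} \<le> 2 * m" if i: "i \<le> q - 1" for i
  proof (cases "i = q - 1")
    case True
    have "b y = i \<longleftrightarrow> (q - 1) * m \<le> y" for y
    proof -
      have "b y = i \<longleftrightarrow> q - 1 \<le> y div m" unfolding b_def True by auto
      also have "\<dots> \<longleftrightarrow> (q - 1) * m \<le> y" using assms(4) by (intro less_eq_div_iff_mult_less_eq) simp
      finally show ?thesis .
    qed
    then have "{y \<in> {..<n - 1}. b y = i} = {(q - 1) * m..<n - 1}"
      by (intro set_eqI) (simp only: mem_Collect_eq lessThan_iff atLeastLessThan_iff, blast)
    then have c: "card {y \<in> {..<n - 1}. b y = i} = n - 1 - (q - 1) * m" by simp
    have "(q - 1) * m + m = q * m" using q1 by (cases q) auto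
    moreover have "n - 1 < q * m + m" using \<open>n - 1 < Suc q * m\<close> by simp
    ultimately have "m \<le> n - 1 - (q - 1) * m" "n - 1 - (q - 1) * m \<le> 2 * m"
      using \<open>q * m \<le> n - 1\<close> by arith+
    moreover have "even (n - 1 - (q - 1) * m)" using assms(1,2) by auto
    ultimately show ?thesis unfolding c by blast
  next
    case False
    then have iq: "i < q - 1" using i by simp
    then have "Suc i * m \<le> (q - 1) * m" by (intro mult_le_mono1) simp
    also have "\<dots> \<le> q * m" by (intro mult_le_mono1) simp
    finally have le: "Suc i * m \<le> n - 1" using \<open>q * m \<le> n - 1\<close> by linarith
    have "b y = i \<longleftrightarrow> i * m \<le> y \<and> y < Suc i * m" for y
    proof -
      have "b y = i \<longleftrightarrow> y div m = i" using iq by (auto simp: b_def min_def)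
      also have "\<dots> \<longleftrightarrow> i \<le> y div m \<and> y div m < Suc i" by auto
      also have "\<dots> \<longleftrightarrow> i * m \<le> y \<and> y < Suc i * m"
        using assms(4) less_eq_div_iff_mult_less_eq[of m i y] div_less_iff_less_mult[of m y "Suc i"] by simp
      finally show ?thesis .
    qed
    moreover have "y < Suc i * m \<longrightarrow> y < n - 1" for y using le by linarith
    ultimately have "{y \<in> {..<n - 1}. b y = i} = {i * m..<Suc i * m}"
      by (intro set_eqI) (simp only: mem_Collect_eq lessThan_iff atLeastLessThan_iff, blast)
    then have "card {y \<in> {..<n - 1}. b y = i} = m" by simp
    then show ?thesis using assms(2) by simp
  qed
  have "block_partition {..<n} (n - 1) b m k"
  proof
    fix x assume "x \<in> {..<n} - {n - 1}"
    have "b x \<le> q - 1" by (simp add: b_def)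
    from block[OF this] show "even (card {y \<in> {..<n} - {n - 1}. b y = b x})"
      "m \<le> card {y \<in> {..<n} - {n - 1}. b y = b x}" "card {y \<in> {..<n} - {n - 1}. b y = b x} \<le> 2 * m"
      unfolding V by auto
  qed (use assms in auto)
  then show ?thesis by (simp add: b_def[abs_def] q_def)
qed

text \<open>Zero excess makes in- and out-degree equal at every vertex, and together they are
  \<open>card V - 1\<close>.\<close>

lemma (in block_partition) regular_tournament_tour:
  assumes A: "A \<in> tours"
  shows "regular_tournament \<lparr>pverts = V, parcs = A\<rparr>"
proof -
  let ?G = "\<lparr>pverts = V, parcs = A\<rparr>"
  have or: "orients A (clique V)" using tours_orients[OF A] .
  then have sub: "A \<subseteq> clique V" by (simp add: orients_def)
  then have AV: "A \<subseteq> V \<times> V" by (auto simp: clique_def)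
  have "pair_digraph ?G"
    by unfold_locales (use sub finite_V finite_subset[OF sub finite_clique] in \<open>auto simp: clique_def\<close>)
  moreover have "\<forall>u v. (u, v) \<in> A \<longrightarrow> (v, u) \<notin> A"
    using or by (auto simp: orients_def)
  ultimately have "orientation ?G" by (simp add: orientation_iff)
  moreover have "(u, v) \<in> A \<or> (v, u) \<in> A" if "u \<in> V" "v \<in> V" "u \<noteq> v" for u v
  proof -
    have "(u, v) \<in> clique V" using that by (simp add: clique_def)
    then show ?thesis using or unfolding orients_def by blast
  qed
  ultimately have tour: "tournament ?G" by (simp add: tournament_def parcs_underlying)
  have "card (A \<inter> {v} \<times> V) = (card V - 1) div 2 \<and> card (A \<inter> V \<times> {v}) = (card V - 1) div 2" if v: "v \<in> V" for v
  proof -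
    have "(\<Sum>y\<in>V. arc_sign A (v, y)) = 0" using tours_balanced[OF A v] .
    then have eq: "card (A \<inter> {v} \<times> V) = card (A \<inter> V \<times> {v})"
      using sum_of_bool_pair[of "{v}" V A] sum_of_bool_pair'[of "{v}" V A] finite_V
      by (simp add: arc_sign_def sum_subtractf)
    have "card (clique V \<inter> {v} \<times> V) = card (A \<inter> {v} \<times> V) + card (A \<inter> V \<times> {v})"
      by (rule card_orients_cut[OF or]) (use finite_V in \<open>auto simp: clique_def\<close>)
    moreover have "clique V \<inter> {v} \<times> V = {v} \<times> (V - {v})" using v by (auto simp: clique_def)
    then have "card (clique V \<inter> {v} \<times> V) = card V - 1"
      using v finite_V by (simp add: card_cartesian_product card_Diff_singleton)
    ultimately show ?thesis using eq by simp
  qed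
  moreover have "out_arcs (with_proj ?G) v = A \<inter> {v} \<times> V" "in_arcs (with_proj ?G) v = A \<inter> V \<times> {v}" for v
    using AV by (auto simp: out_arcs_def in_arcs_def)
  ultimately show ?thesis
    using tour odd_V by (simp add: regular_tournament_def in_degree_def out_degree_def)
qed

text \<open>Turning each arc at \<open>x\<close> so that it starts at \<open>x\<close> embeds these
  arcs in the out-arcs of \<open>x\<close> in the underlying symmetric digraph; asymmetry makes this
  injective.\<close>

lemma degree_bound:
  assumes H: "orientation H" and deg: "max_degree H \<le> k"
  shows "card {e \<in> parcs H. x \<in> ends e} \<le> k"
proof (cases "x \<in> pverts H")
  case True
  have fin: "finite (pverts H)" "finite (parcs H)" and anti: "\<And>u v. (u, v) \<in> parcs H \<Longrightarrow> (v, u) \<notin> parcs H"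
    using H unfolding orientation_iff pair_digraph_def pair_fin_digraph_def pair_fin_digraph_axioms_def by auto
  let ?f = "\<lambda>e. if fst e = x then e else prod.swap e"
  have "{e \<in> parcs (underlying H). fst e = x} \<subseteq> parcs H \<union> prod.swap ` parcs H"
    by (force simp: parcs_underlying)
  then have finU: "finite {e \<in> parcs (underlying H). fst e = x}"
    by (rule finite_subset) (use fin in auto)
  have "card {e \<in> parcs H. x \<in> ends e} \<le> card {e \<in> parcs (underlying H). fst e = x}"
  proof (rule card_inj_on_le[OF _ _ finU])
    show "inj_on ?f {e \<in> parcs H. x \<in> ends e}"
    proof (rule inj_onI)
      fix e e' assume h: "e \<in> {e \<in> parcs H. x \<in> ends e}" "e' \<in> {e \<in> parcs H. x \<in> ends e}" "?f e = ?f e'"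
      show "e = e'"
        using h anti by (cases e; cases e') (auto simp: ends_def split: if_splits)
    qed
    show "?f ` {e \<in> parcs H. x \<in> ends e} \<subseteq> {e \<in> parcs (underlying H). fst e = x}"
      by (auto simp: ends_def parcs_underlying)
  qed
  also have "\<dots> = out_degree (with_proj (underlying H)) x"
    by (simp add: out_degree_def out_arcs_def)
  also have "\<dots> \<le> max_degree H"
    unfolding max_degree_def using fin True by (intro Max_ge) auto
  finally show ?thesis using deg by simp
next
  case False
  then have "{e \<in> parcs H. x \<in> ends e} = {}"
    using H unfolding orientation_iff pair_digraph_def pair_fin_digraph_def pair_wf_digraph_def
    by (auto simp: ends_def)
  then show ?thesis by (simp only: card.empty)
qed

lemma num_copies_le_max_copies:
  fixes G :: "nat pair_pre_digraph"
  assumes "regular_tournament G" "card (pverts G) = card (pverts H)" "finite (pverts H)"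
  shows "num_copies G H \<le> max_copies H"
  unfolding max_copies_def
proof (rule Max_ge)
  let ?S = "{num_copies G H | G :: nat pair_pre_digraph. regular_tournament G \<and> card (pverts G) = card (pverts H)}"
  have "num_copies G H \<le> card (pverts H) ^ card (pverts H)"
    if "regular_tournament G" "card (pverts G) = card (pverts H)" for G :: "nat pair_pre_digraph"
  proof -
    have fin: "finite (pverts G)"
      \<comment> \<open>An infinite vertex set would have cardinality 0, which is even.\<close>
      using that(1) unfolding regular_tournament_def by (metis card.infinite even_zero)
    have "num_copies G H \<le> card (PiE (pverts H) (\<lambda>_. pverts G))"
      unfolding num_copies_def arc_preserving_bijections_def
      by (intro card_mono finite_PiE) (use assms(3) fin in auto)
    then show ?thesis using assms(3) that(2) by (simp add: card_PiE)
  qed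
  then have "?S \<subseteq> {..card (pverts H) ^ card (pverts H)}" by auto
  then show "finite ?S" by (rule finite_subset) simp
  show "num_copies G H \<in> ?S" using assms by auto
qed

lemma (in random_embedding) card_embeddings:
  assumes "pverts H = X" "parcs H = E"
  shows "num_copies \<lparr>pverts = V, parcs = A\<rparr> H = card {\<phi> \<in> bijections X V. img \<phi> \<subseteq> A}"
proof -
  have "arc_preserving_bijections H \<lparr>pverts = V, parcs = A\<rparr> = {\<phi> \<in> bijections X V. img \<phi> \<subseteq> A}"
    using assms by (auto simp: arc_preserving_bijections_def bijections_def img_def)
  then show ?thesis by (simp add: num_copies_def)
qed

text \<open>The bound with \<open>m\<close> still free, so that the choice of constants is separated
  from the probabilistic argument.\<close>

lemma max_copies_ge:
  assumes H: "orientation H" "card (pverts H) = n" "max_degree H \<le> k" and "odd n" "k > 0"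
    and m: "even m" "8 * k < m" "4 * m < n" "\<epsilon> > 0"
    and net: "\<epsilon> * real n \<le> real (num_c H) + 3 * real (num_f H) - real (num_i H) - real (num_g H)"
  shows "fact n * (1 + \<epsilon> / 2 - 160 * (real k)\<^sup>2 / (real m - 1)
      - 60 * real ((4 * m + 1) ^ 4) * real k ^ 3 * real (8 * m) ^ 6 / real n) / 2 ^ num_edges H
    \<le> real (max_copies H)"
proof -
  have pd: "pair_digraph H" and anti: "\<And>u v. (u, v) \<in> parcs H \<Longrightarrow> (v, u) \<notin> parcs H"
    using H(1) by (auto simp: orientation_iff)
  interpret pair_digraph H by (rule pd)
  interpret block_partition "{..<n}" "n - 1" "\<lambda>x. min (x div m) ((n - 1) div m - 1)" m k
    by (rule block_partition_nat) (use assms in auto)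
  interpret random_embedding "{..<n}" "n - 1" "\<lambda>x. min (x div m) ((n - 1) div m - 1)" m k "pverts H" "parcs H"
  proof
    show "parcs H \<subseteq> pverts H \<times> pverts H" using in_arcsD1 in_arcsD2 by auto
    show "card {e \<in> parcs H. x \<in> ends e} \<le> k" for x by (rule degree_bound[OF H(1,3)])
  qed (use assms anti in auto)
  obtain A where A: "A \<in> tours" and ge: "fact n * (1 + \<epsilon> / 2 - 160 * (real k)\<^sup>2 / (real m - 1)
      - 60 * real ((4 * m + 1) ^ 4) * real k ^ 3 * real (8 * m) ^ 6 / real n) / 2 ^ card (parcs H)
    \<le> real (card {\<phi> \<in> bijections (pverts H) {..<n}. img \<phi> \<subseteq> A})"
    using exists_tour[of \<epsilon>] sum_pair_sign[OF H(1) refl] net m(4) by auto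
  have "num_copies \<lparr>pverts = {..<n}, parcs = A\<rparr> H \<le> max_copies H"
    by (rule num_copies_le_max_copies[OF regular_tournament_tour[OF A]]) (use H in auto)
  moreover have "num_copies \<lparr>pverts = {..<n}, parcs = A\<rparr> H =
      card {\<phi> \<in> bijections (pverts H) {..<n}. img \<phi> \<subseteq> A}"
    by (rule card_embeddings) auto
  ultimately show ?thesis using ge by (simp add: num_edges_def)
qed

theorem theorem3p1:
  fixes \<epsilon> :: real and k :: nat
  assumes "\<epsilon> > 0" and "k > 0"
  shows "\<exists>\<delta>::real. \<exists>N::nat. \<delta> > 0 \<and>
    (\<forall>(n::nat) (H :: 'a pair_pre_digraph).
      n > N \<longrightarrow> odd n \<longrightarrow> orientation H \<longrightarrow> card (pverts H) = n \<longrightarrow> max_degree H \<le> k \<longrightarrow>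
      real (num_c H) + (3 - \<epsilon>) * real (num_f H) - real (num_i H) - real (num_g H) \<ge> \<epsilon> * real n \<longrightarrow>
      real (max_copies H) \<ge> (1 + \<delta>) * fact n / 2 ^ num_edges H)"
proof -
  obtain l :: nat where l: "160 * (real k)\<^sup>2 / (\<epsilon> / 8) < real l" using reals_Archimedean2 by blast
  \<comment> \<open>Even, larger than \<open>8 * k\<close>, and with \<open>m - 1\<close> at least
    \<open>l\<close>, which brings the quadratic error below \<open>\<epsilon> / 8\<close>.\<close>
  define m where "m = 8 * k + 2 * l + 2"
  have m: "even m" "8 * k < m" by (simp_all add: m_def)
  have "160 * (real k)\<^sup>2 / (\<epsilon> / 8) \<le> real m - 1" using l by (simp add: m_def)
  then have m_err: "160 * (real k)\<^sup>2 / (real m - 1) \<le> \<epsilon> / 8"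
    using assms by (simp add: m_def field_simps)
  \<comment> \<open>\<open>K\<close> is determined by \<open>m\<close> and \<open>k\<close>, so the
    threshold for \<open>n\<close> can be chosen after \<open>m\<close>.\<close>
  define K where "K = 60 * real ((4 * m + 1) ^ 4) * real k ^ 3 * real (8 * m) ^ 6"
  obtain N0 :: nat where N0: "K / (\<epsilon> / 8) < real N0" using reals_Archimedean2 by blast
  have "(1 + \<epsilon> / 4) * fact n / 2 ^ num_edges H \<le> real (max_copies H)"
    if n: "4 * m + N0 < n" "odd n" and H: "orientation H" "card (pverts H) = n" "max_degree H \<le> k"
      and net: "\<epsilon> * real n \<le> real (num_c H) + (3 - \<epsilon>) * real (num_f H) - real (num_i H) - real (num_g H)"
    for n and H :: "'a pair_pre_digraph"
  proof -
    have "K / (\<epsilon> / 8) \<le> real n" using N0 n by linarith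
    then have n_err: "K / real n \<le> \<epsilon> / 8" using assms n by (simp add: field_simps)
    \<comment> \<open>Adding this nonnegative term to the assumption gives coefficient 3 for
      \<open>num_f H\<close>, and the right-hand side becomes the net number of adjacent
      pairs.\<close>
    have "0 \<le> \<epsilon> * real (num_f H)" using assms by simp
    then have "\<epsilon> * real n \<le> real (num_c H) + 3 * real (num_f H) - real (num_i H) - real (num_g H)"
      using net by (simp add: left_diff_distrib)
    then have "fact n * (1 + \<epsilon> / 2 - 160 * (real k)\<^sup>2 / (real m - 1) - K / real n) / 2 ^ num_edges H
        \<le> real (max_copies H)"
      unfolding K_def by (intro max_copies_ge) (use H n m assms in auto)
    \<comment> \<open>The gain \<open>\<epsilon> / 2\<close> minus two errors of at most
      \<open>\<epsilon> / 8\<close> each leaves \<open>\<epsilon> / 4\<close>.\<close>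
    moreover have "(1 + \<epsilon> / 4) * fact n / 2 ^ num_edges H \<le>
        fact n * (1 + \<epsilon> / 2 - 160 * (real k)\<^sup>2 / (real m - 1) - K / real n) / 2 ^ num_edges H"
      unfolding mult.commute[of _ "fact n"] using m_err n_err by (intro divide_right_mono mult_left_mono) auto
    ultimately show ?thesis by linarith
  qed
  then show ?thesis using assms by (intro exI[of _ "\<epsilon> / 4"] exI[of _ "4 * m + N0"]) auto
qed

end
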